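(* For every integer $m \geq 2$, it is decidable whether a given regular language $L \subseteq A^*$ over a finite alphabet $A$ belongs to $\mathcal{W}_m$.
   Context: A regular language is given as input, e.g., by a finite automaton. A monomial over a class of languages $\mathcal{V}$ is a language of the form $L = L_0 a_1 L_1 \cdots a_k L_k$ with $k \geq 0$, letters $a_i \in A$ and $L_i \in \mathcal{V}$. It is deterministic if for every $u \in L$ and every $i \in \{1,\ldots,k\}$ there is a unique prefix of $u$ which is in $L_0 a_1 \cdots L_{i-1} a_i$; it is codeterministic if for every $u \in L$ and every $i \in \{1,\ldots,k\}$ there is a unique suffix of $u$ in $a_i L_i \cdots a_k L_k$. $\mathcal{W}_1$ is the class of all Boolean combinations of languages $B^*$ with $B \subseteq A$, and for $m \geq 1$, $\mathcal{W}_{m+1}$ consists of all Boolean combinations of deterministic monomials over $\mathcal{W}_m$ and codeterministic monomials over $\mathcal{W}_m$. *)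

theory Defs
  imports Main "HOL-Library.Sublist" "HOL-Library.Nat_Bijection"
begin

section \<open>Boolean combinations and monomials\<close>

inductive_set boolean_combinations :: "'a set \<Rightarrow> 'a set set \<Rightarrow> 'a set set"
  for U :: "'a set" and G :: "'a set set" where
  generator: "L \<in> G \<Longrightarrow> L \<in> boolean_combinations U G"
| complement: "L \<in> boolean_combinations U G \<Longrightarrow> U - L \<in> boolean_combinations U G"
| union: "K \<in> boolean_combinations U G \<Longrightarrow> L \<in> boolean_combinations U G \<Longrightarrow>
    K \<union> L \<in> boolean_combinations U G"
| intersection: "K \<in> boolean_combinations U G \<Longrightarrow> L \<in> boolean_combinations U G \<Longrightarrow>
    K \<inter> L \<in> boolean_combinations U G"

text \<open>
  The expression \<open>L\<^sub>0 a\<^sub>1 L\<^sub>1 \<dots> a\<^sub>k L\<^sub>k\<close> is represented by \<open>L\<^sub>0\<close> and the list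
  \<open>[(a\<^sub>1, L\<^sub>1), \<dots>, (a\<^sub>k, L\<^sub>k)]\<close>. Determinism depends on the expression and not only on
  the language it denotes.
\<close>

fun monomial :: "'a list set \<Rightarrow> ('a \<times> 'a list set) list \<Rightarrow> 'a list set" where
  "monomial L [] = L"
| "monomial L ((a, K) # ps) = {u @ a # v |u v. u \<in> L \<and> v \<in> monomial K ps}"

text \<open>
  List positions start at \<open>0\<close>: position \<open>i\<close> holds \<open>(a\<^bsub>i+1\<^esub>, L\<^bsub>i+1\<^esub>)\<close>, so the two functions
  below denote \<open>L\<^sub>0 a\<^sub>1 \<dots> L\<^sub>i a\<^bsub>i+1\<^esub>\<close> and \<open>a\<^bsub>i+1\<^esub> L\<^bsub>i+1\<^esub> \<dots> a\<^sub>k L\<^sub>k\<close>.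
\<close>

definition left_factor :: "'a list set \<Rightarrow> ('a \<times> 'a list set) list \<Rightarrow> nat \<Rightarrow> 'a list set" where
  "left_factor L ps i = {u @ [fst (ps ! i)] |u. u \<in> monomial L (take i ps)}"

definition right_factor :: "('a \<times> 'a list set) list \<Rightarrow> nat \<Rightarrow> 'a list set" where
  "right_factor ps i = {fst (ps ! i) # v |v. v \<in> monomial (snd (ps ! i)) (drop (Suc i) ps)}"

definition deterministic :: "'a list set \<Rightarrow> ('a \<times> 'a list set) list \<Rightarrow> bool" where
  "deterministic L ps \<longleftrightarrow>
    (\<forall>u \<in> monomial L ps. \<forall>i < length ps. \<exists>!p. prefix p u \<and> p \<in> left_factor L ps i)"

definition codeterministic :: "'a list set \<Rightarrow> ('a \<times> 'a list set) list \<Rightarrow> bool" where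
  "codeterministic L ps \<longleftrightarrow>
    (\<forall>u \<in> monomial L ps. \<forall>i < length ps. \<exists>!s. suffix s u \<and> s \<in> right_factor ps i)"

definition det_monomials :: "'a set \<Rightarrow> 'a list set set \<Rightarrow> 'a list set set" where
  "det_monomials A V = {monomial L ps |L ps.
     L \<in> V \<and> set ps \<subseteq> A \<times> V \<and> deterministic L ps}"

definition codet_monomials :: "'a set \<Rightarrow> 'a list set set \<Rightarrow> 'a list set set" where
  "codet_monomials A V = {monomial L ps |L ps.
     L \<in> V \<and> set ps \<subseteq> A \<times> V \<and> codeterministic L ps}"

text \<open>The hierarchy starts at level \<open>1\<close>; the value at \<open>0\<close> is a dummy.\<close>

fun W :: "'a set \<Rightarrow> nat \<Rightarrow> 'a list set set" where
  "W A 0 = {}"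
| "W A (Suc 0) = boolean_combinations (lists A) {lists B |B. B \<subseteq> A}"
| "W A (Suc (Suc m)) = boolean_combinations (lists A)
     (det_monomials A (W A (Suc m)) \<union> codet_monomials A (W A (Suc m)))"


section \<open>Finite automata\<close>

text \<open>
  Nondeterministic automata whose states and letters are natural numbers, so that they are
  finite data. There is no well-formedness condition: the states are the numbers that occur,
  and a transition whose letter is not in the alphabet is never used.
\<close>

record automaton =
  alphabet :: "nat list"
  initial :: "nat list"
  final :: "nat list"
  transitions :: "(nat \<times> nat \<times> nat) list"

fun run :: "('q \<times> 'a \<times> 'q) set \<Rightarrow> 'q \<Rightarrow> 'a list \<Rightarrow> 'q \<Rightarrow> bool" where
  "run T p [] q \<longleftrightarrow> p = q"
| "run T p (a # w) q \<longleftrightarrow> (\<exists>r. (p, a, r) \<in> T \<and> run T r w q)"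

definition language :: "automaton \<Rightarrow> nat list set" where
  "language M = {w \<in> lists (set (alphabet M)).
     \<exists>p \<in> set (initial M). \<exists>q \<in> set (final M). run (set (transitions M)) p w q}"

definition transition_code :: "nat \<times> nat \<times> nat \<Rightarrow> nat" where
  "transition_code t = (case t of (p, a, q) \<Rightarrow> prod_encode (p, prod_encode (a, q)))"

definition automaton_code :: "automaton \<Rightarrow> nat" where
  "automaton_code M = list_encode
     [list_encode (alphabet M), list_encode (initial M), list_encode (final M),
      list_encode (map transition_code (transitions M))]"

lemma inj_transition_code: "inj transition_code"
  by (auto simp: inj_def transition_code_def)

lemma inj_automaton_code: "inj automaton_code"
  by (rule injI)
    (simp add: automaton_code_def list_encode_eq inj_map_eq_map[OF inj_transition_code])


section \<open>Decidability\<close>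

text \<open>
  \<open>general_recursive n f\<close>: the restriction of \<open>f\<close> to lists of length \<open>n\<close> is a total
  recursive function of \<open>n\<close> arguments. Minimisation is restricted to regular functions,
  so that all functions are total.
\<close>

inductive general_recursive :: "nat \<Rightarrow> (nat list \<Rightarrow> nat) \<Rightarrow> bool" where
  zero: "general_recursive n (\<lambda>xs. 0)"
| successor: "general_recursive 1 (\<lambda>xs. Suc (xs ! 0))"
| projection: "i < n \<Longrightarrow> general_recursive n (\<lambda>xs. xs ! i)"
| composition: "general_recursive (length gs) f \<Longrightarrow> (\<forall>g \<in> set gs. general_recursive n g) \<Longrightarrow>
    general_recursive n (\<lambda>xs. f (map (\<lambda>g. g xs) gs))"
| primitive_recursion: "general_recursive n f \<Longrightarrow> general_recursive (Suc (Suc n)) g \<Longrightarrow>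
    general_recursive (Suc n)
      (\<lambda>xs. rec_nat (f (tl xs)) (\<lambda>y r. g (y # r # tl xs)) (hd xs))"
| minimisation: "general_recursive (Suc n) f \<Longrightarrow>
    (\<forall>xs. length xs = n \<longrightarrow> (\<exists>y. f (y # xs) = 0)) \<Longrightarrow>
    general_recursive n (\<lambda>xs. LEAST y. f (y # xs) = 0)"

definition decidable :: "('a \<Rightarrow> nat) \<Rightarrow> ('a \<Rightarrow> bool) \<Rightarrow> bool" where
  "decidable code P \<longleftrightarrow>
    (\<exists>f. general_recursive 1 f \<and> (\<forall>x. f [code x] = (if P x then 1 else 0)))"

end

theory Submission
  imports Defs "HOL-Library.FuncSet"
begin

text \<open>
  Write \<open>u \<sim> v\<close> at level \<open>k\<close> and depth \<open>n\<close> if \<open>u\<close> and \<open>v\<close> have the same letters and, after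
  cutting both at the first occurrence of any letter, the parts before the cut are related at
  level \<open>k - 1\<close> when read from the right, and the parts after it at level \<open>k\<close>, both at depth
  \<open>n - 1\<close>.
  A language is in the hierarchy at level \<open>k + 1\<close> iff it is saturated, for some \<open>n\<close>, under the
  conjunction of this relation and its mirror image.

  For a regular language this is equivalent to identities of its syntactic congruence: a large
  power of \<open>e\<close> absorbs every word over the letters of \<open>e\<close>, and \<open>s\<close> may be deleted from
  \<open>e\<^sub>1\<^sup>N \<dots> e\<^sub>k\<^sup>N s f\<^sub>k\<^sup>N \<dots> f\<^sub>1\<^sup>N\<close> whenever \<open>e\<^sub>i\<close> and \<open>f\<^sub>i\<close> contain all letters of the word that
  they enclose. Determinism of a monomial forbids a marker inside the scope of an absorbing power,
  so the languages of the hierarchy satisfy the identities. Conversely, cut related words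
  \<open>u\<close> and \<open>v\<close> where the class of a prefix strictly drops from the left or the class of a suffix
  strictly drops from the right. Each factor between consecutive cuts is then surrounded by
  absorbing powers, and can be exchanged by the identities one level below.

  The identities need only be checked for words whose length is bounded by the number of
  classes, which bounds the sufficient exponent \<open>N\<close> as well; this is a finite computation.
\<close>

section \<open>Powers of words and mirror images\<close>

text \<open>The obstacle is that cuts from the left and from the right may cross. If the decisive
  last \<open>b\<close> lies before the decisive first \<open>a\<close>, the factor between them
  belongs to a part that was cut off on either side, and such parts are compared one level lower
  only. This loss is paid for by one pair e_i, f_i of the identities: no letter of such a factor
  lowers the class from the left or from the right, so absorbing powers can be put around it. In the
  induction on the level the congruence is therefore coarsened: words are identified if they agree
  between all absorbing powers whose letters include everything enclosed. The coarser congruence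
  satisfies the identities with one pair less. The number of cuts is bounded because every cut
  shrinks a right or left ideal of the finite quotient; this gives the depth n. The exponent can be
  fixed in advance: if K bounds the number of classes, two of the powers of \<open>e\<close> up to K
  agree, the powers are periodic from there on, and absorption makes the period trivial.\<close>

definition word_pow :: "'a list \<Rightarrow> nat \<Rightarrow> 'a list" where
  "word_pow w n = concat (replicate n w)"

lemma word_pow_0 [simp]: "word_pow w 0 = []"
  by (simp add: word_pow_def)

lemma word_pow_Suc: "word_pow w (Suc n) = w @ word_pow w n"
  by (simp add: word_pow_def)

lemma word_pow_add: "word_pow w (m + n) = word_pow w m @ word_pow w n"
  by (induction m) (simp_all add: word_pow_Suc)

lemma word_pow_commute: "word_pow w m @ word_pow w n = word_pow w n @ word_pow w m"
  by (metis add.commute word_pow_add)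

lemma word_pow_Suc2: "word_pow w (Suc n) = word_pow w n @ w"
  using word_pow_add[of w n 1] by (simp add: word_pow_Suc)

lemma rev_word_pow: "rev (word_pow w n) = word_pow (rev w) n"
  by (induction n) (simp, simp only: word_pow_Suc2[of "rev w"] word_pow_Suc[of w] rev_append)

lemma set_word_pow: "set (word_pow w n) = (if n = 0 then {} else set w)"
  by (induction n) (auto simp: word_pow_Suc)

lemma set_word_pow_subset: "set (word_pow w n) \<subseteq> set w"
  by (simp add: set_word_pow)

lemma word_pow_in_lists: "w \<in> lists A \<Longrightarrow> word_pow w n \<in> lists A"
  by (induction n) (auto simp: word_pow_Suc)

lemma first_occurrence:
  assumes "a \<in> set u"
  obtains u0 u1 where "u = u0 @ a # u1" "a \<notin> set u0"
  using assms by (meson split_list_first)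

lemma first_occurrence_unique:
  assumes "u0 @ a # u1 = v0 @ a # v1" "a \<notin> set u0" "a \<notin> set v0"
  shows "u0 = v0 \<and> u1 = v1"
  using assms by (auto simp: append_eq_append_conv2 append_eq_Cons_conv Cons_eq_append_conv)

lemma last_occurrence:
  assumes "a \<in> set u"
  obtains u0 u1 where "u = u0 @ a # u1" "a \<notin> set u1"
  using assms by (meson split_list_last)

lemma last_occurrence_unique:
  assumes "u0 @ a # u1 = v0 @ a # v1" "a \<notin> set u1" "a \<notin> set v1"
  shows "u0 = v0 \<and> u1 = v1"
proof -
  have "rev u1 @ a # rev u0 = rev v1 @ a # rev v0"
    using arg_cong[OF assms(1), of rev] by simp
  then show ?thesis using first_occurrence_unique assms(2,3) by (metis rev_is_rev_conv set_rev)
qed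

lemma first_outside:
  assumes "\<not> set u \<subseteq> S"
  obtains u0 a u1 where "u = u0 @ a # u1" "set u0 \<subseteq> S" "a \<notin> S" "a \<notin> set u0"
proof -
  obtain x where "x \<in> set u" "x \<notin> S" using assms by blast
  then obtain u0 a u1 where "u = u0 @ a # u1" "a \<notin> S" "\<forall>y\<in>set u0. \<not> y \<notin> S"
    using split_list_first_prop[of u "\<lambda>y. y \<notin> S"] by blast
  then show ?thesis using that by blast
qed

lemma rev_image_rev_image [simp]: "rev ` rev ` L = L"
  by (simp add: image_comp)

lemma in_rev_image_iff: "w \<in> rev ` L \<longleftrightarrow> rev w \<in> L"
  by (metis image_iff rev_rev_ident)

lemma rev_image_lists [simp]: "rev ` lists A = lists A"
  by (auto simp: in_rev_image_iff)

section \<open>Monomials\<close>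

lemma monomial_ConsI:
  "u \<in> L \<Longrightarrow> v \<in> monomial K ps \<Longrightarrow> u @ a # v \<in> monomial L ((a, K) # ps)"
  by auto

lemma monomial_append:
  "monomial L (ps @ [(a, K)]) = {u @ a # v |u v. u \<in> monomial L ps \<and> v \<in> K}"
proof (induction ps arbitrary: L)
  case Nil
  then show ?case by simp
next
  case (Cons p ps)
  obtain b M where p: "p = (b, M)" by fastforce
  show ?case
  proof (intro set_eqI iffI)
    fix w assume "w \<in> monomial L ((p # ps) @ [(a, K)])"
    then obtain x y z where "w = x @ b # y @ a # z" "x \<in> L" "y \<in> monomial M ps" "z \<in> K"
      by (auto simp: p Cons.IH)
    then have "x @ b # y \<in> monomial L (p # ps)" "w = (x @ b # y) @ a # z"
      by (auto simp: p)
    then show "w \<in> {u @ a # v |u v. u \<in> monomial L (p # ps) \<and> v \<in> K}"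
      using \<open>z \<in> K\<close> by blast
  next
    fix w assume "w \<in> {u @ a # v |u v. u \<in> monomial L (p # ps) \<and> v \<in> K}"
    then obtain x y z where "w = x @ b # y @ a # z" "x \<in> L" "y \<in> monomial M ps" "z \<in> K"
      by (auto simp: p)
    then have "y @ a # z \<in> monomial M (ps @ [(a, K)])" "w = x @ b # (y @ a # z)"
      by (auto simp: Cons.IH)
    then show "w \<in> monomial L ((p # ps) @ [(a, K)])"
      using \<open>x \<in> L\<close> monomial_ConsI[of x L "y @ a # z" M "ps @ [(a, K)]" b] by (simp add: p)
  qed
qed

text \<open>Determinism belongs to the expression, so the expression itself has to be mirrored. Its
  last factor becomes the leading one, and each letter is paired with the factor that stood before
  it.\<close>

fun mirror_head :: "'a list set \<Rightarrow> ('a \<times> 'a list set) list \<Rightarrow> 'a list set" where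
  "mirror_head L [] = rev ` L"
| "mirror_head L ((a, K) # ps) = mirror_head K ps"

fun mirror_tail :: "'a list set \<Rightarrow> ('a \<times> 'a list set) list \<Rightarrow> ('a \<times> 'a list set) list" where
  "mirror_tail L [] = []"
| "mirror_tail L ((a, K) # ps) = mirror_tail K ps @ [(a, rev ` L)]"

lemma length_mirror_tail [simp]: "length (mirror_tail L ps) = length ps"
  by (induction L ps rule: mirror_tail.induct) auto

lemma rev_image_marked_product:
  "rev ` {u @ a # v |u v. u \<in> X \<and> v \<in> Y} = {u @ a # v |u v. u \<in> rev ` Y \<and> v \<in> rev ` X}"
proof (intro set_eqI iffI)
  fix w assume "w \<in> rev ` {u @ a # v |u v. u \<in> X \<and> v \<in> Y}"
  then obtain u v where "w = rev v @ a # rev u" "u \<in> X" "v \<in> Y" by auto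
  then show "w \<in> {u @ a # v |u v. u \<in> rev ` Y \<and> v \<in> rev ` X}" by blast
next
  fix w assume "w \<in> {u @ a # v |u v. u \<in> rev ` Y \<and> v \<in> rev ` X}"
  then obtain u v where "w = rev (u @ a # v)" "u \<in> X" "v \<in> Y" by auto
  then show "w \<in> rev ` {u @ a # v |u v. u \<in> X \<and> v \<in> Y}" by blast
qed

lemma monomial_mirror: "monomial (mirror_head L ps) (mirror_tail L ps) = rev ` monomial L ps"
proof (induction L ps rule: mirror_tail.induct)
  case (1 L)
  then show ?case by simp
next
  case (2 L a K ps)
  have "monomial (mirror_head L ((a, K) # ps)) (mirror_tail L ((a, K) # ps)) =
    {u @ a # v |u v. u \<in> rev ` monomial K ps \<and> v \<in> rev ` L}"
    by (simp add: monomial_append 2)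
  also have "\<dots> = rev ` monomial L ((a, K) # ps)"
    by (simp only: monomial.simps rev_image_marked_product)
  finally show ?case .
qed

lemma mirror_append:
  "mirror_head L (ps @ [(a, K)]) = rev ` K"
  "mirror_tail L (ps @ [(a, K)]) = (a, mirror_head L ps) # mirror_tail L ps"
  by (induction L ps rule: mirror_tail.induct) auto

lemma mirror_mirror:
  "mirror_head (mirror_head L ps) (mirror_tail L ps) = L \<and>
   mirror_tail (mirror_head L ps) (mirror_tail L ps) = ps"
  by (induction L ps rule: mirror_tail.induct) (auto simp: mirror_append)

lemma left_factor_mirror:
  assumes "i < length ps"
  shows "left_factor (mirror_head L ps) (mirror_tail L ps) i =
    rev ` right_factor ps (length ps - Suc i)"
  using assms
proof (induction L ps rule: mirror_tail.induct)
  case (1 L)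
  then show ?case by simp
next
  case (2 L a K ps)
  show ?case
  proof (cases "i < length ps")
    case True
    then have "right_factor ((a, K) # ps) (length ((a, K) # ps) - Suc i) =
        right_factor ps (length ps - Suc i)"
      by (simp add: right_factor_def Suc_diff_Suc[symmetric])
    moreover have "left_factor (mirror_head L ((a, K) # ps)) (mirror_tail L ((a, K) # ps)) i =
        left_factor (mirror_head K ps) (mirror_tail K ps) i"
      using True by (simp add: left_factor_def nth_append)
    ultimately show ?thesis using 2 True by simp
  next
    case False
    then have i: "i = length ps" using 2 by simp
    have "rev ` {a # v |v. v \<in> monomial K ps} = {u @ [a] |u. u \<in> rev ` monomial K ps}"
      using rev_image_marked_product[of a "{[]}" "monomial K ps"] by simp
    then show ?thesis
      by (simp add: i left_factor_def right_factor_def nth_append monomial_mirror)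
  qed
qed

lemma Ex1_rev:
  fixes X :: "'a list set"
  shows "(\<exists>!p. prefix p (rev u) \<and> p \<in> rev ` X) \<longleftrightarrow> (\<exists>!s. suffix s u \<and> s \<in> X)"
proof -
  have *: "prefix p (rev u) \<and> p \<in> rev ` X \<longleftrightarrow> suffix (rev p) u \<and> rev p \<in> X" for p
    by (simp add: suffix_to_prefix in_rev_image_iff)
  have "(\<exists>!p. Q (rev p)) \<longleftrightarrow> (\<exists>!s. Q s)" for Q :: "'a list \<Rightarrow> bool"
  proof
    assume "\<exists>!p. Q (rev p)"
    then obtain p where p: "Q (rev p)" "\<And>p'. Q (rev p') \<Longrightarrow> p' = p" by blast
    show "\<exists>!s. Q s"
    proof (rule ex1I[of _ "rev p"])
      show "s = rev p" if "Q s" for s using p(2)[of "rev s"] that by auto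
    qed (rule p(1))
  next
    assume "\<exists>!s. Q s"
    then obtain s where s: "Q s" "\<And>s'. Q s' \<Longrightarrow> s' = s" by blast
    show "\<exists>!p. Q (rev p)"
    proof (rule ex1I[of _ "rev s"])
      show "p = rev s" if "Q (rev p)" for p using s(2)[OF that] by (metis rev_rev_ident)
    qed (use s(1) in simp)
  qed
  then show ?thesis unfolding * .
qed

lemma all_less_reflect: "(\<forall>i<n. P (n - Suc i)) \<longleftrightarrow> (\<forall>i<n. P i)" for n :: nat
proof (intro iffI allI impI)
  fix i assume P: "\<forall>i<n. P (n - Suc i)" and "i < n"
  have "n - Suc i < n" using \<open>i < n\<close> by simp
  with P have "P (n - Suc (n - Suc i))" by blast
  moreover have "n - Suc (n - Suc i) = i" using \<open>i < n\<close> by simp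
  ultimately show "P i" by simp
qed simp

lemma deterministic_mirror:
  "deterministic (mirror_head L ps) (mirror_tail L ps) \<longleftrightarrow> codeterministic L ps"
proof -
  have "(\<forall>i<length ps. \<exists>!p. prefix p (rev u) \<and>
      p \<in> left_factor (mirror_head L ps) (mirror_tail L ps) i) \<longleftrightarrow>
    (\<forall>i<length ps. \<exists>!s. suffix s u \<and> s \<in> right_factor ps i)" for u
  proof -
    have "(\<forall>i<length ps. \<exists>!p. prefix p (rev u) \<and>
        p \<in> left_factor (mirror_head L ps) (mirror_tail L ps) i) \<longleftrightarrow>
      (\<forall>i<length ps. \<exists>!s. suffix s u \<and> s \<in> right_factor ps (length ps - Suc i))"
      by (simp add: left_factor_mirror Ex1_rev)
    also have "\<dots> \<longleftrightarrow> (\<forall>i<length ps. \<exists>!s. suffix s u \<and> s \<in> right_factor ps i)"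
      by (rule all_less_reflect)
    finally show ?thesis .
  qed
  then show ?thesis
    unfolding deterministic_def codeterministic_def monomial_mirror by simp
qed

lemma codeterministic_mirror:
  "codeterministic (mirror_head L ps) (mirror_tail L ps) \<longleftrightarrow> deterministic L ps"
  using deterministic_mirror[of "mirror_head L ps" "mirror_tail L ps"] by (simp add: mirror_mirror)

lemma mirror_in:
  assumes "L \<in> V" "set ps \<subseteq> A \<times> V" "(`) rev ` V \<subseteq> V"
  shows "mirror_head L ps \<in> V \<and> set (mirror_tail L ps) \<subseteq> A \<times> V"
  using assms by (induction L ps rule: mirror_tail.induct) auto

lemma rev_det_monomials:
  assumes "(`) rev ` V \<subseteq> V" "L \<in> det_monomials A V"
  shows "rev ` L \<in> codet_monomials A V"
proof -
  obtain L0 ps where L: "L = monomial L0 ps" "L0 \<in> V" "set ps \<subseteq> A \<times> V" "deterministic L0 ps"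
    using assms(2) by (auto simp: det_monomials_def)
  then show ?thesis
    using mirror_in[OF L(2,3) assms(1)] codeterministic_mirror[of L0 ps] monomial_mirror[of L0 ps]
    unfolding codet_monomials_def by blast
qed

lemma rev_codet_monomials:
  assumes "(`) rev ` V \<subseteq> V" "L \<in> codet_monomials A V"
  shows "rev ` L \<in> det_monomials A V"
proof -
  obtain L0 ps where L: "L = monomial L0 ps" "L0 \<in> V" "set ps \<subseteq> A \<times> V" "codeterministic L0 ps"
    using assms(2) by (auto simp: codet_monomials_def)
  then show ?thesis
    using mirror_in[OF L(2,3) assms(1)] deterministic_mirror[of L0 ps] monomial_mirror[of L0 ps]
    unfolding det_monomials_def by blast
qed

section \<open>The levels under reversal, inclusion and restriction to the alphabet\<close>

lemma rev_boolean_combinations: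
  assumes "L \<in> boolean_combinations (lists A) G"
  shows "rev ` L \<in> boolean_combinations (lists A) ((`) rev ` G)"
  using assms
proof induction
  case (generator L)
  then show ?case by (blast intro: boolean_combinations.generator)
next
  case (complement L)
  have "rev ` (lists A - L) = lists A - rev ` L"
    by (subst image_set_diff) (auto simp: inj_on_def)
  then show ?case using complement by (simp add: boolean_combinations.complement)
next
  case (union K L)
  then show ?case by (simp add: image_Un boolean_combinations.union)
next
  case (intersection K L)
  have "rev ` (K \<inter> L) = rev ` K \<inter> rev ` L"
    by (rule image_Int) (auto simp: inj_on_def)
  then show ?case using intersection by (simp add: boolean_combinations.intersection)
qed

lemma boolean_combinations_mono:
  assumes "L \<in> boolean_combinations U G" "G \<subseteq> H"
  shows "L \<in> boolean_combinations U H"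
  using assms by (induction) (auto intro: boolean_combinations.intros)

lemma rev_W: "L \<in> W A m \<Longrightarrow> rev ` L \<in> W A m"
proof (induction A m arbitrary: L rule: W.induct)
  case (1 A)
  then show ?case by simp
next
  case (2 A)
  have "rev ` L \<in> boolean_combinations (lists A) ((`) rev ` {lists B |B. B \<subseteq> A})"
    using 2 unfolding W.simps by (rule rev_boolean_combinations)
  then have "rev ` L \<in> boolean_combinations (lists A) {lists B |B. B \<subseteq> A}"
    by (rule boolean_combinations_mono) (clarsimp, rule exI, rule conjI, rule refl)
  then show ?case by simp
next
  case (3 A m)
  let ?V = "W A (Suc m)"
  have V: "(`) rev ` ?V \<subseteq> ?V" using 3 by auto
  have "rev ` L \<in> boolean_combinations (lists A)
      ((`) rev ` (det_monomials A ?V \<union> codet_monomials A ?V))"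
    using "3.prems" unfolding W.simps by (rule rev_boolean_combinations)
  moreover have "(`) rev ` (det_monomials A ?V \<union> codet_monomials A ?V) \<subseteq>
      det_monomials A ?V \<union> codet_monomials A ?V"
    using rev_det_monomials[OF V] rev_codet_monomials[OF V] by blast
  ultimately show ?case
    unfolding W.simps by (rule boolean_combinations_mono)
qed

lemma W_Suc_mono: "L \<in> W A m \<Longrightarrow> L \<in> W A (Suc m)"
proof (cases m)
  case (Suc k)
  assume "L \<in> W A m"
  \<comment> \<open>A monomial without markers is vacuously deterministic.\<close>
  then have "L \<in> det_monomials A (W A (Suc k))"
    unfolding det_monomials_def
    by (auto simp: Suc deterministic_def intro!: exI[of _ L] exI[of _ "[]"])
  then show ?thesis by (auto simp: Suc intro: boolean_combinations.generator)
qed simp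

lemma boolean_combinations_subset:
  assumes "L \<in> boolean_combinations U G" "\<And>L. L \<in> G \<Longrightarrow> L \<subseteq> U"
  shows "L \<subseteq> U"
  using assms by induction auto

lemma monomial_subset_lists:
  assumes "L \<subseteq> lists A" "set ps \<subseteq> A \<times> V" "\<And>K. K \<in> V \<Longrightarrow> K \<subseteq> lists A"
  shows "monomial L ps \<subseteq> lists A"
  using assms by (induction L ps rule: monomial.induct) fastforce+

lemma W_subset_lists: "L \<in> W A m \<Longrightarrow> L \<subseteq> lists A"
proof (induction A m arbitrary: L rule: W.induct)
  case (1 A)
  then show ?case by simp
next
  case (2 A)
  then show ?case
    unfolding W.simps by (rule boolean_combinations_subset) (use lists_mono in blast)
next
  case (3 A m)
  have "K \<subseteq> lists A" if in_gen: "K \<in> det_monomials A (W A (Suc m)) \<union> codet_monomials A (W A (Suc m))" for K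
  proof -
    obtain L0 ps where K: "K = monomial L0 ps" "L0 \<in> W A (Suc m)" "set ps \<subseteq> A \<times> W A (Suc m)"
      using in_gen unfolding det_monomials_def codet_monomials_def by blast
    show ?thesis
      unfolding K(1) using monomial_subset_lists[OF 3(1)[OF K(2)] K(3)] 3(1) by blast
  qed
  then show ?case
    using "3.prems" unfolding W.simps by (rule boolean_combinations_subset[rotated])
qed

section \<open>Comparing words by first and last occurrences\<close>

text \<open>Only the reverse of \<open>u0\<close> is compared, since the comparison of
  \<open>u0\<close> from the left follows by \<open>sim_before_first\<close>, even at level
  \<open>Suc k\<close>. In terms of languages, \<open>u0\<close> ranges over the first factor of a
  deterministic product; that factor is one level lower, where \<open>rev_W\<close> makes mirrored
  classes available.\<close>

fun sim :: "nat \<Rightarrow> nat \<Rightarrow> 'a list \<Rightarrow> 'a list \<Rightarrow> bool" where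
  "sim 0 n u v \<longleftrightarrow> set u = set v"
| "sim (Suc k) 0 u v \<longleftrightarrow> set u = set v"
| "sim (Suc k) (Suc n) u v \<longleftrightarrow> set u = set v \<and>
    (\<forall>a u0 u1 v0 v1. u = u0 @ a # u1 \<longrightarrow> a \<notin> set u0 \<longrightarrow> v = v0 @ a # v1 \<longrightarrow> a \<notin> set v0 \<longrightarrow>
      sim k n (rev u0) (rev v0) \<and> sim (Suc k) n u1 v1)"

declare sim.simps(3) [simp del]

definition eqv :: "nat \<Rightarrow> nat \<Rightarrow> 'a list \<Rightarrow> 'a list \<Rightarrow> bool" where
  "eqv k n u v \<longleftrightarrow> sim k n u v \<and> sim k n (rev u) (rev v)"

lemma sim_set: "sim k n u v \<Longrightarrow> set u = set v"
  by (cases k; cases n) (auto simp: sim.simps(3))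

lemma sim_splitD:
  assumes "sim (Suc k) (Suc n) u v"
    "u = u0 @ a # u1" "a \<notin> set u0" "v = v0 @ a # v1" "a \<notin> set v0"
  shows "sim k n (rev u0) (rev v0)" "sim (Suc k) n u1 v1"
  using assms unfolding sim.simps by blast+

lemma sim_split:
  assumes "sim (Suc k) (Suc n) (u0 @ a # u1) (v0 @ a # v1)" "a \<notin> set u0" "a \<notin> set v0"
  shows "sim k n (rev u0) (rev v0)" "sim (Suc k) n u1 v1"
  using sim_splitD[OF assms(1) refl assms(2) refl assms(3)] .

lemma sim_SucI:
  assumes "set u = set v"
    and "\<And>a u0 u1 v0 v1. u = u0 @ a # u1 \<Longrightarrow> a \<notin> set u0 \<Longrightarrow> v = v0 @ a # v1 \<Longrightarrow> a \<notin> set v0 \<Longrightarrow>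
      sim k n (rev u0) (rev v0) \<and> sim (Suc k) n u1 v1"
  shows "sim (Suc k) (Suc n) u v"
  unfolding sim.simps using assms by blast

lemma sim_refl: "sim k n u u"
proof -
  have "sim k n u v" if "u = v" for v
    using that
  proof (induction k n u v rule: sim.induct)
    case (3 k n u v)
    show ?case
    proof (rule sim_SucI)
      fix a u0 u1 v0 v1
      assume *: "u = u0 @ a # u1" "a \<notin> set u0" "v = v0 @ a # v1" "a \<notin> set v0"
      then have "u0 @ a # u1 = v0 @ a # v1" using "3.prems" by simp
      from first_occurrence_unique[OF this *(2,4)] have "u0 = v0" "u1 = v1" by auto
      then show "sim k n (rev u0) (rev v0) \<and> sim (Suc k) n u1 v1"
        using "3.IH"(1)[OF *] "3.IH"(2)[OF *] by simp
    qed (use "3.prems" in simp)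
  qed auto
  then show ?thesis by simp
qed

lemma sim_Suc_imp: "sim k (Suc n) u v \<Longrightarrow> sim k n u v"
proof (induction k n u v rule: sim.induct)
  case (2 k u v)
  then show ?case using sim_set by fastforce
next
  case (3 k n u v)
  show ?case
  proof (rule sim_SucI)
    show "set u = set v" using "3.prems" sim_set by metis
  next
    fix a u0 u1 v0 v1
    assume *: "u = u0 @ a # u1" "a \<notin> set u0" "v = v0 @ a # v1" "a \<notin> set v0"
    have "sim k (Suc n) (rev u0) (rev v0)" "sim (Suc k) (Suc n) u1 v1"
      using sim_splitD[OF "3.prems" *] .
    then show "sim k n (rev u0) (rev v0) \<and> sim (Suc k) n u1 v1"
      using "3.IH"(1)[OF *] "3.IH"(2)[OF *] by simp
  qed
qed auto

lemma sim_mono: "n \<le> n' \<Longrightarrow> sim k n' u v \<Longrightarrow> sim k n u v"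
  by (induction rule: dec_induct) (auto dest: sim_Suc_imp)

lemma sim_level_imp: "sim (Suc k) n u v \<Longrightarrow> sim k n u v"
proof (induction k n u v rule: sim.induct)
  case (1 n u v)
  then show ?case using sim_set by fastforce
next
  case (2 k u v)
  then show ?case using sim_set by fastforce
next
  case (3 k n u v)
  show ?case
  proof (rule sim_SucI)
    show "set u = set v" using "3.prems" sim_set by metis
  next
    fix a u0 u1 v0 v1
    assume *: "u = u0 @ a # u1" "a \<notin> set u0" "v = v0 @ a # v1" "a \<notin> set v0"
    have "sim (Suc k) n (rev u0) (rev v0)" "sim (Suc (Suc k)) n u1 v1"
      using sim_splitD[OF "3.prems" *] .
    then show "sim k n (rev u0) (rev v0) \<and> sim (Suc k) n u1 v1"
      using "3.IH"(1)[OF *] "3.IH"(2)[OF *] by simp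
  qed
qed

section \<open>Short subsequences, a comparison that is invariant under reversal\<close>

definition same_subseqs :: "nat \<Rightarrow> 'a list \<Rightarrow> 'a list \<Rightarrow> bool" where
  "same_subseqs n u v \<longleftrightarrow> (\<forall>s. length s \<le> n \<longrightarrow> subseq s u = subseq s v)"

lemma subseq_rev_rev: "subseq s u \<Longrightarrow> subseq (rev s) (rev u)"
  by (induction rule: list_emb.induct)
    (auto intro: subseq_rev_drop_many list_emb_append_mono)

lemma same_subseqs_rev: "same_subseqs n (rev u) (rev v) \<longleftrightarrow> same_subseqs n u v"
proof -
  have *: "subseq s (rev w) \<longleftrightarrow> subseq (rev s) w" for s w :: "'a list"
    using subseq_rev_rev[of s "rev w"] subseq_rev_rev[of "rev s" w] by auto
  have "(\<forall>s. length s \<le> n \<longrightarrow> Q (rev s)) \<longleftrightarrow> (\<forall>s. length s \<le> n \<longrightarrow> Q s)"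
    for Q :: "'a list \<Rightarrow> bool"
    by (metis length_rev rev_rev_ident)
  then show ?thesis unfolding same_subseqs_def * .
qed

lemma same_subseqs_set: "same_subseqs (Suc n) u v \<Longrightarrow> set u = set v"
  unfolding same_subseqs_def
  by (metis One_nat_def Suc_le_mono le0 length_Cons list.size(3) subseq_singleton_left subsetI
      subset_antisym)

lemma subseq_first_occurrence:
  "a \<notin> set u0 \<Longrightarrow> subseq (a # s) (u0 @ a # u1) \<longleftrightarrow> subseq s u1"
  by (induction u0) (auto simp: subseq_Cons2_neq)

lemma same_subseqs_split:
  assumes "same_subseqs (Suc n) (u0 @ a # u1) (v0 @ a # v1)" "a \<notin> set u0" "a \<notin> set v0"
  shows "same_subseqs n u1 v1"
  unfolding same_subseqs_def
proof (intro allI impI)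
  fix s :: "'a list" assume "length s \<le> n"
  then have "subseq (a # s) (u0 @ a # u1) = subseq (a # s) (v0 @ a # v1)"
    using assms(1) by (simp add: same_subseqs_def)
  then show "subseq s u1 = subseq s v1"
    using assms(2,3) by (simp add: subseq_first_occurrence)
qed

text \<open>By leftmost embedding, \<open>a # t\<close> is a subsequence iff \<open>t\<close> is one
  of the part after the first \<open>a\<close>. Each cut accounts for one letter and the final
  comparison of contents for one more, hence length \<open>Suc n\<close> at depth
  \<open>n\<close>.\<close>

lemma sim_same_subseqs: "sim (Suc k) n u v \<Longrightarrow> same_subseqs (Suc n) u v"
proof (induction n arbitrary: u v)
  have *: "subseq s u = subseq s v" if "set u = set v" "length s \<le> Suc 0" for s u v :: "'a list"
    using that by (cases s) (auto simp: subseq_singleton_left)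
  {
    case 0
    then show ?case using * sim_set unfolding same_subseqs_def by metis
  next
    case (Suc n)
    show ?case unfolding same_subseqs_def
    proof (intro allI impI)
      fix s :: "'a list" assume s: "length s \<le> Suc (Suc n)"
      show "subseq s u = subseq s v"
      proof (cases s)
        case (Cons a t)
        show ?thesis
        proof (cases "a \<in> set u")
          case True
          moreover have "set u = set v" using Suc.prems sim_set by metis
          ultimately obtain u0 u1 v0 v1 where uv: "u = u0 @ a # u1" "a \<notin> set u0"
            "v = v0 @ a # v1" "a \<notin> set v0"
            by (metis first_occurrence)
          then have "same_subseqs (Suc n) u1 v1"
            using Suc.IH sim_splitD(2)[OF Suc.prems] by blast
          then show ?thesis
            using uv s by (simp add: Cons subseq_first_occurrence same_subseqs_def)
        next
          case False
          moreover have "set u = set v" using Suc.prems sim_set by metis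
          moreover have "\<not> subseq s w" if "a \<notin> set w" for w
            using that Cons list_emb_set[of "(=)" s w a] by auto
          ultimately show ?thesis by metis
        qed
      qed simp
    qed
  }
qed

text \<open>First occurrences in \<open>u0\<close> are first occurrences in the whole word, so the
  cuts of \<open>u0\<close> are available. The unit of depth that is lost serves for the cut at
  \<open>a\<close>, which shows at the end that the remaining contents agree.\<close>

lemma sim_before_first:
  assumes "sim (Suc k) (Suc n) (u0 @ a # u1) (v0 @ a # v1)" "a \<notin> set u0" "a \<notin> set v0"
  shows "sim (Suc k) n u0 v0"
  using assms
proof (induction n arbitrary: u0 v0)
  case 0
  then show ?case using sim_split(1) sim_set by fastforce
next
  case (Suc n)
  show ?case
  proof (rule sim_SucI)
    show "set u0 = set v0" using sim_split(1)[OF Suc.prems] sim_set by fastforce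
  next
    fix c x x' y y'
    assume *: "u0 = x @ c # x'" "c \<notin> set x" "v0 = y @ c # y'" "c \<notin> set y"
    have "sim (Suc k) (Suc (Suc n)) (x @ c # (x' @ a # u1)) (y @ c # (y' @ a # v1))"
      using Suc.prems(1) * by simp
    then have "sim k (Suc n) (rev x) (rev y)" "sim (Suc k) (Suc n) (x' @ a # u1) (y' @ a # v1)"
      using sim_split[OF _ *(2,4)] by blast+
    then show "sim k n (rev x) (rev y) \<and> sim (Suc k) n x' y'"
      using Suc.IH Suc.prems(2,3) * by (auto intro: sim_Suc_imp)
  qed
qed

text \<open>As in \<open>sim_before_first\<close>, but no marker ends \<open>u0\<close>, so the
  comparison of the long words does not tell where the prefixes end. Common subsequences supply the
  equality of contents after each cut.\<close>

lemma sim_prefix: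
  assumes "sim (Suc k) n (u0 @ r) (v0 @ r')" "same_subseqs (Suc n) u0 v0"
  shows "sim (Suc k) n u0 v0"
  using assms
proof (induction n arbitrary: u0 v0)
  case 0
  then show ?case using same_subseqs_set by fastforce
next
  case (Suc n)
  show ?case
  proof (rule sim_SucI)
    show "set u0 = set v0" using Suc.prems(2) same_subseqs_set by blast
  next
    fix c x x' y y'
    assume *: "u0 = x @ c # x'" "c \<notin> set x" "v0 = y @ c # y'" "c \<notin> set y"
    have "sim (Suc k) (Suc n) (x @ c # (x' @ r)) (y @ c # (y' @ r'))"
      using Suc.prems(1) * by simp
    then have "sim k n (rev x) (rev y)" "sim (Suc k) n (x' @ r) (y' @ r')"
      using sim_split[OF _ *(2,4)] by blast+
    moreover have "same_subseqs (Suc n) x' y'"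
      using same_subseqs_split[OF _ *(2,4)] Suc.prems(2) *(1,3) by blast
    ultimately show "sim k n (rev x) (rev y) \<and> sim (Suc k) n x' y'"
      using Suc.IH by blast
  qed
qed

section \<open>The two-sided comparison under cuts\<close>

lemma eqv_refl: "eqv k n u u"
  by (simp add: eqv_def sim_refl)

lemma eqv_mono: "eqv k n' u v \<Longrightarrow> n \<le> n' \<Longrightarrow> eqv k n u v"
  by (auto simp: eqv_def intro: sim_mono)

lemma eqv_level_imp: "eqv (Suc k) n u v \<Longrightarrow> eqv k n u v"
  by (auto simp: eqv_def intro: sim_level_imp)

lemma eqv_rev: "eqv k n (rev u) (rev v) \<longleftrightarrow> eqv k n u v"
  by (auto simp: eqv_def)

lemma eqv_set: "eqv k n u v \<Longrightarrow> set u = set v"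
  by (auto simp: eqv_def dest: sim_set)

lemma eqv_split:
  assumes "eqv (Suc k) (Suc n) (u0 @ a # u1) (v0 @ a # v1)" "a \<notin> set u0" "a \<notin> set v0"
  shows "eqv (Suc k) n u1 v1" and "eqv k n u0 v0"
proof -
  have *: "sim (Suc k) (Suc n) (u0 @ a # u1) (v0 @ a # v1)"
    using assms(1) by (simp add: eqv_def)
  then show "eqv k n u0 v0"
    using sim_split(1)[OF *] sim_before_first[OF *] assms(2,3) sim_level_imp
    by (auto simp: eqv_def)
  have 1: "sim (Suc k) n u1 v1" using sim_split(2)[OF *] assms(2,3) .
  \<comment> \<open>Read from the right, \<open>u1\<close> is a prefix whose end need not be the
    first \<open>a\<close> met in that direction. So \<open>sim_prefix\<close> is used, with the
    subsequences taken from the comparison \<open>1\<close> from the left.\<close>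
  have "sim (Suc k) n (rev u1 @ a # rev u0) (rev v1 @ a # rev v0)"
    using assms(1) by (auto simp: eqv_def intro: sim_Suc_imp)
  then have "sim (Suc k) n (rev u1) (rev v1)"
    using sim_prefix sim_same_subseqs[OF 1] same_subseqs_rev by metis
  then show "eqv (Suc k) n u1 v1" using 1 by (simp add: eqv_def)
qed

lemma eqv_split_last:
  assumes "eqv (Suc k) (Suc n) (u0 @ a # u1) (v0 @ a # v1)" "a \<notin> set u1" "a \<notin> set v1"
  shows "eqv (Suc k) n u0 v0" and "eqv k n u1 v1"
  using eqv_split[of k n "rev u1" a "rev u0" "rev v1" "rev v0"] assms eqv_rev
    eqv_rev[of "Suc k" "Suc n" "u0 @ a # u1" "v0 @ a # v1"]
  by auto

text \<open>If the last b lies before the first a, only one level of information is left between them.\<close>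

lemma eqv_between:
  assumes "eqv (Suc (Suc k)) (Suc (Suc n)) (x @ b # w @ a # u1) (y @ b # w' @ a # v1)"
    and "a \<notin> set (x @ b # w)" "a \<notin> set (y @ b # w')"
    and "b \<notin> set (w @ a # u1)" "b \<notin> set (w' @ a # v1)"
  shows "eqv (Suc k) n w w'"
proof -
  \<comment> \<open>Applying \<open>eqv_split\<close> and \<open>eqv_split_last\<close> in
    succession would lose two levels. \<open>sim_before_first\<close> keeps the level, but only for
    the direction in which its cut is made; the two orders of cutting supply the two
    directions.\<close>
  have "eqv (Suc k) (Suc n) (w @ a # u1) (w' @ a # v1)"
    using eqv_split_last(2)[OF assms(1)] assms by simp
  then have 1: "sim (Suc k) n w w'"
    using assms(2,3) by (auto simp: eqv_def intro: sim_before_first)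
  have "eqv (Suc k) (Suc n) (x @ b # w) (y @ b # w')"
    using eqv_split(2)[of "Suc k" "Suc n" "x @ b # w" a u1 "y @ b # w'" v1] assms by simp
  then have "sim (Suc k) (Suc n) (rev w @ b # rev x) (rev w' @ b # rev y)"
    by (simp add: eqv_def)
  then have "sim (Suc k) n (rev w) (rev w')"
    using assms(4,5) by (auto intro: sim_before_first)
  then show ?thesis using 1 by (simp add: eqv_def)
qed

section \<open>Congruences in which powers absorb their letters\<close>

lemma finite_image_if_kernel:
  assumes "finite (g ` S)" "\<And>x y. x \<in> S \<Longrightarrow> y \<in> S \<Longrightarrow> g x = g y \<Longrightarrow> f x = f y"
  shows "finite (f ` S)"
proof -
  have "f ` S \<subseteq> (\<lambda>z. f (SOME x. x \<in> S \<and> g x = z)) ` g ` S"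
  proof
    fix y assume "y \<in> f ` S"
    then obtain x where x: "x \<in> S" "y = f x" by blast
    let ?x = "SOME x'. x' \<in> S \<and> g x' = g x"
    have "?x \<in> S \<and> g ?x = g x" by (rule someI[of _ x]) (use x in simp)
    then have "f ?x = f x" using assms(2)[of ?x x] x(1) by simp
    then have "y = (\<lambda>z. f (SOME x. x \<in> S \<and> g x = z)) (g x)" using x(2) by simp
    then show "y \<in> (\<lambda>z. f (SOME x. x \<in> S \<and> g x = z)) ` g ` S"
      using x(1) by blast
  qed
  then show ?thesis using assms(1) finite_surj by blast
qed

text \<open>\<open>h\<close> stands for the quotient map onto a finite monoid; only its kernel
  matters, so the multiplication of the quotient is never made explicit.\<close>

locale absorbing =
  fixes A :: "'a set" and h :: "'a list \<Rightarrow> 'b" and N :: nat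
  assumes finite_A: "finite A"
    and cong: "h u = h v \<Longrightarrow> h (x @ u @ y) = h (x @ v @ y)"
    and finite_range: "finite (h ` lists A)"
    and absorb: "e \<in> lists A \<Longrightarrow> set s \<subseteq> set e \<Longrightarrow>
      h (word_pow e N @ s @ word_pow e N) = h (word_pow e N)"
begin

text \<open>The axioms are symmetric. Thus \<open>stab\<close> and \<open>rank\<close>, which are
  about prefixes, also yield the notions for suffixes.\<close>

lemma absorbing_rev: "absorbing A (\<lambda>w. h (rev w)) N"
proof
  show "finite A" by (rule finite_A)
next
  fix u v x y assume "h (rev u) = h (rev v)"
  then show "h (rev (x @ u @ y)) = h (rev (x @ v @ y))"
    using cong[of "rev u" "rev v" "rev y" "rev x"] by simp
next
  have "(\<lambda>w. h (rev w)) ` lists A = h ` rev ` lists A" by (simp only: image_image)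
  then show "finite ((\<lambda>w. h (rev w)) ` lists A)" using finite_range by simp
next
  fix e s assume "e \<in> lists A" "set s \<subseteq> set e"
  then show "h (rev (word_pow e N @ s @ word_pow e N)) = h (rev (word_pow e N))"
    using absorb[of "rev e" "rev s"] by (simp add: rev_word_pow in_lists_conv_set)
qed

lemma cong_left: "h u = h v \<Longrightarrow> h (u @ y) = h (v @ y)"
  using cong[of u v "[]" y] by simp

lemma cong_right: "h u = h v \<Longrightarrow> h (x @ u) = h (x @ v)"
  using cong[of u v x "[]"] by simp

lemma absorb_ctx:
  assumes "e \<in> lists A" "set s \<subseteq> set e"
  shows "h (p @ word_pow e N @ s @ word_pow e N @ q) = h (p @ word_pow e N @ q)"
  using cong[OF absorb[OF assms], of p q] by simp

text \<open>The letters that do not leave the R-class of \<open>p\<close>, in the sense of Green's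
  relations.\<close>

definition stab :: "'a list \<Rightarrow> 'a set" where
  "stab p = {a \<in> A. \<exists>x \<in> lists A. h (p @ a # x) = h p}"

text \<open>The size of the right ideal generated by the class of \<open>p\<close>.\<close>

definition rank :: "'a list \<Rightarrow> nat" where
  "rank p = card (h ` (@) p ` lists A)"

lemma stab_word_pow:
  assumes "h (p @ e) = h p"
  shows "h (p @ word_pow e n) = h p"
proof (induction n)
  case (Suc n)
  have "h (p @ word_pow e (Suc n)) = h ((p @ e) @ word_pow e n)"
    by (simp add: word_pow_Suc)
  also have "\<dots> = h (p @ word_pow e n)" by (rule cong_left) (rule assms)
  finally show ?case using Suc by simp
qed simp

text \<open>Loops at the class of \<open>p\<close> compose, so one loop through each letter of
  \<open>stab p\<close> gives a single loop through all of them.\<close>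

lemma stab_word:
  obtains e where "e \<in> lists A" "stab p \<subseteq> set e" "h (p @ e) = h p"
proof -
  have "finite (stab p)" using finite_A by (simp add: stab_def)
  moreover have "stab p \<subseteq> stab p" ..
  ultimately have "\<exists>e \<in> lists A. stab p \<subseteq> set e \<and> h (p @ e) = h p"
  proof (induction rule: finite_subset_induct')
    case empty
    then show ?case by (intro bexI[of _ "[]"]) auto
  next
    case (insert a F)
    then obtain e where e: "e \<in> lists A" "F \<subseteq> set e" "h (p @ e) = h p" by blast
    obtain x where x: "x \<in> lists A" "h (p @ a # x) = h p" "a \<in> A"
      using insert by (auto simp: stab_def)
    have "h ((p @ e) @ a # x) = h (p @ a # x)" by (rule cong_left) (rule e)
    then have "h (p @ (e @ a # x)) = h p" using x by simp
    then show ?case using e x by (intro bexI[of _ "e @ a # x"]) auto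
  qed
  then show ?thesis using that by blast
qed

lemma stab_absorb:
  assumes "set s \<subseteq> stab p" "e \<in> lists A" "stab p \<subseteq> set e" "h (p @ e) = h p"
  shows "h (p @ s @ word_pow e N) = h p"
proof -
  have e: "h (p @ word_pow e N) = h p" by (rule stab_word_pow) (rule assms)
  have "h (p @ s @ word_pow e N) = h ((p @ word_pow e N) @ s @ word_pow e N)"
    by (rule cong_left) (simp add: e)
  also have "\<dots> = h (p @ word_pow e N)"
    using absorb_ctx[of e s p "[]"] assms by auto
  finally show ?thesis using e by simp
qed

text \<open>In a general finite monoid two letters may each keep the R-class of \<open>p\<close>
  while their product leaves it. Here absorption gives a way back to \<open>p\<close> from any word
  over \<open>stab p\<close>.\<close>

lemma stab_append_mono:
  assumes "set s \<subseteq> stab p"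
  shows "stab p \<subseteq> stab (p @ s)"
proof
  fix a assume a: "a \<in> stab p"
  obtain e where e: "e \<in> lists A" "stab p \<subseteq> set e" "h (p @ e) = h p" by (rule stab_word)
  have "h (p @ (s @ [a]) @ word_pow e N) = h p"
    using stab_absorb[OF _ e, of "s @ [a]"] assms a by simp
  then have "h ((p @ s @ a # word_pow e N) @ s) = h (p @ s)"
    by (intro cong_left) simp
  moreover have "word_pow e N @ s \<in> lists A"
    using e assms by (auto simp: word_pow_in_lists stab_def)
  ultimately show "a \<in> stab (p @ s)"
    using a by (auto simp: stab_def intro!: bexI[of _ "word_pow e N @ s"])
qed

text \<open>If the class of \<open>p\<close> were still reachable, some loop at \<open>p\<close>
  would contain \<open>a\<close>. Its power absorbs the letter \<open>a\<close> placed directly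
  after \<open>p\<close>, which puts \<open>a\<close> into \<open>stab p\<close>.\<close>

lemma rank_less:
  assumes "p \<in> lists A" "s \<in> lists A" "a \<in> A" "a \<notin> stab p"
  shows "rank (p @ s @ [a]) < rank p"
  unfolding rank_def
proof (rule psubset_card_mono)
  have "(@) p ` lists A \<subseteq> lists A" using assms by auto
  then show "finite (h ` (@) p ` lists A)"
    by (meson finite_range finite_subset image_mono)
  have sub: "(@) (p @ s @ [a]) ` lists A \<subseteq> (@) p ` lists A"
    using assms by (auto simp: image_iff intro!: bexI[of _ "s @ a # _"])
  have "h p \<notin> h ` (@) (p @ s @ [a]) ` lists A"
  proof
    assume "h p \<in> h ` (@) (p @ s @ [a]) ` lists A"
    then obtain x where x: "x \<in> lists A" "h p = h ((p @ s @ [a]) @ x)" by blast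
    define e where "e = s @ a # x"
    have e: "e \<in> lists A" "h (p @ e) = h p" using x assms by (simp_all add: e_def)
    have eN: "h (p @ word_pow e N) = h p" using stab_word_pow[OF e(2)] .
    have "h (p @ a # word_pow e N) = h ((p @ word_pow e N) @ a # word_pow e N)"
      by (rule cong_left) (simp add: eN)
    also have "\<dots> = h p"
      using absorb_ctx[of e "[a]" p "[]"] e eN by (simp add: e_def)
    finally have "a \<in> stab p" using e assms by (auto simp: stab_def word_pow_in_lists)
    then show False using assms by simp
  qed
  moreover have "h p \<in> h ` (@) p ` lists A"
    by (rule imageI) (rule image_eqI[of _ _ "[]"], auto)
  ultimately show "h ` (@) (p @ s @ [a]) ` lists A \<subset> h ` (@) p ` lists A"
    using image_mono[OF sub, of h] by blast
qed

text \<open>The class of the prefix drops at letters outside \<open>stab p\<close>, and the ranks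
  bound the number of drops. One step cuts at the first letter outside \<open>stab p\<close> and at
  the last letter outside \<open>costab q\<close>, which costs two units of depth, while each
  recursive call has a smaller sum of ranks; hence the factor 2. The summand 2 pays for the last
  pair of cuts, and \<open>d\<close> is what remains for \<open>direct\<close>.\<close>

lemma replace_factors:
  fixes p q u v :: "'a list"
  defines "costab \<equiv> \<lambda>q. absorbing.stab A (\<lambda>w. h (rev w)) (rev q)"
    and "corank \<equiv> \<lambda>q. absorbing.rank A (\<lambda>w. h (rev w)) (rev q)"
  assumes direct: "\<And>p q w w'. p \<in> lists A \<Longrightarrow> q \<in> lists A \<Longrightarrow> w \<in> lists A \<Longrightarrow> w' \<in> lists A \<Longrightarrow>
      set w \<subseteq> stab p \<inter> costab q \<Longrightarrow> set w' \<subseteq> stab p \<inter> costab q \<Longrightarrow>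
      (k \<noteq> 0 \<Longrightarrow> eqv k d w w') \<Longrightarrow> h (p @ w @ q) = h (p @ w' @ q)"
    and "p \<in> lists A" "q \<in> lists A" "u \<in> lists A" "v \<in> lists A"
    and "eqv (Suc k) (d + 2 + 2 * (rank p + corank q)) u v"
  shows "h (p @ u @ q) = h (p @ v @ q)"
  using assms(4-8)
proof (induction "rank p + corank q" arbitrary: p q u v rule: less_induct)
  case less
  interpret R: absorbing A "\<lambda>w. h (rev w)" N by (rule absorbing_rev)
  define r where "r = d + 2 * (rank p + corank q)"
  have uv: "eqv (Suc k) (Suc (Suc r)) u v" using less.prems by (simp add: r_def)
  have setuv: "set u = set v" using uv eqv_set by blast
  note lists = less.prems(1-4)
  have IH: "h (p' @ x @ q') = h (p' @ y @ q')"
    if "rank p' + corank q' < rank p + corank q" "p' \<in> lists A" "q' \<in> lists A"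
      "x \<in> lists A" "y \<in> lists A" "eqv (Suc k) r x y" for p' q' x y
    using that less.hyps[of p' q' x y]
      eqv_mono[OF that(6), of "d + 2 + 2 * (rank p' + corank q')"]
    by (simp add: r_def)
  have direct': "h (p' @ w @ q') = h (p' @ w' @ q')"
    if "p' \<in> lists A" "q' \<in> lists A" "w \<in> lists A" "w' \<in> lists A"
      "set w \<subseteq> stab p'" "set w' \<subseteq> stab p'" "set w \<subseteq> costab q'" "set w' \<subseteq> costab q'"
      "k \<noteq> 0 \<Longrightarrow> eqv k r w w'" for p' q' w w'
    using that by (intro direct) (auto simp: r_def intro: eqv_mono)
  have dropR: "corank (b # s @ q) < corank q" if "s \<in> lists A" "b \<in> A" "b \<notin> costab q" for b s
    using R.rank_less[of "rev q" "rev s" b] that lists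
    by (simp add: corank_def costab_def in_lists_conv_set)
  have dropL: "rank (p @ s @ [a]) < rank p" if "s \<in> lists A" "a \<in> A" "a \<notin> stab p" for a s
    using rank_less that lists by blast
  have costab_mono: "costab q \<subseteq> costab (s @ q)" if "set s \<subseteq> costab q" for s
    using R.stab_append_mono[of "rev s" "rev q"] that by (simp add: costab_def)
  have stab_mono: "stab p \<subseteq> stab (p @ s)" if "set s \<subseteq> stab p" for s
    using stab_append_mono that by blast
  have left: "\<exists>u0 a u1 v0 v1. u = u0 @ a # u1 \<and> v = v0 @ a # v1 \<and> a \<notin> set u0 \<and> a \<notin> set v0 \<and>
      a \<notin> stab p \<and> set u0 \<subseteq> stab p \<and> set v0 \<subseteq> stab p" if outside: "\<not> set u \<subseteq> stab p"
  proof -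
    obtain u0 a u1 where u: "u = u0 @ a # u1" "set u0 \<subseteq> stab p" "a \<notin> stab p" "a \<notin> set u0"
      using outside by (rule first_outside)
    then obtain v0 v1 where v: "v = v0 @ a # v1" "a \<notin> set v0"
      using setuv by (metis first_occurrence in_set_conv_decomp)
    \<comment> \<open>Equal contents before the cut make \<open>a\<close> the first letter outside
      \<open>stab p\<close> in \<open>v\<close> as well.\<close>
    have "set u0 = set v0"
      using eqv_split(2)[OF uv[unfolded u v]] u v eqv_set by blast
    then show ?thesis using u v by metis
  qed
  have right: "\<exists>x b x' y y'. u = x @ b # x' \<and> v = y @ b # y' \<and> b \<notin> set x' \<and> b \<notin> set y' \<and>
      b \<notin> costab q \<and> set x' \<subseteq> costab q \<and> set y' \<subseteq> costab q" if "\<not> set u \<subseteq> costab q"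
  proof -
    have "\<not> set (rev u) \<subseteq> costab q" using that by simp
    then obtain x b x' where u: "rev u = x @ b # x'" "set x \<subseteq> costab q" "b \<notin> costab q" "b \<notin> set x"
      by (rule first_outside)
    then have u': "u = rev x' @ b # rev x" by (metis rev_eq_append_conv rev_rev_ident rev.simps(2) append.assoc append_Cons append_Nil)
    then have "b \<in> set (rev v)" using setuv by auto
    then obtain y y' where v: "rev v = y @ b # y'" "b \<notin> set y" by (rule first_occurrence)
    then have v': "v = rev y' @ b # rev y" by (metis rev_eq_append_conv rev_rev_ident rev.simps(2) append.assoc append_Cons append_Nil)
    have "set (rev x) = set (rev y)"
      using eqv_split_last(2)[OF uv[unfolded u' v']] u v eqv_set by (metis set_rev)
    then show ?thesis using u u' v v' by (metis set_rev)
  qed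
  show ?case
  proof (cases "set u \<subseteq> stab p")
    case True
    note L = this
    show ?thesis
    proof (cases "set u \<subseteq> costab q")
      case True
      show ?thesis
        using uv by (intro direct')
          (use lists L True setuv in \<open>auto intro: eqv_mono eqv_level_imp\<close>)
    next
      case False
      from right[OF this] obtain x b x' y y' where b: "u = x @ b # x'" "v = y @ b # y'"
        "b \<notin> set x'" "b \<notin> set y'" "b \<notin> costab q" "set x' \<subseteq> costab q" "set y' \<subseteq> costab q"
        by blast
      have in_lists: "x \<in> lists A" "x' \<in> lists A" "y \<in> lists A" "y' \<in> lists A" "b \<in> A"
        using lists b by auto
      have e: "eqv (Suc k) (Suc r) x y" "eqv k (Suc r) x' y'"
        using eqv_split_last[OF uv[unfolded b(1,2)]] b by auto
      have "h (p @ x @ (b # x' @ q)) = h (p @ y @ (b # x' @ q))"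
        by (rule IH) (use dropR in_lists lists b e in \<open>auto intro: eqv_mono\<close>)
      moreover have vp: "set v \<subseteq> stab p" using L setuv by simp
      have "stab p \<subseteq> stab (p @ y @ [b])" "set x' \<subseteq> stab p" "set y' \<subseteq> stab p"
        using stab_mono[of "y @ [b]"] vp L by (simp_all add: b)
      then have "h ((p @ y @ [b]) @ x' @ q) = h ((p @ y @ [b]) @ y' @ q)"
        using e b in_lists lists by (intro direct') (auto intro: eqv_mono)
      ultimately show ?thesis by (simp add: b)
    qed
  next
    case False
    from left[OF this] obtain u0 a u1 v0 v1 where a: "u = u0 @ a # u1" "v = v0 @ a # v1"
      "a \<notin> set u0" "a \<notin> set v0" "a \<notin> stab p" "set u0 \<subseteq> stab p" "set v0 \<subseteq> stab p"
      by blast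
    have in_listsL: "u0 \<in> lists A" "u1 \<in> lists A" "v0 \<in> lists A" "v1 \<in> lists A" "a \<in> A"
      using lists a by auto
    have e: "eqv (Suc k) (Suc r) u1 v1" "eqv k (Suc r) u0 v0"
      using eqv_split[OF uv[unfolded a(1,2)]] a by auto
    have u1v1: "h (p @ u0 @ a # u1 @ q) = h (p @ u0 @ a # v1 @ q)"
    proof -
      have "h ((p @ u0 @ [a]) @ u1 @ q) = h ((p @ u0 @ [a]) @ v1 @ q)"
        by (rule IH) (use dropL in_listsL lists a e in \<open>auto intro: eqv_mono\<close>)
      then show ?thesis by simp
    qed
    show ?thesis
    proof (cases "set u \<subseteq> costab q")
      case True
      have vq: "set v \<subseteq> costab q" using True setuv by simp
      have "costab q \<subseteq> costab (a # v1 @ q)" "set u0 \<subseteq> costab q" "set v0 \<subseteq> costab q"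
        using costab_mono[of "a # v1"] vq True by (simp_all add: a)
      then have "h (p @ u0 @ (a # v1 @ q)) = h (p @ v0 @ (a # v1 @ q))"
        using e a in_listsL lists by (intro direct') (auto intro: eqv_mono)
      then show ?thesis using u1v1 by (simp add: a)
    next
      case False
      from right[OF this] obtain x b x' y y' where b: "u = x @ b # x'" "v = y @ b # y'"
        "b \<notin> set x'" "b \<notin> set y'" "b \<notin> costab q" "set x' \<subseteq> costab q" "set y' \<subseteq> costab q"
        by blast
      have in_listsR: "x \<in> lists A" "x' \<in> lists A" "y \<in> lists A" "y' \<in> lists A" "b \<in> A"
        using lists b by auto
      have f: "eqv (Suc k) (Suc r) x y" "eqv k (Suc r) x' y'"
        using eqv_split_last[OF uv[unfolded b(1,2)]] b by auto
      have xy: "h (p @ x @ b # x' @ q) = h (p @ y @ b # x' @ q)"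
        "h (p @ x @ b # y' @ q) = h (p @ y @ b # y' @ q)"
        using IH[of p "b # x' @ q" x y] IH[of p "b # y' @ q" x y] dropR in_listsR lists b
          eqv_mono[OF f(1), of r]
        by auto
      have set1: "set u1 = set v1" "set u0 = set v0" using e eqv_set by blast+
      \<comment> \<open>The last \<open>b\<close> comes after, at, or before the first
        \<open>a\<close>. Since \<open>u0\<close>, \<open>v0\<close> and \<open>u1\<close>,
        \<open>v1\<close> have equal contents, the order is the same in both words.\<close>
      show ?thesis
      proof (cases "b \<in> set u1")
        case True
        obtain w z where "u1 = w @ b # z" "b \<notin> set z"
          using True by (rule last_occurrence)
        with last_occurrence_unique[of x b x' "u0 @ a # w" z] a b
        have w: "u1 = w @ b # x'" "x = u0 @ a # w" by simp_all
        have "b \<in> set v1" using True set1 by simp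
        then obtain w' z' where "v1 = w' @ b # z'" "b \<notin> set z'"
          by (rule last_occurrence)
        with last_occurrence_unique[of y b y' "v0 @ a # w'" z'] a b
        have w': "v1 = w' @ b # y'" "y = v0 @ a # w'" by simp_all
        \<comment> \<open>The cuts do not cross, so the middle factor keeps its level, and both
          ranks have dropped around it. Exchanging it connects the end of \<open>u1v1\<close> with
          the start of the second equation of \<open>xy\<close>.\<close>
        have "eqv (Suc k) r w w'"
          using eqv_split_last(1)[OF e(1)[unfolded w w']] b by simp
        then have "h ((p @ u0 @ [a]) @ w @ (b # y' @ q)) = h ((p @ u0 @ [a]) @ w' @ (b # y' @ q))"
          using dropR[of y' b] dropL[of u0 a] in_listsL in_listsR lists a b w w'
          by (intro IH) auto
        then show ?thesis using u1v1 xy by (simp add: a w w')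
      next
        case b1: False
        show ?thesis
        proof (cases "a = b")
          case True
          have "x = u0" "x' = u1" "y = v0" "y' = v1"
            using last_occurrence_unique[of x b x' u0 u1] last_occurrence_unique[of y b y' v0 v1]
              a b b1 set1 True by simp_all
          then show ?thesis using u1v1 xy by (simp add: a True)
        next
          case False
          have "b \<in> set u" by (simp add: b)
          then have b0: "b \<in> set u0" using False b1 by (simp add: a)
          then obtain z w where "u0 = z @ b # w" "b \<notin> set w"
            by (rule last_occurrence)
          with last_occurrence_unique[of x b x' z "w @ a # u1"] a b b1 False
          have w: "u0 = x @ b # w" "x' = w @ a # u1" by simp_all
          have "b \<in> set v0" using b0 set1 by simp
          then obtain z' w' where "v0 = z' @ b # w'" "b \<notin> set w'"
            by (rule last_occurrence)
          with last_occurrence_unique[of y b y' z' "w' @ a # v1"] a b b1 False set1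
          have w': "v0 = y @ b # w'" "y' = w' @ a # v1" by simp_all
          \<comment> \<open>The cuts cross: \<open>w\<close> comes before the first
            \<open>a\<close>, hence is over \<open>stab p\<close>, and after the last
            \<open>b\<close>, hence is over \<open>costab q\<close>. For such factors
            \<open>direct\<close> works from level \<open>k\<close>.\<close>
          have eqvw: "eqv k r w w'" if k0: "k \<noteq> 0"
          proof -
            obtain k' where k: "k = Suc k'" using k0 by (cases k) auto
            have "eqv (Suc (Suc k')) (Suc (Suc r)) (x @ b # w @ a # u1) (y @ b # w' @ a # v1)"
              using uv by (simp add: k b w w')
            then show ?thesis
              unfolding k by (rule eqv_between) (use a b w w' in auto)
          qed
          have 1: "h (p @ u0 @ a # v1 @ q) = h ((p @ x @ [b]) @ w @ (a # v1 @ q))"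
            by (simp add: w)
          also have "\<dots> = h ((p @ x @ [b]) @ w' @ (a # v1 @ q))"
            using stab_mono[of "x @ [b]"] costab_mono[of "a # v1"] eqvw a b w w' in_listsL in_listsR lists
            by (intro direct') auto
          also have "\<dots> = h (p @ v @ q)"
            using xy by (simp add: b w')
          finally show ?thesis using u1v1 by (simp add: a)
        qed
      qed
    qed
  qed
qed

text \<open>Turns the contexts of \<open>replace_factors\<close> into powers: a loop through all of
  \<open>stab p\<close> lets \<open>p\<close> be followed by a power of \<open>e\<close> without
  changing its class, and symmetrically for \<open>q\<close>. Thus \<open>direct\<close> is only
  required between powers.\<close>

lemma eqv_imp_eq:
  assumes direct: "\<And>e f w w'. e \<in> lists A \<Longrightarrow> f \<in> lists A \<Longrightarrow>
      set w \<subseteq> set e \<inter> set f \<Longrightarrow> set w' \<subseteq> set e \<inter> set f \<Longrightarrow> (k \<noteq> 0 \<Longrightarrow> eqv k d w w') \<Longrightarrow>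
      h (word_pow e N @ w @ word_pow f N) = h (word_pow e N @ w' @ word_pow f N)"
  shows "\<exists>n. \<forall>u \<in> lists A. \<forall>v \<in> lists A. eqv (Suc k) n u v \<longrightarrow> h u = h v"
proof -
  interpret R: absorbing A "\<lambda>w. h (rev w)" N by (rule absorbing_rev)
  have *: "h (p @ w @ q) = h (p @ w' @ q)"
    if "w \<in> lists A" "w' \<in> lists A" "set w \<subseteq> stab p \<inter> R.stab (rev q)"
      "set w' \<subseteq> stab p \<inter> R.stab (rev q)" and eqv: "k \<noteq> 0 \<Longrightarrow> eqv k d w w'" for p q w w'
  proof -
    obtain e where e: "e \<in> lists A" "stab p \<subseteq> set e" "h (p @ e) = h p" by (rule stab_word)
    obtain f0 where f0: "f0 \<in> lists A" "R.stab (rev q) \<subseteq> set f0" "h (rev (rev q @ f0)) = h (rev (rev q))"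
      by (rule R.stab_word)
    define f where "f = rev f0"
    have eN: "h (p @ word_pow e N) = h p" by (rule stab_word_pow) (rule e)
    have fN: "h (word_pow f N @ q) = h q"
      using R.stab_word_pow[OF f0(3), of N] by (simp add: f_def rev_word_pow)
    have expand: "h (p @ x @ q) = h (p @ (word_pow e N @ x @ word_pow f N) @ q)" for x
    proof -
      have "h (p @ x @ q) = h ((p @ word_pow e N) @ x @ q)"
        by (rule cong_left) (simp add: eN)
      also have "\<dots> = h ((p @ word_pow e N @ x) @ word_pow f N @ q)"
        using cong_right[of q "word_pow f N @ q" "p @ word_pow e N @ x"] fN by simp
      finally show ?thesis by simp
    qed
    have "h (word_pow e N @ w @ word_pow f N) = h (word_pow e N @ w' @ word_pow f N)"
      by (rule direct) (use e f0 that in \<open>auto simp: f_def\<close>)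
    then show ?thesis using expand cong by metis
  qed
  \<comment> \<open>For empty contexts both ranks are the number of classes of words over
    \<open>A\<close>.\<close>
  show ?thesis
    using replace_factors[where p = "[]" and q = "[]" and k = k and d = d] *
    by (intro exI[of _ "d + 2 + 2 * (rank [] + R.rank (rev []))"] ballI impI) fastforce
qed

end

section \<open>Nested replacements\<close>

fun wrap :: "nat \<Rightarrow> 'a list \<Rightarrow> ('a list \<times> 'a list) list \<Rightarrow> 'a list" where
  "wrap N s [] = s"
| "wrap N s ((e, f) # efs) = word_pow e N @ wrap N s efs @ word_pow f N"

text \<open>All positive exponents give the same letters, so the content condition can be stated
  with exponent 1, independently of the exponent of the identity.\<close>

fun nested :: "'a list \<Rightarrow> ('a list \<times> 'a list) list \<Rightarrow> bool" where
  "nested s [] \<longleftrightarrow> True"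
| "nested s ((e, f) # efs) \<longleftrightarrow> nested s efs \<and> set (wrap 1 s efs) \<subseteq> set e \<inter> set f"

lemma set_wrap: "0 < N \<Longrightarrow> set (wrap N s efs) = set (wrap 1 s efs)"
  by (induction N s efs rule: wrap.induct) (auto simp: set_word_pow)

lemma set_wrap_mono: "set (wrap N [] efs) \<subseteq> set (wrap N s efs)"
  by (induction N s efs rule: wrap.induct) auto

lemma nested_set_wrap:
  assumes "nested s efs" "efs \<noteq> []" "0 < N"
  shows "set (wrap N [] efs) = set (wrap N s efs)"
proof -
  obtain e f efs' where efs: "efs = (e, f) # efs'" using assms(2) by (cases efs) auto
  show ?thesis
    using assms set_wrap_mono[of N efs' s] set_wrap[of N s efs']
    by (auto simp: efs set_word_pow)
qed

text \<open>The induction passes from \<open>h\<close> to a coarser congruence. Letting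
  \<open>h\<close> take values in sets of words keeps its type fixed in the induction: the new map
  sends a word to its class.\<close>

lemma absorbing_nested_imp_eqv:
  fixes h :: "'a list \<Rightarrow> 'a list set"
  assumes "absorbing A h N" "0 < N"
    and "\<And>efs s. length efs = Suc k \<Longrightarrow> set efs \<subseteq> lists A \<times> lists A \<Longrightarrow> nested s efs \<Longrightarrow>
      h (wrap N s efs) = h (wrap N [] efs)"
  shows "\<exists>n. \<forall>u \<in> lists A. \<forall>v \<in> lists A. eqv (Suc k) n u v \<longrightarrow> h u = h v"
  using assms
proof (induction k arbitrary: h)
  case 0
  interpret absorbing A h N by (rule 0)
  show ?case
  proof (rule eqv_imp_eq)
    fix e f w w'
    assume *: "e \<in> lists A" "f \<in> lists A" "set w \<subseteq> set e \<inter> set f" "set w' \<subseteq> set e \<inter> set f"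
    show "h (word_pow e N @ w @ word_pow f N) = h (word_pow e N @ w' @ word_pow f N)"
      using "0.prems"(3)[of "[(e, f)]" w] "0.prems"(3)[of "[(e, f)]" w'] * by simp
  qed
next
  case (Suc k)
  interpret absorbing A h N by (rule Suc)
  \<comment> \<open>Equality of contents is part of \<open>R\<close> so that the condition on the
    surrounding powers holds for both words at once. A nested word of depth \<open>Suc k\<close> in
    such a context becomes one of depth \<open>Suc (Suc k)\<close> for \<open>h\<close>.\<close>
  define R where "R u v \<longleftrightarrow> set u = set v \<and> (\<forall>e p q f. e \<in> lists A \<longrightarrow> f \<in> lists A \<longrightarrow>
      set (p @ u @ q) \<subseteq> set e \<inter> set f \<longrightarrow>
      h (word_pow e N @ p @ u @ q @ word_pow f N) = h (word_pow e N @ p @ v @ q @ word_pow f N))"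
    for u v
  define h' where "h' u = {v. R u v}" for u
  have R_refl: "R u u" for u by (simp add: R_def)
  have R_sym: "R u v \<Longrightarrow> R v u" for u v unfolding R_def by auto
  have R_trans: "R u v \<Longrightarrow> R v w \<Longrightarrow> R u w" for u v w unfolding R_def by auto
  have h'_eq: "h' u = h' v \<longleftrightarrow> R u v" for u v
    unfolding h'_def using R_refl R_sym R_trans by blast
  have h_R: "R u v" if "h u = h v" "set u = set v" for u v
    using that cong[of u v "word_pow _ N @ _" "_ @ word_pow _ N"] by (auto simp: R_def)
  have "absorbing A h' N"
  proof
    show "finite A" by (rule finite_A)
  next
    fix u v x y assume "h' u = h' v"
    then have uv: "R u v" by (simp add: h'_eq)
    show "h' (x @ u @ y) = h' (x @ v @ y)"
      unfolding h'_eq unfolding R_def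
    proof (intro conjI allI impI)
      show "set (x @ u @ y) = set (x @ v @ y)" using uv by (simp add: R_def)
    next
      fix e p q f
      assume "e \<in> lists A" "f \<in> lists A" "set (p @ (x @ u @ y) @ q) \<subseteq> set e \<inter> set f"
      moreover from this have "set ((p @ x) @ u @ (y @ q)) \<subseteq> set e \<inter> set f" by simp
      ultimately have "h (word_pow e N @ (p @ x) @ u @ (y @ q) @ word_pow f N) =
          h (word_pow e N @ (p @ x) @ v @ (y @ q) @ word_pow f N)"
        using uv unfolding R_def by blast
      then show "h (word_pow e N @ p @ (x @ u @ y) @ q @ word_pow f N) =
          h (word_pow e N @ p @ (x @ v @ y) @ q @ word_pow f N)" by simp
    qed
  next
    \<comment> \<open>By \<open>h_R\<close>, the class under \<open>h\<close> together with the
      content refines \<open>R\<close>, so \<open>R\<close> has finite index on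
      \<open>lists A\<close>.\<close>
    have "finite ((\<lambda>u. (h u, set u)) ` lists A)"
      by (rule finite_subset[of _ "h ` lists A \<times> Pow A"]) (use finite_range finite_A in auto)
    then show "finite (h' ` lists A)"
      by (rule finite_image_if_kernel) (simp add: h'_eq h_R)
  next
    fix e s assume "e \<in> lists A" "set s \<subseteq> set e"
    then show "h' (word_pow e N @ s @ word_pow e N) = h' (word_pow e N)"
      unfolding h'_eq using \<open>0 < N\<close> by (intro h_R absorb) (auto simp: set_word_pow)
  qed
  moreover have "h' (wrap N s efs) = h' (wrap N [] efs)"
    if "length efs = Suc k" "set efs \<subseteq> lists A \<times> lists A" "nested s efs" for efs s
    unfolding h'_eq R_def
  proof (intro conjI allI impI)
    show "set (wrap N s efs) = set (wrap N [] efs)"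
      using nested_set_wrap[of s efs N] that \<open>0 < N\<close> by (cases efs) auto
    fix e p q f
    assume *: "e \<in> lists A" "f \<in> lists A" "set (p @ wrap N s efs @ q) \<subseteq> set e \<inter> set f"
    \<comment> \<open>The identities for \<open>h\<close> have no room for \<open>p\<close> and
      \<open>q\<close> between two powers, so these are merged into the outer pair.
      \<open>e'\<close> has the letters of \<open>e\<close>, and by absorption its square has the
      class of \<open>e'\<close>; so it is equivalent to its own \<open>N\<close>-th power.\<close>
    define e' where "e' = word_pow e N @ p"
    define f' where "f' = q @ word_pow f N"
    have e': "e' \<in> lists A" "set e' = set e"
      using * \<open>0 < N\<close> by (auto simp: e'_def set_word_pow)
    have f': "f' \<in> lists A" "set f' = set f"
      using * \<open>0 < N\<close> by (auto simp: f'_def set_word_pow)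
    have "h (word_pow e' (Suc n)) = h e'" for n
    proof (induction n)
      case (Suc n)
      have "h (e' @ word_pow e' (Suc n)) = h (e' @ e')"
        by (rule cong_right) (rule Suc)
      also have "\<dots> = h e'"
        using absorb_ctx[of e p "[]" p] * by (simp add: e'_def)
      finally show ?case by (simp add: word_pow_Suc)
    qed (simp add: word_pow_Suc)
    then have e'N: "h (word_pow e' N) = h e'" using \<open>0 < N\<close> by (metis Suc_pred)
    have "h (word_pow f' (Suc n)) = h f'" for n
    proof (induction n)
      case (Suc n)
      have "h (f' @ word_pow f' (Suc n)) = h (f' @ f')"
        by (rule cong_right) (rule Suc)
      also have "\<dots> = h f'"
        using absorb_ctx[of f q q "[]"] * by (simp add: f'_def)
      finally show ?case by (simp add: word_pow_Suc)
    qed (simp add: word_pow_Suc)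
    then have f'N: "h (word_pow f' N) = h f'" using \<open>0 < N\<close> by (metis Suc_pred)
    have expand: "h (e' @ x @ f') = h (word_pow e' N @ x @ word_pow f' N)" for x
    proof -
      have "h (e' @ x @ f') = h (word_pow e' N @ x @ f')"
        by (rule cong_left) (simp add: e'N)
      also have "\<dots> = h ((word_pow e' N @ x) @ word_pow f' N)"
        using cong_right[of f' "word_pow f' N" "word_pow e' N @ x"] f'N by simp
      finally show ?thesis by simp
    qed
    have "h (wrap N s ((e', f') # efs)) = h (wrap N [] ((e', f') # efs))"
      using that * e' f' set_wrap[of N s efs] \<open>0 < N\<close> by (intro Suc.prems(3)) auto
    then show "h (word_pow e N @ p @ wrap N s efs @ q @ word_pow f N) =
        h (word_pow e N @ p @ wrap N [] efs @ q @ word_pow f N)"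
      using expand[of "wrap N s efs"] expand[of "wrap N [] efs"] by (simp add: e'_def f'_def)
  qed
  ultimately obtain n where n: "\<forall>u \<in> lists A. \<forall>v \<in> lists A. eqv (Suc k) n u v \<longrightarrow> h' u = h' v"
    using Suc.IH[of h'] \<open>0 < N\<close> by blast
  show ?case
  proof (rule eqv_imp_eq)
    fix e f w w'
    assume *: "e \<in> lists A" "f \<in> lists A" "set w \<subseteq> set e \<inter> set f" "set w' \<subseteq> set e \<inter> set f"
      and eqv: "Suc k \<noteq> 0 \<Longrightarrow> eqv (Suc k) n w w'"
    have "w \<in> lists A" "w' \<in> lists A" using * by (auto simp: in_lists_conv_set)
    then have "R w w'" using n eqv h'_eq by blast
    then show "h (word_pow e N @ w @ word_pow f N) = h (word_pow e N @ w' @ word_pow f N)"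
      using *(1-3) unfolding R_def by (metis append_Nil append_Nil2)
  qed
qed

section \<open>Languages of the hierarchy respect nested replacements\<close>

definition absorbs :: "nat \<Rightarrow> 'a list set \<Rightarrow> bool" where
  "absorbs N L \<longleftrightarrow> (\<forall>e s x y. set s \<subseteq> set e \<longrightarrow>
    (x @ word_pow e N @ s @ word_pow e N @ y \<in> L \<longleftrightarrow> x @ word_pow e N @ y \<in> L))"

definition respects_nested :: "nat \<Rightarrow> nat \<Rightarrow> 'a list set \<Rightarrow> bool" where
  "respects_nested k N L \<longleftrightarrow> (\<forall>efs s x y. length efs = k \<longrightarrow> nested s efs \<longrightarrow>
    (x @ wrap N s efs @ y \<in> L \<longleftrightarrow> x @ wrap N [] efs @ y \<in> L))"

text \<open>Absorbing the empty word doubles the power of exponent \<open>N\<close>; moved between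
  the two copies, the surplus copies of \<open>e\<close> are absorbed.\<close>

lemma absorbs_word_pow:
  assumes "absorbs N L" "N \<le> n"
  shows "x @ word_pow e n @ y \<in> L \<longleftrightarrow> x @ word_pow e N @ y \<in> L"
  using assms(2)
proof (induction n rule: dec_induct)
  case (step n)
  have "x @ word_pow e (Suc n) @ y = x @ word_pow e N @ word_pow e (Suc n - N) @ y"
    using word_pow_add[of e N "Suc n - N"] step by simp
  also have "\<dots> \<in> L \<longleftrightarrow> x @ word_pow e N @ [] @ word_pow e N @ word_pow e (Suc n - N) @ y \<in> L"
    using assms(1) unfolding absorbs_def by (metis append_Nil empty_set empty_subsetI)
  also have "x @ word_pow e N @ [] @ word_pow e N @ word_pow e (Suc n - N) @ y =
      x @ word_pow e N @ word_pow e (Suc n - N) @ word_pow e N @ y"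
    using word_pow_commute[of e N "Suc n - N"] by simp
  also have "\<dots> \<in> L \<longleftrightarrow> x @ word_pow e N @ y \<in> L"
    using assms(1) set_word_pow_subset[of e] unfolding absorbs_def by metis
  finally show ?case .
qed simp

lemma absorbs_mono:
  assumes "absorbs N L" "N \<le> n"
  shows "absorbs n L"
  unfolding absorbs_def
proof (intro allI impI)
  fix e s x y :: "'a list" assume s: "set s \<subseteq> set e"
  have "x @ word_pow e n @ s @ word_pow e n @ y \<in> L \<longleftrightarrow>
      x @ word_pow e N @ s @ word_pow e N @ y \<in> L"
    using absorbs_word_pow[OF assms, of x e "s @ word_pow e n @ y"]
      absorbs_word_pow[OF assms, of "x @ word_pow e N @ s" e y] by simp
  also have "\<dots> \<longleftrightarrow> x @ word_pow e N @ y \<in> L"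
    using assms(1) s unfolding absorbs_def by blast
  also have "\<dots> \<longleftrightarrow> x @ word_pow e n @ y \<in> L"
    using absorbs_word_pow[OF assms] by blast
  finally show "x @ word_pow e n @ s @ word_pow e n @ y \<in> L \<longleftrightarrow> x @ word_pow e n @ y \<in> L" .
qed

lemma absorbs_wrap:
  assumes "absorbs N L" "N \<le> n"
  shows "x @ wrap n s efs @ y \<in> L \<longleftrightarrow> x @ wrap N s efs @ y \<in> L"
proof (induction efs arbitrary: x y)
  case (Cons ef efs)
  obtain e f where ef: "ef = (e, f)" by fastforce
  show ?case
    using absorbs_word_pow[OF assms, of x e "wrap n s efs @ word_pow f n @ y"]
      absorbs_word_pow[OF assms, of "x @ word_pow e N @ wrap n s efs" f y]
      Cons.IH[of "x @ word_pow e N" "word_pow f N @ y"]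
    by (simp add: ef)
qed simp

lemma respects_nested_mono:
  assumes "absorbs N L" "N \<le> n" "respects_nested k N L"
  shows "respects_nested k n L"
  using assms(3) unfolding respects_nested_def absorbs_wrap[OF assms(1,2)] .

definition content_closed :: "'a list set \<Rightarrow> bool" where
  "content_closed L \<longleftrightarrow> (\<forall>u v. set u = set v \<longrightarrow> (u \<in> L \<longleftrightarrow> v \<in> L))"

text \<open>At level 0, \<open>respects_nested 0\<close> would allow every factor to be deleted
  anywhere, which is too strong for the languages of the first level; dependence on the content
  alone takes its place.\<close>

definition good :: "nat \<Rightarrow> nat \<Rightarrow> 'a list set \<Rightarrow> bool" where
  "good k N L \<longleftrightarrow> absorbs N L \<and> (if k = 0 then content_closed L else respects_nested k N L)"

lemma good_mono: "good k N L \<Longrightarrow> N \<le> n \<Longrightarrow> good k n L"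
  unfolding good_def using absorbs_mono respects_nested_mono by metis

text \<open>Writes \<open>good\<close> as saturation under a set of pairs, a form that passes to
  unions and intersections at once.\<close>

definition test_pairs :: "nat \<Rightarrow> nat \<Rightarrow> ('a list \<times> 'a list) set" where
  "test_pairs k N =
    {(x @ word_pow e N @ s @ word_pow e N @ y, x @ word_pow e N @ y) |x e s y. set s \<subseteq> set e} \<union>
    (if k = 0 then {(u, v). set u = set v}
     else {(x @ wrap N s efs @ y, x @ wrap N [] efs @ y) |x s efs y.
       length efs = k \<and> nested s efs})"

lemma good_iff_test_pairs: "good k N L \<longleftrightarrow> (\<forall>(u, v) \<in> test_pairs k N. u \<in> L \<longleftrightarrow> v \<in> L)"
proof (cases "k = 0")
  case True
  show ?thesis
    unfolding good_def test_pairs_def absorbs_def content_closed_def if_P[OF True] ball_Un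
    by (rule arg_cong2[where f = conj]; auto; metis)
next
  case False
  show ?thesis
    unfolding good_def test_pairs_def absorbs_def respects_nested_def if_not_P[OF False]
      ball_Un
    by (rule arg_cong2[where f = conj]; auto; metis)
qed

lemma test_pairs_set:
  assumes "(u, v) \<in> test_pairs k N" "0 < N"
  shows "set u = set v"
proof -
  from assms(1) consider
    (power) x e s y where "set s \<subseteq> set e"
      "u = x @ word_pow e N @ s @ word_pow e N @ y" "v = x @ word_pow e N @ y"
    | (content) "set u = set v"
    | (nested) x s efs y where "u = x @ wrap N s efs @ y" "v = x @ wrap N [] efs @ y"
      "length efs = k" "k \<noteq> 0" "nested s efs"
    unfolding test_pairs_def by (cases "k = 0") auto
  then show ?thesis
  proof cases
    case power
    then show ?thesis using assms(2) by (auto simp: set_word_pow)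
  next
    case nested
    then have "set (wrap N [] efs) = set (wrap N s efs)"
      using nested_set_wrap[of s efs N] assms(2) by auto
    then show ?thesis by (simp add: nested(1,2))
  qed
qed

lemma good_boolean_combinations:
  assumes "L \<in> boolean_combinations (lists A) G" "\<And>K. K \<in> G \<Longrightarrow> \<exists>N>0. good k N K"
  shows "\<exists>N>0. good k N L"
  using assms
proof induction
  case (generator L)
  then show ?case by blast
next
  case (complement L)
  then obtain N where N: "0 < N" "good k N L" by blast
  \<comment> \<open>The complement is relative to \<open>lists A\<close>. It preserves saturation
    because the two words of a pair have the same letters.\<close>
  have "u \<in> lists A \<longleftrightarrow> v \<in> lists A" if "(u, v) \<in> test_pairs k N" for u v
    using test_pairs_set[OF that N(1)] by (simp add: in_lists_conv_set)
  then have "good k N (lists A - L)"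
    using N(2) unfolding good_iff_test_pairs by blast
  then show ?case using N(1) by blast
next
  case (union K L)
  then obtain M N where MN: "0 < M" "good k M K" "0 < N" "good k N L" by blast
  then have "good k (max M N) K" "good k (max M N) L" by (auto intro: good_mono)
  then have "good k (max M N) (K \<union> L)" unfolding good_iff_test_pairs by blast
  then show ?case using MN(1) by (meson less_max_iff_disj)
next
  case (intersection K L)
  then obtain M N where MN: "0 < M" "good k M K" "0 < N" "good k N L" by blast
  then have "good k (max M N) K" "good k (max M N) L" by (auto intro: good_mono)
  then have "good k (max M N) (K \<inter> L)" unfolding good_iff_test_pairs by blast
  then show ?case using MN(1) by (meson less_max_iff_disj)
qed

section \<open>Deterministic monomials gain one level of nesting\<close>

lemma marked_split:
  assumes "x @ y = u @ a # v"
  obtains (right) y1 where "u = x @ y1" "y = y1 @ a # v"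
    | (left) z where "x = u @ a # z" "v = z @ y"
  using assms by (auto simp: append_eq_append_conv2 Cons_eq_append_conv append_eq_Cons_conv)

lemma left_factor_exists:
  assumes "v \<in> monomial K ps" "i < length ps"
  shows "\<exists>p. prefix p v \<and> p \<in> left_factor K ps i"
  using assms
proof (induction K ps arbitrary: v i rule: monomial.induct)
  case (2 L a K ps)
  then obtain u w where v: "v = u @ a # w" "u \<in> L" "w \<in> monomial K ps" by auto
  show ?case
  proof (cases i)
    case 0
    then show ?thesis using v by (intro exI[of _ "u @ [a]"]) (auto simp: left_factor_def)
  next
    case (Suc j)
    then obtain p where "prefix p w" "p \<in> left_factor K ps j" using 2 v by auto
    then show ?thesis using v Suc
      by (intro exI[of _ "u @ a # p"]) (fastforce simp: left_factor_def)
  qed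
qed simp

text \<open>Prepending \<open>u\<close> and \<open>a\<close> maps marked prefixes of the tail
  injectively to marked prefixes of the whole word, so uniqueness is inherited.\<close>

lemma deterministic_tail:
  assumes "deterministic L ((a, K) # ps)" "u \<in> L"
  shows "deterministic K ps"
  unfolding deterministic_def
proof (intro ballI allI impI)
  fix v i assume v: "v \<in> monomial K ps" and i: "i < length ps"
  have "u @ a # v \<in> monomial L ((a, K) # ps)" using v assms(2) by (rule monomial_ConsI[rotated])
  then have ex1: "\<exists>!p. prefix p (u @ a # v) \<and> p \<in> left_factor L ((a, K) # ps) (Suc i)"
    by (rule assms(1)[unfolded deterministic_def, rule_format]) (use i in simp)
  have lift: "prefix (u @ a # p) (u @ a # v) \<and> u @ a # p \<in> left_factor L ((a, K) # ps) (Suc i)"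
    if p: "prefix p v" "p \<in> left_factor K ps i" for p
    using p assms(2) by (fastforce simp: left_factor_def)
  obtain p where p: "prefix p v" "p \<in> left_factor K ps i"
    using left_factor_exists[OF v i] by blast
  show "\<exists>!p. prefix p v \<and> p \<in> left_factor K ps i"
  proof (rule ex1I[of _ p])
    fix p' assume "prefix p' v \<and> p' \<in> left_factor K ps i"
    then have "u @ a # p' = u @ a # p" using lift p ex1 by blast
    then show "p' = p" by simp
  qed (use p in blast)
qed

text \<open>
  A marker cannot follow a long block of powers of e inside its alphabet: otherwise the block
  could be enlarged by a copy of the text up to the marker, which creates a second marked prefix.
\<close>

lemma det_monomial_replace:
  assumes "deterministic L ps"
    and "\<And>K. K \<in> insert L (snd ` set ps) \<Longrightarrow> absorbs N K"
    and "\<And>K x y r. K \<in> insert L (snd ` set ps) \<Longrightarrow> N \<le> r \<Longrightarrow>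
      x @ word_pow e r @ t @ y \<in> K \<Longrightarrow> x @ word_pow e r @ t' @ y \<in> K"
    and "set t \<subseteq> set e"
    and "p @ word_pow e n @ t @ q \<in> monomial L ps" "Suc (length ps) * N \<le> n"
  shows "p @ word_pow e n @ t' @ q \<in> monomial L ps"
  using assms
proof (induction L ps arbitrary: p n rule: monomial.induct)
  case (1 L)
  then show ?case by simp
next
  case (2 L a K ps)
  \<comment> \<open>The exponent reserves \<open>N\<close> copies of \<open>e\<close> for each
    marker and \<open>N\<close> for the final factor. A marker found within the first
    \<open>N\<close> copies uses up only these.\<close>
  have n: "N \<le> n" "Suc (length ps) * N \<le> n - N" using 2(7) by auto
  obtain u v where uv: "p @ word_pow e n @ t @ q = u @ a # v" "u \<in> L" "v \<in> monomial K ps"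
    using 2(6) by auto
  have split: "word_pow e n = word_pow e N @ word_pow e (n - N)"
    using n(1) word_pow_add[of e N "n - N"] by simp
  consider (after) q1 where "u = p @ word_pow e n @ t @ q1" "q = q1 @ a # v"
    | (before) z where "p @ word_pow e N = u @ a # z" "v = z @ word_pow e (n - N) @ t @ q"
    | (inside) u' z where "u = p @ word_pow e N @ u'" "word_pow e (n - N) @ t = u' @ a # z"
  proof -
    have "(p @ word_pow e n @ t) @ q = u @ a # v" using uv by simp
    then show thesis
    proof (cases rule: marked_split)
      case right
      then show thesis using after by simp
    next
      case (left z)
      then have "(p @ word_pow e N) @ (word_pow e (n - N) @ t) = u @ a # z"
        by (simp add: split)
      then show thesis
      proof (cases rule: marked_split)
        case right
        then show thesis using inside by simp
      next
        case (left z')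
        then show thesis using before \<open>v = z @ q\<close> by simp
      qed
    qed
  qed
  then show ?case
  proof cases
    case after
    then have "p @ word_pow e n @ t' @ q1 \<in> L" using 2(4)[of L n p q1] n uv by simp
    then show ?thesis using after uv monomial_ConsI[of "p @ word_pow e n @ t' @ q1" L v K ps a] by simp
  next
    case before
    have "z @ word_pow e (n - N) @ t' @ q \<in> monomial K ps"
    proof (rule 2(1))
      show "deterministic K ps" using deterministic_tail[OF 2(2) uv(2)] .
      show "z @ word_pow e (n - N) @ t @ q \<in> monomial K ps" using before uv by simp
    qed (use 2 n in auto)
    then have "u @ a # (z @ word_pow e (n - N) @ t' @ q) \<in> monomial L ((a, K) # ps)"
      using uv(2) by (rule monomial_ConsI[rotated])
    also have "u @ a # (z @ word_pow e (n - N) @ t' @ q) = (p @ word_pow e N) @ word_pow e (n - N) @ t' @ q"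
      using before(1) by simp
    finally show ?thesis by (simp add: split)
  next
    case inside
    have "set (u' @ a # z) \<subseteq> set e"
      using inside(2) 2(5) set_word_pow_subset[of e] by (metis set_append Un_least)
    then have "set (u' @ [a]) \<subseteq> set e" by simp
    \<comment> \<open>Absorption in \<open>L\<close> inserts a word over the letters of
      \<open>e\<close> that ends with the marker, and one more power. In the resulting word both
      \<open>u\<close> and the longer \<open>?u2\<close> are followed by the marker, against
      determinism.\<close>
    then have "p @ word_pow e N @ (u' @ [a]) @ word_pow e N @ u' \<in> L"
      (is "?u2 \<in> L")
      using 2(3)[of L] uv(2) inside(1) unfolding absorbs_def by blast
    then have "?u2 @ a # v \<in> monomial L ((a, K) # ps)"
      using uv(3) by (rule monomial_ConsI)
    then have "\<exists>!p. prefix p (?u2 @ a # v) \<and> p \<in> left_factor L ((a, K) # ps) 0"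
      by (rule 2(2)[unfolded deterministic_def, rule_format]) simp
    moreover have "prefix (?u2 @ [a]) (?u2 @ a # v)" "prefix (u @ [a]) (?u2 @ a # v)"
      by (auto simp: inside(1))
    moreover have "?u2 @ [a] \<in> left_factor L ((a, K) # ps) 0" "u @ [a] \<in> left_factor L ((a, K) # ps) 0"
      using \<open>?u2 \<in> L\<close> uv(2) by (auto simp: left_factor_def)
    ultimately have "?u2 @ [a] = u @ [a]" by blast
    then show ?thesis by (simp add: inside(1))
  qed
qed

text \<open>By \<open>det_monomial_replace\<close>, a change directly after a long power of
  \<open>e\<close>, over the letters of \<open>e\<close>, takes place inside a single factor. With
  the outermost power of \<open>e\<close> in this role and the power of \<open>f\<close> as part of
  the right context, only the inner \<open>k\<close> pairs remain for that factor, which is one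
  level lower.\<close>

lemma good_det_monomial:
  assumes "deterministic L ps" "\<And>K. K \<in> insert L (snd ` set ps) \<Longrightarrow> good k N K" "0 < N"
  shows "good (Suc k) (Suc (length ps) * N) (monomial L ps)"
proof -
  define n where "n = Suc (length ps) * N"
  have n: "N \<le> n" "0 < n" "Suc (length ps) * N \<le> n" using assms(3) by (auto simp: n_def)
  have abs: "absorbs N K" if "K \<in> insert L (snd ` set ps)" for K
    using assms(2)[OF that] by (simp add: good_def)
  have replace: "x @ word_pow e n @ t' @ q \<in> monomial L ps"
    if "\<And>K x y r. K \<in> insert L (snd ` set ps) \<Longrightarrow> N \<le> r \<Longrightarrow>
      x @ word_pow e r @ t @ y \<in> K \<longleftrightarrow> x @ word_pow e r @ t' @ y \<in> K"
      "set t \<subseteq> set e" "x @ word_pow e n @ t @ q \<in> monomial L ps" for x e t t' q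
    using det_monomial_replace[OF assms(1) abs _ that(2,3) n(3), of t'] that(1) by blast
  have shrink: "x @ word_pow e r @ (s @ word_pow e n) @ y \<in> K \<longleftrightarrow> x @ word_pow e r @ [] @ y \<in> K"
    if "K \<in> insert L (snd ` set ps)" "N \<le> r" "set s \<subseteq> set e" for K x y r e s
  proof -
    note pow = absorbs_word_pow[OF abs[OF that(1)]]
    have "x @ word_pow e r @ (s @ word_pow e n) @ y \<in> K \<longleftrightarrow>
        x @ word_pow e N @ s @ word_pow e N @ y \<in> K"
      using pow[OF that(2), of x e "s @ word_pow e n @ y"] pow[OF n(1), of "x @ word_pow e N @ s" e y]
      by simp
    also have "\<dots> \<longleftrightarrow> x @ word_pow e r @ [] @ y \<in> K"
      using abs[OF that(1)] that(3) pow[OF that(2), of x e y] by (simp add: absorbs_def)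
    finally show ?thesis .
  qed
  have "absorbs n (monomial L ps)"
    unfolding absorbs_def
  proof (intro allI impI iffI)
    fix e s x y :: "'a list"
    assume s: "set s \<subseteq> set e"
    { assume "x @ word_pow e n @ s @ word_pow e n @ y \<in> monomial L ps"
      then have "x @ word_pow e n @ [] @ y \<in> monomial L ps"
        using s set_word_pow_subset[of e n] 
          replace[where e = e and t = "s @ word_pow e n" and t' = "[]" and x = x and q = y]
          shrink[OF _ _ s] by simp
      then show "x @ word_pow e n @ y \<in> monomial L ps" by simp }
    { assume "x @ word_pow e n @ y \<in> monomial L ps"
      then have "x @ word_pow e n @ (s @ word_pow e n) @ y \<in> monomial L ps"
        using s 
          replace[where e = e and t' = "s @ word_pow e n" and t = "[]" and x = x and q = y]
          shrink[OF _ _ s] by simp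
      then show "x @ word_pow e n @ s @ word_pow e n @ y \<in> monomial L ps" by simp }
  qed
  moreover have "respects_nested (Suc k) n (monomial L ps)"
    unfolding respects_nested_def
  proof (intro allI impI)
    fix efs :: "('a list \<times> 'a list) list" and s x y
    assume len: "length efs = Suc k" and nest: "nested s efs"
    obtain e f efs' where efs: "efs = (e, f) # efs'" using len by (cases efs) auto
    have sub: "set (wrap n s efs') \<subseteq> set e" "set (wrap n [] efs') \<subseteq> set e"
      using nest set_wrap[OF n(2), of s efs'] set_wrap_mono[of n efs' s] by (auto simp: efs)
    have *: "x @ word_pow e r @ wrap n s efs' @ y \<in> K \<longleftrightarrow>
        x @ word_pow e r @ wrap n [] efs' @ y \<in> K"
      if K: "K \<in> insert L (snd ` set ps)" and r: "N \<le> r" for K x y r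
    \<comment> \<open>For \<open>k = 0\<close> no inner pair is left: \<open>s\<close> is over the
      letters of the preceding nonempty power, so deleting it does not change the content.\<close>
    proof (cases "k = 0")
      case True
      then have "content_closed K" "efs' = []" using assms(2)[OF K] len by (auto simp: good_def efs)
      moreover have "set (x @ word_pow e r @ s @ y) = set (x @ word_pow e r @ y)"
        using sub r assms(3) \<open>efs' = []\<close> by (auto simp: set_word_pow)
      ultimately show ?thesis unfolding content_closed_def by simp
    next
      case False
      then have "respects_nested k n K"
        using good_mono[OF assms(2)[OF K] n(1)] by (simp add: good_def)
      then show ?thesis using nest len unfolding respects_nested_def efs
        by (metis append.assoc length_Cons nested.simps(2) old.nat.inject)
    qed
    have "x @ word_pow e n @ wrap n s efs' @ (word_pow f n @ y) \<in> monomial L ps \<longleftrightarrow>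
        x @ word_pow e n @ wrap n [] efs' @ (word_pow f n @ y) \<in> monomial L ps"
      using replace[OF * sub(1)] replace[OF *[symmetric] sub(2)] by blast
    then show "x @ wrap n s efs @ y \<in> monomial L ps \<longleftrightarrow> x @ wrap n [] efs @ y \<in> monomial L ps"
      by (simp add: efs)
  qed
  ultimately show ?thesis by (simp add: good_def n_def)
qed

section \<open>Mirror images of the identities and the induction on the level\<close>

lemma rev_wrap: "rev (wrap N s efs) = wrap N (rev s) (map (\<lambda>(e, f). (rev f, rev e)) efs)"
  by (induction N s efs rule: wrap.induct) (auto simp: rev_word_pow)

lemma nested_rev: "nested s efs \<Longrightarrow> nested (rev s) (map (\<lambda>(e, f). (rev f, rev e)) efs)"
proof (induction s efs rule: nested.induct)
  case (2 s e f efs)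
  have "set (wrap 1 (rev s) (map (\<lambda>(e, f). (rev f, rev e)) efs)) = set (wrap 1 s efs)"
    using rev_wrap[of 1 s efs] by (metis set_rev)
  then show ?case using 2 by auto
qed simp

lemma good_rev:
  assumes "good (Suc k) N (rev ` L)"
  shows "good (Suc k) N L"
proof -
  have mem: "u \<in> L \<longleftrightarrow> rev u \<in> rev ` L" for u by (simp add: in_rev_image_iff)
  have 1: "absorbs N (rev ` L)" "respects_nested (Suc k) N (rev ` L)" using assms by (auto simp: good_def)
  have "absorbs N L"
    using 1(1) unfolding absorbs_def mem by (simp add: rev_word_pow)
  moreover have "respects_nested (Suc k) N L"
    unfolding respects_nested_def mem
  proof (intro allI impI)
    fix efs :: "('a list \<times> 'a list) list" and s x y
    assume "length efs = Suc k" "nested s efs"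
    then show "rev (x @ wrap N s efs @ y) \<in> rev ` L \<longleftrightarrow> rev (x @ wrap N [] efs @ y) \<in> rev ` L"
      using 1(2)[unfolded respects_nested_def, rule_format,
          of "map (\<lambda>(e, f). (rev f, rev e)) efs" "rev s" "rev y" "rev x"] nested_rev[of s efs]
      by (simp add: rev_wrap del: rev_image_lists)
  qed
  ultimately show ?thesis by (simp add: good_def)
qed

lemma common_good:
  assumes "finite X" "\<And>K. K \<in> X \<Longrightarrow> \<exists>N>0. good k N K"
  shows "\<exists>N>0. \<forall>K \<in> X. good k N K"
  using assms
proof (induction rule: finite_induct)
  case (insert K X)
  then obtain M N where "0 < M" "good k M K" "\<forall>K \<in> X. good k N K" by blast
  then show ?case by (intro exI[of _ "max M N"]) (auto intro: good_mono)
qed auto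

lemma W_imp_good: "L \<in> W A (Suc k) \<Longrightarrow> \<exists>N>0. good k N L"
proof (induction k arbitrary: L)
  case 0
  then have "L \<in> boolean_combinations (lists A) {lists B |B. B \<subseteq> A}" by simp
  then show ?case
  proof (rule good_boolean_combinations)
    fix K assume "K \<in> {lists B |B. B \<subseteq> A}"
    then obtain B where K: "K = lists B" by blast
    have "good 0 1 K"
      unfolding good_iff_test_pairs using test_pairs_set[of _ _ 0 1]
      by (auto simp: K in_lists_conv_set)
    then show "\<exists>N>0. good 0 N K" by (intro exI[of _ 1]) simp
  qed
next
  case (Suc k)
  let ?V = "W A (Suc k)"
  have det: "\<exists>N>0. good (Suc k) N K" if K: "K \<in> det_monomials A ?V" for K
  proof -
    obtain L0 ps where K: "K = monomial L0 ps" "L0 \<in> ?V" "set ps \<subseteq> A \<times> ?V" "deterministic L0 ps"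
      using K unfolding det_monomials_def by blast
    have "\<exists>N>0. \<forall>M \<in> insert L0 (snd ` set ps). good k N M"
      using K(2,3) Suc.IH by (intro common_good) auto
    then obtain N where "0 < N" "\<And>M. M \<in> insert L0 (snd ` set ps) \<Longrightarrow> good k N M" by blast
    then show ?thesis using good_det_monomial[OF K(4), of k N] K(1)
      by (intro exI[of _ "Suc (length ps) * N"]) auto
  qed
  have "L \<in> boolean_combinations (lists A) (det_monomials A ?V \<union> codet_monomials A ?V)"
    using Suc.prems by simp
  then show ?case
  proof (rule good_boolean_combinations)
    fix K assume "K \<in> det_monomials A ?V \<union> codet_monomials A ?V"
    then show "\<exists>N>0. good (Suc k) N K"
    proof
      assume "K \<in> codet_monomials A ?V"
      then have "rev ` K \<in> det_monomials A ?V"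
        by (intro rev_codet_monomials) (auto intro: rev_W)
      then show ?thesis using det good_rev by blast
    qed (rule det)
  qed
qed

section \<open>Classes of the comparison relation belong to the hierarchy\<close>

lemma rev_in_lists_iff [simp]: "rev u \<in> lists A \<longleftrightarrow> u \<in> lists A"
  by (simp add: in_lists_conv_set)

lemma boolean_combinations_diff:
  assumes "X \<in> boolean_combinations U G" "Y \<in> boolean_combinations U G" "X \<subseteq> U"
  shows "X - Y \<in> boolean_combinations U G"
proof -
  have "X - Y = X \<inter> (U - Y)" using assms(3) by blast
  then show ?thesis
    using assms boolean_combinations.complement boolean_combinations.intersection by metis
qed

lemma boolean_combinations_Union:
  assumes "finite F" "F \<subseteq> boolean_combinations U G" "X \<in> boolean_combinations U G"
  shows "\<Union>F \<in> boolean_combinations U G"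
  using assms(1,2)
proof (induction rule: finite_induct)
  case empty
  have "X \<inter> (U - X) \<in> boolean_combinations U G"
    using assms(3) by (intro boolean_combinations.intersection boolean_combinations.complement)
  then show ?case by simp
next
  case (insert Y F)
  then show ?case by (simp add: boolean_combinations.union)
qed

lemma boolean_combinations_INT:
  assumes "finite F" "\<And>a. a \<in> F \<Longrightarrow> P a \<in> boolean_combinations U G"
    and "X \<in> boolean_combinations U G"
  shows "X \<inter> (\<Inter>a\<in>F. P a) \<in> boolean_combinations U G"
  using assms(1,2)
proof (induction rule: finite_induct)
  case empty
  then show ?case using assms(3) by simp
next
  case (insert a F)
  then have "P a \<inter> (X \<inter> (\<Inter>a\<in>F. P a)) \<in> boolean_combinations U G"
    by (simp add: boolean_combinations.intersection)
  then show ?case by (simp add: Int_left_commute)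
qed

lemma W_boolean: "\<exists>G. W A (Suc k) = boolean_combinations (lists A) G"
  by (cases k) auto

lemma lists_in_W: "B \<subseteq> A \<Longrightarrow> lists B \<in> W A (Suc k)"
proof (induction k)
  case 0
  then have "lists B \<in> boolean_combinations (lists A) {lists B |B. B \<subseteq> A}"
    by (intro boolean_combinations.generator) blast
  then show ?case by simp
qed (use W_Suc_mono in blast)

lemma content_class_in_W:
  assumes "finite A" "B \<subseteq> A"
  shows "{v \<in> lists A. set v = B} \<in> W A (Suc k)"
proof -
  obtain G where G: "W A (Suc k) = boolean_combinations (lists A) G" using W_boolean by blast
  have "lists B \<inter> (\<Inter>a\<in>B. lists A - lists (A - {a})) \<in> W A (Suc k)"
    unfolding G
  proof (rule boolean_combinations_INT)
    show "finite B" using assms finite_subset by blast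
    show "lists B \<in> boolean_combinations (lists A) G"
      using lists_in_W[OF assms(2), of k] G by simp
    show "lists A - lists (A - {a}) \<in> boolean_combinations (lists A) G" for a
      using lists_in_W[of "A - {a}" A k] G by (auto intro: boolean_combinations.complement)
  qed
  also have "lists B \<inter> (\<Inter>a\<in>B. lists A - lists (A - {a})) = {v \<in> lists A. set v = B}"
    using assms(2) by (auto simp: in_lists_conv_set)
  finally show ?thesis .
qed

text \<open>No word of \<open>K\<close> contains \<open>a\<close>, so the first marker can only be
  the first \<open>a\<close> of the word; the other markers are then located in the rest.\<close>

lemma marked_product_deterministic:
  assumes "K \<subseteq> lists (- {a})" "deterministic L ps"
  shows "deterministic K ((a, L) # ps)"
  unfolding deterministic_def
proof (intro ballI allI impI)
  fix u i assume "u \<in> monomial K ((a, L) # ps)" and i: "i < length ((a, L) # ps)"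
  then obtain x v where u: "u = x @ a # v" "x \<in> K" "v \<in> monomial L ps" by auto
  have no_a: "a \<notin> set y" if "y \<in> K" for y using assms(1) that by auto
  have unique: "y = x \<and> prefix p v" if y: "y \<in> K" "prefix (y @ a # p) u" for y p
  proof -
    obtain z where "u = (y @ a # p) @ z" using y(2) unfolding prefix_def by blast
    then have "y @ a # (p @ z) = x @ a # v" by (simp add: u)
    then have "y = x \<and> p @ z = v"
      by (rule first_occurrence_unique) (use no_a y(1) u(2) in auto)
    then show ?thesis by auto
  qed
  show "\<exists>!p. prefix p u \<and> p \<in> left_factor K ((a, L) # ps) i"
  proof (cases i)
    case 0
    show ?thesis
    proof (rule ex1I[of _ "x @ [a]"])
      show "prefix (x @ [a]) u \<and> x @ [a] \<in> left_factor K ((a, L) # ps) i"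
        using u by (auto simp: 0 left_factor_def)
    next
      fix p assume p: "prefix p u \<and> p \<in> left_factor K ((a, L) # ps) i"
      then obtain y where "p = y @ [a]" "y \<in> K" by (auto simp: 0 left_factor_def)
      then show "p = x @ [a]" using p unique[of y "[]"] by simp
    qed
  next
    case (Suc j)
    have lf: "left_factor K ((a, L) # ps) i = {y @ a # p |y p. y \<in> K \<and> p \<in> left_factor L ps j}"
      by (fastforce simp: Suc left_factor_def)
    have ex1: "\<exists>!p. prefix p v \<and> p \<in> left_factor L ps j"
      by (rule assms(2)[unfolded deterministic_def, rule_format]) (use u i Suc in auto)
    then obtain p where p: "prefix p v" "p \<in> left_factor L ps j" by blast
    show ?thesis
    proof (rule ex1I[of _ "x @ a # p"])
      show "prefix (x @ a # p) u \<and> x @ a # p \<in> left_factor K ((a, L) # ps) i"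
        unfolding lf using u p by auto
    next
      fix p' assume p': "prefix p' u \<and> p' \<in> left_factor K ((a, L) # ps) i"
      then obtain y q where "p' = y @ a # q" "y \<in> K" "q \<in> left_factor L ps j" unfolding lf by blast
      then show "p' = x @ a # p" using p' unique[of y q] p ex1 by blast
    qed
  qed
qed

text \<open>Since the factorisation at the first \<open>a\<close> is unique, prepending
  \<open>K\<close> and \<open>a\<close> commutes with intersection and relative complement, so it
  suffices to treat generators. Prepending keeps a monomial deterministic, while codeterminism may
  be lost; hence only deterministic generators occur here.\<close>

lemma marked_product_det_combination:
  assumes "X \<in> boolean_combinations (lists A) (det_monomials A V)"
    and "K \<in> V" "K \<subseteq> lists (A - {a})" "a \<in> A" "lists A \<in> V" "\<And>L. L \<in> V \<Longrightarrow> L \<subseteq> lists A"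
  shows "{x @ a # y |x y. x \<in> K \<and> y \<in> X} \<in> boolean_combinations (lists A) (det_monomials A V)"
proof -
  define f where "f X = {x @ a # y |x y. x \<in> K \<and> y \<in> X}" for X
  let ?D = "boolean_combinations (lists A) (det_monomials A V)"
  have no_a: "a \<notin> set y" if "y \<in> K" for y using assms(3) that by auto
  have gen: "f X \<in> ?D" if X: "X \<in> det_monomials A V" for X
  proof -
    obtain L ps where X: "X = monomial L ps" "L \<in> V" "set ps \<subseteq> A \<times> V" "deterministic L ps"
      using X unfolding det_monomials_def by blast
    have "deterministic K ((a, L) # ps)"
      by (rule marked_product_deterministic) (use assms(3) X in auto)
    moreover have "set ((a, L) # ps) \<subseteq> A \<times> V" using X assms(4) by simp
    moreover have "f X = monomial K ((a, L) # ps)" by (simp add: f_def X)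
    ultimately have "f X \<in> det_monomials A V" using assms(2) unfolding det_monomials_def by blast
    then show ?thesis by (rule boolean_combinations.generator)
  qed
  have "deterministic (lists A) []" by (simp add: deterministic_def)
  then have "lists A \<in> det_monomials A V"
    using assms(5) unfolding det_monomials_def
    by (intro CollectI exI[of _ "lists A"] exI[of _ "[]"]) simp
  then have full: "f (lists A) \<in> ?D" by (rule gen)
  have unique: "x = x' \<and> y = y'" if "x @ a # y = x' @ a # y'" "x \<in> K" "x' \<in> K" for x y x' y'
    using first_occurrence_unique[OF that(1)] no_a that by blast
  have sub: "f Y \<subseteq> lists A" if "Y \<subseteq> lists A" for Y
    using that assms(4) subsetD[OF assms(6)[OF assms(2)]] unfolding f_def by fastforce
  have "f X \<in> ?D"
    using assms(1)
  proof induction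
    case (generator L)
    then show ?case by (rule gen)
  next
    case (complement L)
    \<comment> \<open>The complement must be taken within the product of \<open>K\<close>,
      \<open>a\<close> and all words, which is itself a deterministic monomial.\<close>
    have "f (lists A - L) = f (lists A) - f L"
      unfolding f_def using unique by blast
    then show ?case using boolean_combinations_diff[OF full complement.IH sub] by simp
  next
    case (union L M)
    have "f (L \<union> M) = f L \<union> f M" unfolding f_def by blast
    then show ?case using union by (simp add: boolean_combinations.union)
  next
    case (intersection L M)
    have "f (L \<inter> M) = f L \<inter> f M" unfolding f_def using unique by blast
    then show ?case using intersection by (simp add: boolean_combinations.intersection)
  qed
  then show ?thesis by (simp add: f_def)
qed

definition sim_class :: "'a set \<Rightarrow> nat \<Rightarrow> nat \<Rightarrow> 'a list \<Rightarrow> 'a list set" where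
  "sim_class A k n u = {v \<in> lists A. sim k n u v}"

text \<open>The existential form of the cut condition presents a class as a finite intersection of
  marked products.\<close>

lemma sim_Suc_iff:
  "sim (Suc k) (Suc n) u v \<longleftrightarrow> set u = set v \<and> (\<forall>a \<in> set u. \<exists>u0 u1 v0 v1.
    u = u0 @ a # u1 \<and> a \<notin> set u0 \<and> v = v0 @ a # v1 \<and> a \<notin> set v0 \<and>
    sim k n (rev u0) (rev v0) \<and> sim (Suc k) n u1 v1)" (is "_ \<longleftrightarrow> ?rhs")
proof
  assume *: "sim (Suc k) (Suc n) u v"
  then have s: "set u = set v" by (rule sim_set)
  moreover have "\<exists>u0 u1 v0 v1. u = u0 @ a # u1 \<and> a \<notin> set u0 \<and> v = v0 @ a # v1 \<and> a \<notin> set v0 \<and>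
    sim k n (rev u0) (rev v0) \<and> sim (Suc k) n u1 v1" if "a \<in> set u" for a
  proof -
    from that obtain u0 u1 where u: "u = u0 @ a # u1" "a \<notin> set u0" by (rule first_occurrence)
    from that s have "a \<in> set v" by simp
    then obtain v0 v1 where v: "v = v0 @ a # v1" "a \<notin> set v0" by (rule first_occurrence)
    show ?thesis using sim_splitD[OF * u v] u v by blast
  qed
  ultimately show ?rhs by blast
next
  assume rhs: ?rhs
  show "sim (Suc k) (Suc n) u v"
  proof (rule sim_SucI)
    fix a u0 u1 v0 v1
    assume *: "u = u0 @ a # u1" "a \<notin> set u0" "v = v0 @ a # v1" "a \<notin> set v0"
    then have "a \<in> set u" by simp
    then obtain x0 x1 y0 y1 where x: "u = x0 @ a # x1" "a \<notin> set x0" "v = y0 @ a # y1"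
      "a \<notin> set y0" "sim k n (rev x0) (rev y0)" "sim (Suc k) n x1 y1"
      using rhs by blast
    have "x0 = u0 \<and> x1 = u1" "y0 = v0 \<and> y1 = v1"
      using first_occurrence_unique[of x0 a x1 u0 u1] first_occurrence_unique[of y0 a y1 v0 v1] * x
      by simp_all
    then show "sim k n (rev u0) (rev v0) \<and> sim (Suc k) n u1 v1" using x by simp
  qed (use rhs in blast)
qed

text \<open>For each letter \<open>a\<close> of \<open>u\<close>, the cut condition is a marked
  product: its left factor is the mirror of a class one level lower, restricted to words without
  \<open>a\<close>, and its right factor is a class of smaller depth. The inner induction stays
  within combinations of deterministic monomials, where
  \<open>marked_product_det_combination\<close> applies.\<close>

lemma sim_class_in_W:
  assumes "finite A" "u \<in> lists A"
  shows "sim_class A k n u \<in> W A (Suc k)"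
  using assms(2)
proof (induction k arbitrary: n u)
  case 0
  then have "set u \<subseteq> A" by auto
  then show ?case
    using content_class_in_W[OF assms(1), of "set u" 0] by (simp add: sim_class_def eq_commute)
next
  case (Suc k)
  note IHk = Suc.IH
  let ?V = "W A (Suc k)"
  let ?D = "boolean_combinations (lists A) (det_monomials A ?V)"
  have VD: "L \<in> ?D" if "L \<in> ?V" for L
  proof -
    have "deterministic L []" by (simp add: deterministic_def)
    then have "L \<in> det_monomials A ?V"
      using that unfolding det_monomials_def by (intro CollectI exI[of _ L] exI[of _ "[]"]) simp
    then show ?thesis by (rule boolean_combinations.generator)
  qed
  have content: "{v \<in> lists A. set v = set u} \<in> ?D" if "u \<in> lists A" for u
    using content_class_in_W[OF assms(1), of "set u" k] that by (intro VD) auto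
  have "sim_class A (Suc k) n u \<in> ?D"
    using Suc.prems
  proof (induction n arbitrary: u)
    case 0
    then show ?case using content[OF 0] by (simp add: sim_class_def eq_commute)
  next
    case (Suc n)
    define P where "P a = {v \<in> lists A. \<exists>u0 u1 v0 v1. u = u0 @ a # u1 \<and> a \<notin> set u0 \<and>
      v = v0 @ a # v1 \<and> a \<notin> set v0 \<and> sim k n (rev u0) (rev v0) \<and> sim (Suc k) n u1 v1}" for a
    have "P a \<in> ?D" if "a \<in> set u" for a
    proof -
      from that obtain u0 u1 where u: "u = u0 @ a # u1" "a \<notin> set u0" by (rule first_occurrence)
      define K where "K = rev ` sim_class A k n (rev u0) \<inter> lists (A - {a})"
      have aA: "a \<in> A" "u0 \<in> lists A" "u1 \<in> lists A" using u Suc.prems by auto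
      obtain G where G: "?V = boolean_combinations (lists A) G" using W_boolean by blast
      have K: "K \<in> ?V"
        unfolding K_def G
        using rev_W[OF IHk, of "rev u0" n] lists_in_W[of "A - {a}" A k] aA
        by (intro boolean_combinations.intersection) (auto simp: G)
      have "P a = {x @ a # y |x y. x \<in> K \<and> y \<in> sim_class A (Suc k) n u1}"
      proof (intro set_eqI iffI)
        fix v assume "v \<in> P a"
        then obtain x0 x1 v0 v1 where v: "v \<in> lists A" "u = x0 @ a # x1" "a \<notin> set x0"
          "v = v0 @ a # v1" "a \<notin> set v0" "sim k n (rev x0) (rev v0)" "sim (Suc k) n x1 v1"
          unfolding P_def by blast
        have "x0 @ a # x1 = u0 @ a # u1" using u(1) v(2) by simp
        from first_occurrence_unique[OF this v(3) u(2)] have x: "x0 = u0" "x1 = u1" by simp_all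
        have v01: "v0 \<in> lists A" "v1 \<in> lists A" using v(1) unfolding v(4) by simp_all
        then have "v0 \<in> lists (A - {a})" using v(5) by (auto simp: in_lists_conv_set)
        then have "v0 \<in> K" "v1 \<in> sim_class A (Suc k) n u1"
          using v(6,7) v01 by (simp_all add: K_def in_rev_image_iff sim_class_def x)
        then show "v \<in> {x @ a # y |x y. x \<in> K \<and> y \<in> sim_class A (Suc k) n u1}" using v(4) by blast
      next
        fix v assume "v \<in> {x @ a # y |x y. x \<in> K \<and> y \<in> sim_class A (Suc k) n u1}"
        then obtain x y where v: "v = x @ a # y" "x \<in> K" "y \<in> sim_class A (Suc k) n u1" by blast
        have "a \<notin> set x" "x \<in> lists A" "sim k n (rev u0) (rev x)"
          using v(2) by (auto simp: K_def in_rev_image_iff sim_class_def)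
        moreover have "sim (Suc k) n u1 y" "y \<in> lists A" using v(3) by (simp_all add: sim_class_def)
        moreover have "v \<in> lists A" using calculation aA(1) by (simp add: v(1))
        ultimately show "v \<in> P a" using u v(1) unfolding P_def by blast
      qed
      also have "\<dots> \<in> ?D"
      proof (rule marked_product_det_combination)
        show "sim_class A (Suc k) n u1 \<in> ?D" using Suc.IH aA by blast
        show "lists A \<in> ?V" by (rule lists_in_W) simp
        show "L \<subseteq> lists A" if "L \<in> ?V" for L using that by (rule W_subset_lists)
      qed (use K aA in \<open>auto simp: K_def\<close>)
      finally show ?thesis .
    qed
    then have "{v \<in> lists A. set v = set u} \<inter> (\<Inter>a\<in>set u. P a) \<in> ?D"
      using content[OF Suc.prems] by (intro boolean_combinations_INT) auto
    also have "{v \<in> lists A. set v = set u} \<inter> (\<Inter>a\<in>set u. P a) = sim_class A (Suc k) (Suc n) u"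
      unfolding sim_class_def sim_Suc_iff P_def by blast
    finally show ?case .
  qed
  then show ?case
    unfolding W.simps by (rule boolean_combinations_mono) simp
qed

lemma finite_sim_classes:
  assumes "finite A"
  shows "finite (sim_class A k n ` lists A)"
proof (induction k arbitrary: n)
  case content: 0
  have "finite (set ` lists A)" by (rule finite_subset[of _ "Pow A"]) (use assms in auto)
  then show ?case by (rule finite_image_if_kernel) (simp add: sim_class_def)
next
  case IHk: (Suc k)
  show ?case
  proof (induction n)
    case 0
    have "finite (set ` lists A)" by (rule finite_subset[of _ "Pow A"]) (use assms in auto)
    then show ?case by (rule finite_image_if_kernel) (simp add: sim_class_def)
  next
    case (Suc n)
    define before where "before a u = takeWhile (\<lambda>b. b \<noteq> a) u" for a and u :: "'a list"
    define after where "after a u = tl (dropWhile (\<lambda>b. b \<noteq> a) u)" for a and u :: "'a list"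
    have cut: "before a u = u0" "after a u = u1" if "u = u0 @ a # u1" "a \<notin> set u0" for a u u0 u1
    proof -
      have "\<forall>b \<in> set u0. b \<noteq> a" using that(2) by blast
      then show "before a u = u0" "after a u = u1"
        by (simp_all add: before_def after_def that(1))
    qed
    \<comment> \<open>The class of \<open>u\<close> is determined by its content and the classes of
      the two parts of each cut. Letters that do not occur in \<open>u\<close> get a dummy pair, and
      restriction to \<open>A\<close> puts the values into a finite function space.\<close>
    define g where "g u = (set u, \<lambda>a\<in>A. if a \<in> set u then
      (sim_class A k n (rev (before a u)), sim_class A (Suc k) n (after a u)) else ({}, {}))" for u
    have "finite (g ` lists A)"
    proof (rule finite_subset)
      show "g ` lists A \<subseteq> Pow A \<times>
          (\<Pi>\<^sub>E a\<in>A. insert ({}, {}) (sim_class A k n ` lists A \<times> sim_class A (Suc k) n ` lists A))"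
      proof
        fix z assume "z \<in> g ` lists A"
        then obtain u where u: "z = g u" "u \<in> lists A" by blast
        have "before a u \<in> lists A \<and> after a u \<in> lists A" if a: "a \<in> set u" for a
        proof -
          obtain u0 u1 where "u = u0 @ a # u1" "a \<notin> set u0" using a by (rule first_occurrence)
          then show ?thesis using cut u(2) by auto
        qed
        moreover have "set u \<subseteq> A" using u(2) by auto
        ultimately show "z \<in> Pow A \<times>
          (\<Pi>\<^sub>E a\<in>A. insert ({}, {}) (sim_class A k n ` lists A \<times> sim_class A (Suc k) n ` lists A))"
          unfolding u(1) g_def by (auto simp del: in_lists_conv_set)
      qed
      show "finite (Pow A \<times>
          (\<Pi>\<^sub>E a\<in>A. insert ({}, {}) (sim_class A k n ` lists A \<times> sim_class A (Suc k) n ` lists A)))"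
        using assms IHk Suc by (intro finite_cartesian_product finite_PiE) auto
    qed
    then show ?case
    proof (rule finite_image_if_kernel)
      have *: "sim (Suc k) (Suc n) u' v"
        if "u' \<in> lists A" "v \<in> lists A" and g: "g u = g u'" and sim: "sim (Suc k) (Suc n) u v" for u u' v
      proof (rule sim_SucI)
        have set: "set u = set u'" using g by (simp add: g_def)
        then show "set u' = set v" using sim_set[OF sim] by simp
        fix a x0 x1 v0 v1
        assume *: "u' = x0 @ a # x1" "a \<notin> set x0" "v = v0 @ a # v1" "a \<notin> set v0"
        have a: "a \<in> A" "a \<in> set u" "a \<in> set u'" using that(1) * set by auto
        obtain u0 u1 where u: "u = u0 @ a # u1" "a \<notin> set u0" using a(2) by (rule first_occurrence)
        have "snd (g u) a = snd (g u') a" using g by simp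
        then have "sim_class A k n (rev u0) = sim_class A k n (rev x0)"
          "sim_class A (Suc k) n u1 = sim_class A (Suc k) n x1"
          using a cut[OF u] cut[OF *(1,2)] by (simp_all add: g_def)
        moreover have "rev v0 \<in> sim_class A k n (rev u0)" "v1 \<in> sim_class A (Suc k) n u1"
          using sim_splitD[OF sim u *(3,4)] that(2) *(3) by (auto simp: sim_class_def)
        ultimately show "sim k n (rev x0) (rev v0) \<and> sim (Suc k) n x1 v1"
          by (simp add: sim_class_def)
      qed
      show "sim_class A (Suc k) (Suc n) u = sim_class A (Suc k) (Suc n) u'"
        if "u \<in> lists A" "u' \<in> lists A" "g u = g u'" for u u'
        using *[of u' _ u] *[of u _ u'] that by (auto simp: sim_class_def)
    qed
  qed
qed

text \<open>\<open>L\<close> is a union of classes; each is the intersection of a class of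
  \<open>sim\<close> with the mirror of another, and there are finitely many.\<close>

lemma eqv_saturated_in_W:
  assumes "finite A" "L \<subseteq> lists A"
    and "\<And>u v. u \<in> L \<Longrightarrow> v \<in> lists A \<Longrightarrow> eqv k n u v \<Longrightarrow> v \<in> L"
  shows "L \<in> W A (Suc k)"
proof -
  define C where "C u = sim_class A k n u \<inter> rev ` sim_class A k n (rev u)" for u
  have C: "C u = {v \<in> lists A. eqv k n u v}" for u
    by (auto simp: C_def sim_class_def eqv_def in_rev_image_iff)
  obtain G where G: "W A (Suc k) = boolean_combinations (lists A) G" using W_boolean by blast
  have CW: "C u \<in> W A (Suc k)" if "u \<in> lists A" for u
    unfolding C_def G
    using sim_class_in_W[OF assms(1) that, of k n]
      rev_W[OF sim_class_in_W[OF assms(1)], of "rev u" k n] that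
    unfolding G by (intro boolean_combinations.intersection) simp_all
  have "finite ((\<lambda>u. (sim_class A k n u, sim_class A k n (rev u))) ` lists A)"
    by (rule finite_subset[of _ "sim_class A k n ` lists A \<times> sim_class A k n ` lists A"])
      (use finite_sim_classes[OF assms(1)] in auto)
  then have "finite (C ` lists A)"
    by (rule finite_image_if_kernel) (simp add: C_def)
  then have "finite (C ` L)" using assms(2) by (meson finite_subset image_mono)
  then have "\<Union>(C ` L) \<in> W A (Suc k)"
    unfolding G
  proof (rule boolean_combinations_Union)
    show "C ` L \<subseteq> boolean_combinations (lists A) G" using CW assms(2) G by auto
    show "lists A \<in> boolean_combinations (lists A) G" using lists_in_W[of A A k] G by simp
  qed
  also have "\<Union>(C ` L) = L"
    using assms eqv_refl[of k n] unfolding C by blast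
  finally show ?thesis .
qed

section \<open>The syntactic congruence\<close>

definition syntactic_class :: "'a list set \<Rightarrow> 'a list \<Rightarrow> 'a list set" where
  "syntactic_class L u = {v. \<forall>x y. x @ u @ y \<in> L \<longleftrightarrow> x @ v @ y \<in> L}"

lemma syntactic_class_eq_iff:
  "syntactic_class L u = syntactic_class L v \<longleftrightarrow> (\<forall>x y. x @ u @ y \<in> L \<longleftrightarrow> x @ v @ y \<in> L)"
  unfolding syntactic_class_def by blast

lemma nested_imp_in_W:
  assumes "L \<subseteq> lists A" "absorbing A (syntactic_class L) N" "0 < N"
    and "\<And>efs s. length efs = Suc k \<Longrightarrow> set efs \<subseteq> lists A \<times> lists A \<Longrightarrow> nested s efs \<Longrightarrow>
      syntactic_class L (wrap N s efs) = syntactic_class L (wrap N [] efs)"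
  shows "L \<in> W A (Suc (Suc k))"
proof -
  interpret absorbing A "syntactic_class L" N by (rule assms(2))
  obtain n where n: "\<forall>u \<in> lists A. \<forall>v \<in> lists A. eqv (Suc k) n u v \<longrightarrow>
      syntactic_class L u = syntactic_class L v"
    using absorbing_nested_imp_eqv[OF assms(2-4)] by blast
  show ?thesis
  proof (rule eqv_saturated_in_W)
    fix u v assume uv: "u \<in> L" "v \<in> lists A" "eqv (Suc k) n u v"
    then have "syntactic_class L u = syntactic_class L v" using n assms(1) by blast
    then have "[] @ u @ [] \<in> L \<longleftrightarrow> [] @ v @ [] \<in> L" unfolding syntactic_class_eq_iff by blast
    then show "v \<in> L" using uv(1) by simp
  qed (use finite_A assms(1) in auto)
qed

section \<open>Short test words suffice\<close>

lemma syntactic_class_cong: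
  "syntactic_class L u = syntactic_class L v \<Longrightarrow>
    syntactic_class L (x @ u @ y) = syntactic_class L (x @ v @ y)"
  unfolding syntactic_class_eq_iff by (metis append.assoc)

lemma syntactic_class_append:
  assumes "syntactic_class L u = syntactic_class L u'" "syntactic_class L v = syntactic_class L v'"
  shows "syntactic_class L (u @ v) = syntactic_class L (u' @ v')"
  using syntactic_class_cong[OF assms(1), of "[]" v] syntactic_class_cong[OF assms(2), of u' "[]"]
  by simp

lemma syntactic_class_word_pow:
  assumes "syntactic_class L u = syntactic_class L v"
  shows "syntactic_class L (word_pow u n) = syntactic_class L (word_pow v n)"
proof (induction n)
  case (Suc n)
  show ?case using syntactic_class_append[OF assms Suc] by (simp add: word_pow_Suc)
qed simp

lemma syntactic_class_member:
  "syntactic_class L u = syntactic_class L v \<Longrightarrow> u \<in> L \<longleftrightarrow> v \<in> L"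
  unfolding syntactic_class_eq_iff by (metis append_Nil append_Nil2)

lemma repeated_image:
  fixes f :: "nat \<Rightarrow> 'b"
  assumes "f ` {..K} \<subseteq> S" "finite S" "card S \<le> K"
  obtains i j where "i < j" "j \<le> K" "f i = f j"
proof -
  have "card (f ` {..K}) \<le> K" using card_mono[OF assms(2,1)] assms(3) by simp
  then have "\<not> inj_on f {..K}" using card_image[of f "{..K}"] by auto
  then obtain i j where "i \<le> K" "j \<le> K" "i \<noteq> j" "f i = f j" by (auto simp: inj_on_def)
  then show ?thesis using that[of i j] that[of j i] by (cases "i < j") auto
qed

text \<open>Two of the prefixes of length at most \<open>K\<close> have the same image; the factor
  between them can be cut out.\<close>

lemma short_representative:
  assumes "finite (g ` lists A)" "card (g ` lists A) \<le> K"
    and cong: "\<And>u v y. g u = g v \<Longrightarrow> g (u @ y) = g (v @ y)"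
    and "w \<in> lists A"
  shows "\<exists>w' \<in> lists A. length w' \<le> K \<and> g w' = g w"
  using assms(4)
proof (induction "length w" arbitrary: w rule: less_induct)
  case less
  show ?case
  proof (cases "length w \<le> K")
    case True
    then show ?thesis using less.prems by blast
  next
    case False
    have "(\<lambda>i. g (take i w)) ` {..K} \<subseteq> g ` lists A"
      using less.prems by (auto dest: in_set_takeD)
    from repeated_image[OF this assms(1,2)]
    obtain i j where ij: "i < j" "j \<le> K" "g (take i w) = g (take j w)" by metis
    define v where "v = take i w @ drop j w"
    have "g v = g (take j w @ drop j w)" unfolding v_def by (rule cong) (rule ij)
    then have "g v = g w" by simp
    moreover have "length v < length w" "v \<in> lists A"
      using ij False less.prems by (auto simp: v_def dest: in_set_takeD in_set_dropD)
    ultimately show ?thesis using less.hyps by metis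
  qed
qed

text \<open>Membership in the hierarchy yields some unknown \<open>N\<close>, whereas
  \<open>K\<close> can be computed. Among the exponents up to \<open>K\<close> two give the same
  class, so the power with exponent \<open>K\<close> is already on the cycle of the powers of
  \<open>e\<close>; adding periods leads beyond \<open>N\<close>, where the powers are
  constant.\<close>

lemma syntactic_class_pow_stable:
  assumes "absorbs N L" "finite (syntactic_class L ` lists A)"
    "card (syntactic_class L ` lists A) \<le> K" "e \<in> lists A"
  shows "syntactic_class L (word_pow e K) = syntactic_class L (word_pow e N)"
proof -
  have stable: "syntactic_class L (word_pow e n) = syntactic_class L (word_pow e N)" if "N \<le> n" for n
    unfolding syntactic_class_eq_iff using absorbs_word_pow[OF assms(1) that] by blast
  have "(\<lambda>i. syntactic_class L (word_pow e i)) ` {..K} \<subseteq> syntactic_class L ` lists A"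
    by (rule image_subsetI) (rule imageI, rule word_pow_in_lists, rule assms(4))
  from repeated_image[OF this assms(2,3)] obtain i j where ij: "i < j" "j \<le> K"
    "syntactic_class L (word_pow e i) = syntactic_class L (word_pow e j)"
    by metis
  have shift: "syntactic_class L (word_pow e (n + (j - i))) = syntactic_class L (word_pow e n)"
    if "i \<le> n" for n
  proof -
    have "word_pow e n = word_pow e i @ word_pow e (n - i)"
      "word_pow e (n + (j - i)) = word_pow e j @ word_pow e (n - i)"
      using that ij(1) word_pow_add[of e i "n - i"] word_pow_add[of e j "n - i"]
      by (simp_all add: add.commute)
    then show ?thesis using syntactic_class_append[OF ij(3) refl, of "word_pow e (n - i)"] by simp
  qed
  have "syntactic_class L (word_pow e (K + m * (j - i))) = syntactic_class L (word_pow e K)" for m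
  proof (induction m)
    case (Suc m)
    have "K + Suc m * (j - i) = K + m * (j - i) + (j - i)" by simp
    then show ?case using Suc shift[of "K + m * (j - i)"] ij by simp
  qed simp
  moreover have "N * 1 \<le> N * (j - i)" using ij(1) by (intro mult_le_mono2) simp
  then have "N \<le> K + N * (j - i)" by linarith
  ultimately show ?thesis using stable by metis
qed

lemma syntactic_class_wrap:
  assumes "\<And>e. e \<in> lists A \<Longrightarrow> syntactic_class L (word_pow e K) = syntactic_class L (word_pow e N)"
    and "set efs \<subseteq> lists A \<times> lists A"
  shows "syntactic_class L (wrap K s efs) = syntactic_class L (wrap N s efs)"
  using assms(2)
proof (induction efs)
  case (Cons ef efs)
  obtain e f where ef: "ef = (e, f)" by fastforce
  show ?case using Cons assms(1) unfolding ef wrap.simps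
    by (intro syntactic_class_append) auto
qed simp

definition test_words :: "'a set \<Rightarrow> nat \<Rightarrow> 'a list set" where
  "test_words A K = {w \<in> lists A. length w \<le> K}"

text \<open>The single number \<open>K\<close> serves as exponent and as bound on the length of
  every word involved, the contexts included, so that over a finite alphabet the tests are finite in
  number.\<close>

definition passes_tests :: "'a set \<Rightarrow> nat \<Rightarrow> nat \<Rightarrow> 'a list set \<Rightarrow> bool" where
  "passes_tests A k K L \<longleftrightarrow>
    (\<forall>e \<in> test_words A K. \<forall>s \<in> test_words A K. \<forall>x \<in> test_words A K. \<forall>y \<in> test_words A K.
      set s \<subseteq> set e \<longrightarrow>
      (x @ word_pow e K @ s @ word_pow e K @ y \<in> L \<longleftrightarrow> x @ word_pow e K @ y \<in> L)) \<and>
    (\<forall>efs. length efs = k \<longrightarrow> set efs \<subseteq> test_words A K \<times> test_words A K \<longrightarrow>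
      (\<forall>s \<in> test_words A K. \<forall>x \<in> test_words A K. \<forall>y \<in> test_words A K. nested s efs \<longrightarrow>
        (x @ wrap K s efs @ y \<in> L \<longleftrightarrow> x @ wrap K [] efs @ y \<in> L)))"

lemma W_imp_passes_tests:
  assumes "L \<in> W A (Suc (Suc k))" "finite (syntactic_class L ` lists A)"
    "card (syntactic_class L ` lists A) \<le> K"
  shows "passes_tests A (Suc k) K L"
proof -
  obtain N where "good (Suc k) N L" using W_imp_good[OF assms(1)] by blast
  then have N: "absorbs N L" "respects_nested (Suc k) N L" by (auto simp: good_def)
  note pow = syntactic_class_pow_stable[OF N(1) assms(2,3)]
  show ?thesis
    unfolding passes_tests_def
  proof (intro conjI ballI allI impI)
    fix e s x y assume "e \<in> test_words A K" and s: "set s \<subseteq> set e"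
    then have e: "e \<in> lists A" by (simp add: test_words_def)
    have "syntactic_class L (x @ word_pow e K @ s @ word_pow e K @ y) =
        syntactic_class L (x @ word_pow e N @ s @ word_pow e N @ y)"
      "syntactic_class L (x @ word_pow e K @ y) = syntactic_class L (x @ word_pow e N @ y)"
      using pow[OF e] by (intro syntactic_class_append; simp)+
    then show "x @ word_pow e K @ s @ word_pow e K @ y \<in> L \<longleftrightarrow> x @ word_pow e K @ y \<in> L"
      using N(1) s syntactic_class_member unfolding absorbs_def by metis
  next
    fix efs s x y
    assume efs: "length efs = Suc k" "set efs \<subseteq> test_words A K \<times> test_words A K" "nested s efs"
    then have sub: "set efs \<subseteq> lists A \<times> lists A" by (auto simp: test_words_def)
    have "syntactic_class L (x @ wrap K t efs @ y) = syntactic_class L (x @ wrap N t efs @ y)" for t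
      using syntactic_class_wrap[OF pow sub, of t] by (rule syntactic_class_cong)
    then show "x @ wrap K s efs @ y \<in> L \<longleftrightarrow> x @ wrap K [] efs @ y \<in> L"
      using N(2) efs syntactic_class_member unfolding respects_nested_def by metis
  qed
qed

text \<open>The innermost word is quantified so that one short list of pairs serves for
  \<open>s\<close> and for the empty word, that is, for both sides of the identity.\<close>

definition represents :: "'a list set \<Rightarrow> nat \<Rightarrow> ('a list \<times> 'a list) list \<Rightarrow> ('a list \<times> 'a list) list \<Rightarrow> bool"
  where "represents L K efs' efs \<longleftrightarrow>
    (\<forall>s s'. syntactic_class L s' = syntactic_class L s \<longrightarrow> set s' = set s \<longrightarrow>
      syntactic_class L (wrap K s' efs') = syntactic_class L (wrap K s efs) \<and>
      set (wrap 1 s' efs') = set (wrap 1 s efs) \<and> (nested s' efs' \<longleftrightarrow> nested s efs))"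

lemma representsD:
  assumes "represents L K efs' efs" "syntactic_class L s' = syntactic_class L s" "set s' = set s"
  shows "syntactic_class L (wrap K s' efs') = syntactic_class L (wrap K s efs)"
    "set (wrap 1 s' efs') = set (wrap 1 s efs)" "nested s' efs' \<longleftrightarrow> nested s efs"
  using assms unfolding represents_def by blast+

lemma short_nested:
  assumes short: "\<And>w. w \<in> lists A \<Longrightarrow>
      \<exists>w' \<in> test_words A K. syntactic_class L w' = syntactic_class L w \<and> set w' = set w"
    and "0 < K" "set efs \<subseteq> lists A \<times> lists A"
  shows "\<exists>efs'. length efs' = length efs \<and> set efs' \<subseteq> test_words A K \<times> test_words A K \<and>
    represents L K efs' efs"
  using assms(3)
proof (induction efs)
  case (Cons ef efs)
  obtain e f where ef: "ef = (e, f)" "e \<in> lists A" "f \<in> lists A" using Cons.prems by (cases ef) auto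
  from short[OF ef(2)] obtain e' where e': "e' \<in> test_words A K" "syntactic_class L e' = syntactic_class L e" "set e' = set e"
    by blast
  from short[OF ef(3)] obtain f' where f': "f' \<in> test_words A K" "syntactic_class L f' = syntactic_class L f" "set f' = set f"
    by blast
  obtain efs' where efs': "length efs' = length efs" "set efs' \<subseteq> test_words A K \<times> test_words A K"
    "represents L K efs' efs"
    using Cons.IH Cons.prems by (metis insert_subset list.simps(15))
  show ?case
  proof (intro exI[of _ "(e', f') # efs'"] conjI)
    show "represents L K ((e', f') # efs') (ef # efs)"
      unfolding represents_def
    proof (intro conjI allI impI)
      fix s s' assume s: "syntactic_class L s' = syntactic_class L s" "set s' = set s"
      show "syntactic_class L (wrap K s' ((e', f') # efs')) = syntactic_class L (wrap K s (ef # efs))"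
        unfolding ef wrap.simps using representsD[OF efs'(3) s] e' f'
        by (intro syntactic_class_append syntactic_class_word_pow) auto
      show "set (wrap 1 s' ((e', f') # efs')) = set (wrap 1 s (ef # efs))"
        "nested s' ((e', f') # efs') \<longleftrightarrow> nested s (ef # efs)"
        using representsD[OF efs'(3) s] e' f' by (simp_all add: ef set_word_pow)
    qed
  qed (use e' f' efs' in auto)
qed (simp add: represents_def)

text \<open>Short representatives must preserve the content along with the class, because the side
  conditions of the identities refer to letters; this is why \<open>K\<close> bounds the number of
  pairs formed by \<open>g\<close>.\<close>

lemma passes_tests_imp_W:
  fixes L :: "'a list set"
  defines "g \<equiv> \<lambda>w. (syntactic_class L w, set w)"
  assumes "passes_tests A (Suc k) K L" "finite A" "L \<subseteq> lists A"
    and "finite (syntactic_class L ` lists A)" "card (g ` lists A) \<le> K" "0 < K"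
  shows "L \<in> W A (Suc (Suc k))"
proof -
  have g_cong: "g (u @ y) = g (v @ y)" if "g u = g v" for u v y
    using that syntactic_class_append[of L u v y y] by (simp add: g_def)
  have "finite (g ` lists A)"
    by (rule finite_subset[of _ "syntactic_class L ` lists A \<times> Pow A"])
      (use assms(3,5) in \<open>auto simp: g_def\<close>)
  then have short: "\<exists>w' \<in> test_words A K. syntactic_class L w' = syntactic_class L w \<and> set w' = set w"
    if "w \<in> lists A" for w
    using short_representative[OF _ assms(6) g_cong that] by (auto simp: g_def test_words_def)
  note tests = assms(2)[unfolded passes_tests_def]
  have eqI: "syntactic_class L u = syntactic_class L v"
    if uv: "\<And>x y. x \<in> test_words A K \<Longrightarrow> y \<in> test_words A K \<Longrightarrow> x @ u @ y \<in> L \<longleftrightarrow> x @ v @ y \<in> L" for u v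
    unfolding syntactic_class_eq_iff
  proof (intro allI)
    fix x y
    show "x @ u @ y \<in> L \<longleftrightarrow> x @ v @ y \<in> L"
    proof (cases "x \<in> lists A \<and> y \<in> lists A")
      case True
      from True have xy: "x \<in> lists A" "y \<in> lists A" by simp_all
      from short[OF xy(1)] obtain x' where x': "x' \<in> test_words A K"
        "syntactic_class L x' = syntactic_class L x" by blast
      from short[OF xy(2)] obtain y' where y': "y' \<in> test_words A K"
        "syntactic_class L y' = syntactic_class L y" by blast
      have "x @ w @ y \<in> L \<longleftrightarrow> x' @ w @ y' \<in> L" for w
        by (rule syntactic_class_member) (intro syntactic_class_append; simp add: x' y')
      then show ?thesis using uv x'(1) y'(1) by simp
    next
      case False
      \<comment> \<open>A context with a letter outside \<open>A\<close> keeps both words out of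
        \<open>L\<close>.\<close>
      then show ?thesis using assms(4) by auto
    qed
  qed
  show ?thesis
  proof (rule nested_imp_in_W)
    show "absorbing A (syntactic_class L) K"
    proof
      fix e s assume e: "e \<in> lists A" and s: "set s \<subseteq> set e"
      then have "s \<in> lists A" by (auto simp: in_lists_conv_set)
      from short[OF this] obtain s' where s': "s' \<in> test_words A K"
        "syntactic_class L s' = syntactic_class L s" "set s' = set s" by blast
      from short[OF e] obtain e' where e': "e' \<in> test_words A K" "syntactic_class L e' = syntactic_class L e" "set e' = set e"
        by blast
      have pow: "syntactic_class L (word_pow e' K) = syntactic_class L (word_pow e K)"
        using e'(2) by (rule syntactic_class_word_pow)
      have "syntactic_class L (word_pow e K @ s @ word_pow e K) =
          syntactic_class L (word_pow e' K @ s' @ word_pow e' K)"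
        by (intro syntactic_class_append; simp add: pow s')
      also have "\<dots> = syntactic_class L (word_pow e' K)"
        by (rule eqI) (use tests e' s' s in simp)
      finally show "syntactic_class L (word_pow e K @ s @ word_pow e K) =
          syntactic_class L (word_pow e K)" using pow by simp
    qed (rule assms(3), erule syntactic_class_cong, rule assms(5))
  next
    fix efs :: "('a list \<times> 'a list) list" and s :: "'a list"
    assume efs: "length efs = Suc k" "set efs \<subseteq> lists A \<times> lists A" "nested s efs"
    \<comment> \<open>Positive depth provides an outermost pair; it contains the letters of
      \<open>s\<close>, which are therefore in \<open>A\<close>.\<close>
    obtain e f efs0 where "efs = (e, f) # efs0" using efs(1) by (cases efs) auto
    then have "set (wrap 1 s efs0) \<subseteq> A" using efs by auto
    moreover have "set s \<subseteq> set (wrap 1 s efs0)" for efs0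
      by (induction "1 :: nat" s efs0 rule: wrap.induct) auto
    ultimately have "s \<in> lists A" by (auto simp: in_lists_conv_set)
    from short[OF this] obtain s' where s': "s' \<in> test_words A K"
      "syntactic_class L s' = syntactic_class L s" "set s' = set s" by blast
    from short_nested[OF short assms(7) efs(2)] obtain efs' where efs': "length efs' = length efs"
      "set efs' \<subseteq> test_words A K \<times> test_words A K" "represents L K efs' efs"
      by blast
    have "syntactic_class L (wrap K s' efs') = syntactic_class L (wrap K [] efs')"
    proof (rule eqI)
      fix x y assume "x \<in> test_words A K" "y \<in> test_words A K"
      then show "x @ wrap K s' efs' @ y \<in> L \<longleftrightarrow> x @ wrap K [] efs' @ y \<in> L"
        using tests efs efs'(1,2) representsD[OF efs'(3) s'(2,3)] s'(1) by simp
    qed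
    then show "syntactic_class L (wrap K s efs) = syntactic_class L (wrap K [] efs)"
      using representsD[OF efs'(3) s'(2,3)] representsD[OF efs'(3) refl refl, of "[]"] by simp
  qed (use assms in auto)
qed

section \<open>Runs of automata\<close>

lemma run_append: "run T p (u @ v) q \<longleftrightarrow> (\<exists>r. run T p u r \<and> run T r v q)"
  by (induction u arbitrary: p) auto

lemma card_image_le_kernel:
  assumes "finite (g ` S)" "\<And>x y. x \<in> S \<Longrightarrow> y \<in> S \<Longrightarrow> g x = g y \<Longrightarrow> f x = f y"
  shows "card (f ` S) \<le> card (g ` S)"
proof -
  have "f x = f (inv_into S g (g x))" if "x \<in> S" for x
    using assms(2)[of x "inv_into S g (g x)"] that by (simp add: f_inv_into_f inv_into_into)
  then have "f ` S = (\<lambda>z. f (inv_into S g z)) ` g ` S" by (auto simp: image_image)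
  then show ?thesis using card_image_le[OF assms(1)] by metis
qed

text \<open>An automaton as nested pairs of lists, the shape for which encodings are defined
  below.\<close>

type_synonym machine = "nat list \<times> nat list \<times> nat list \<times> (nat \<times> nat \<times> nat) list"

definition machine_of :: "automaton \<Rightarrow> machine" where
  "machine_of M = (alphabet M, initial M, final M, transitions M)"

definition states :: "machine \<Rightarrow> nat list" where
  "states = (\<lambda>(al, ini, fin, tr). ini @ map fst tr @ map (\<lambda>t. snd (snd t)) tr)"

text \<open>Bounds the number of pairs of a relation on the states and a set of letters. Repetitions
  in the lists only enlarge it.\<close>

definition test_length :: "machine \<Rightarrow> nat" where
  "test_length M = 2 ^ (length (states M) * length (states M) + length (fst M))"

lemma run_states:
  assumes "run T p w q" "p \<in> Q" "\<And>p a q. (p, a, q) \<in> T \<Longrightarrow> q \<in> Q"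
  shows "q \<in> Q"
  using assms by (induction w arbitrary: p) auto

text \<open>The relation that a word induces on the states and the content of the word, which
  decides membership in \<open>lists A\<close>, together determine its syntactic class. So the pairs
  of these data bound the number of classes, with or without contents.\<close>

lemma syntactic_class_language_bounds:
  fixes M :: automaton
  defines "A \<equiv> set (alphabet M)" and "L \<equiv> language M" and "K \<equiv> test_length (machine_of M)"
  shows "finite (syntactic_class L ` lists A)"
    "card ((\<lambda>w. (syntactic_class L w, set w)) ` lists A) \<le> K"
    "card (syntactic_class L ` lists A) \<le> K"
proof -
  define Q where "Q = set (states (machine_of M))"
  define T where "T = set (transitions M)"
  define g where "g w = ({(p, q) \<in> Q \<times> Q. run T p w q}, set w)" for w
  have sub: "g ` lists A \<subseteq> Pow (Q \<times> Q) \<times> Pow A" by (auto simp: g_def)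
  have finQ: "finite (Pow (Q \<times> Q) \<times> Pow A)" by (auto simp: Q_def A_def)
  have fin: "finite (g ` lists A)" using sub finQ by (rule finite_subset)
  have "card (g ` lists A) \<le> card (Pow (Q \<times> Q) \<times> Pow A)" using finQ sub by (rule card_mono)
  also have "\<dots> = 2 ^ (card Q * card Q + card A)"
    by (simp add: card_cartesian_product card_Pow Q_def A_def power_add)
  also have "\<dots> \<le> K"
    unfolding K_def test_length_def
    by (intro power_increasing add_mono mult_mono)
      (auto simp: Q_def A_def card_length machine_of_def)
  finally have card: "card (g ` lists A) \<le> K" .
  have run_mem: "w \<in> L \<longleftrightarrow> w \<in> lists A \<and> (\<exists>p \<in> set (initial M). \<exists>q \<in> set (final M). run T p w q)" for w
    by (auto simp: L_def language_def A_def T_def)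
  have closed: "q \<in> Q" if "run T p w q" "p \<in> Q" for p w q
    using that by (rule run_states) (force simp: Q_def T_def states_def machine_of_def)
  have iniQ: "p \<in> Q" if "p \<in> set (initial M)" for p
    using that by (auto simp: Q_def states_def machine_of_def)
  have kernel: "syntactic_class L u = syntactic_class L v" if g: "g u = g v" for u v
  proof -
    have run: "run T p u q \<longleftrightarrow> run T p v q" if "p \<in> Q" for p q
    proof -
      have "(p, q) \<in> fst (g u) \<longleftrightarrow> (p, q) \<in> fst (g v)" using g by simp
      then show ?thesis using that closed by (auto simp: g_def)
    qed
    have "u \<in> lists A \<longleftrightarrow> v \<in> lists A" using g by (simp add: g_def in_lists_conv_set)
    moreover have "run T p (x @ u @ y) q \<longleftrightarrow> run T p (x @ v @ y) q" if "p \<in> Q" for p q x y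
      using run closed that unfolding run_append by blast
    ultimately show ?thesis unfolding syntactic_class_eq_iff run_mem using iniQ by auto
  qed
  show "finite (syntactic_class L ` lists A)"
    using fin by (rule finite_image_if_kernel) (rule kernel)
  have "card (syntactic_class L ` lists A) \<le> card (g ` lists A)"
    using fin by (rule card_image_le_kernel) (rule kernel)
  then show "card (syntactic_class L ` lists A) \<le> K" using card by (rule order_trans)
  have pair: "(syntactic_class L u, set u) = (syntactic_class L v, set v)" if g: "g u = g v" for u v
    using kernel[OF g] g by (simp add: g_def)
  have "card ((\<lambda>w. (syntactic_class L w, set w)) ` lists A) \<le> card (g ` lists A)"
    using fin by (rule card_image_le_kernel) (rule pair)
  then show "card ((\<lambda>w. (syntactic_class L w, set w)) ` lists A) \<le> K" using card by (rule order_trans)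
qed

lemma language_in_W_iff:
  "language M \<in> W (set (alphabet M)) (Suc (Suc k)) \<longleftrightarrow>
    passes_tests (set (alphabet M)) (Suc k) (test_length (machine_of M)) (language M)"
proof
  assume "language M \<in> W (set (alphabet M)) (Suc (Suc k))"
  then show "passes_tests (set (alphabet M)) (Suc k) (test_length (machine_of M)) (language M)"
    using syntactic_class_language_bounds by (intro W_imp_passes_tests)
next
  assume "passes_tests (set (alphabet M)) (Suc k) (test_length (machine_of M)) (language M)"
  then show "language M \<in> W (set (alphabet M)) (Suc (Suc k))"
  proof (rule passes_tests_imp_W)
    show "language M \<subseteq> lists (set (alphabet M))" by (auto simp: language_def)
    show "0 < test_length (machine_of M)" by (simp add: test_length_def)
  qed (use syntactic_class_language_bounds in auto)
qed

section \<open>Recursive functions\<close>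

text \<open>\<open>general_recursive\<close> fixes the values on lists of every length. Looking only
  at lists of length \<open>n\<close> allows functions to be rewritten by equations that hold at
  that arity.\<close>

definition recfun :: "nat \<Rightarrow> (nat list \<Rightarrow> nat) \<Rightarrow> bool" where
  "recfun n f \<longleftrightarrow> (\<exists>g. general_recursive n g \<and> (\<forall>xs. length xs = n \<longrightarrow> g xs = f xs))"

lemma recfun_cong: "recfun n f \<Longrightarrow> (\<And>xs. length xs = n \<Longrightarrow> f xs = g xs) \<Longrightarrow> recfun n g"
  unfolding recfun_def by (metis (full_types))

lemma recfun_comp:
  assumes "recfun (length gs) f" "\<forall>g \<in> set gs. recfun n g"
  shows "recfun n (\<lambda>xs. f (map (\<lambda>g. g xs) gs))"
proof -
  obtain f' where f': "general_recursive (length gs) f'" "\<And>xs. length xs = length gs \<Longrightarrow> f' xs = f xs"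
    using assms(1) unfolding recfun_def by blast
  have "\<forall>g \<in> set gs. \<exists>g'. general_recursive n g' \<and> (\<forall>xs. length xs = n \<longrightarrow> g' xs = g xs)"
    using assms(2) unfolding recfun_def by blast
  then obtain c where c: "\<And>g. g \<in> set gs \<Longrightarrow> general_recursive n (c g)"
    "\<And>g xs. g \<in> set gs \<Longrightarrow> length xs = n \<Longrightarrow> c g xs = g xs"
    by metis
  have "general_recursive n (\<lambda>xs. f' (map (\<lambda>g. g xs) (map c gs)))"
    by (rule composition) (use f' c in auto)
  moreover have "f' (map (\<lambda>g. g xs) (map c gs)) = f (map (\<lambda>g. g xs) gs)" if "length xs = n" for xs
  proof -
    have eq: "map (\<lambda>g. g xs) (map c gs) = map (\<lambda>g. g xs) gs" using c(2) that by simp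
    show ?thesis unfolding eq by (rule f'(2)) simp
  qed
  ultimately show ?thesis unfolding recfun_def by blast
qed

lemma recfun_proj: "i < n \<Longrightarrow> recfun n (\<lambda>xs. xs ! i)"
  unfolding recfun_def using projection by blast

lemma recfun_Suc:
  assumes "recfun n f"
  shows "recfun n (\<lambda>xs. Suc (f xs))"
proof -
  have "recfun (length [f]) (\<lambda>xs. Suc (xs ! 0))"
    using successor unfolding recfun_def by auto
  from recfun_comp[OF this, of n] show ?thesis using assms by simp
qed

lemma recfun_const: "recfun n (\<lambda>xs. c)"
proof (induction c)
  case 0
  show ?case unfolding recfun_def using zero by blast
qed (rule recfun_Suc)

lemma recfun_rec:
  assumes "recfun n i" "recfun (Suc (Suc n)) s" "recfun n c"
  shows "recfun n (\<lambda>xs. rec_nat (i xs) (\<lambda>y r. s (y # r # xs)) (c xs))"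
proof -
  obtain i' where i': "general_recursive n i'" "\<And>xs. length xs = n \<Longrightarrow> i' xs = i xs"
    using assms(1) unfolding recfun_def by blast
  obtain s' where s': "general_recursive (Suc (Suc n)) s'" "\<And>xs. length xs = Suc (Suc n) \<Longrightarrow> s' xs = s xs"
    using assms(2) unfolding recfun_def by blast
  define f where "f xs = rec_nat (i' (tl xs)) (\<lambda>y r. s' (y # r # tl xs)) (hd xs)" for xs
  have "general_recursive (Suc n) f"
    unfolding f_def by (rule primitive_recursion) (rule i' s')+
  then have f: "recfun (Suc n) f" unfolding recfun_def by blast
  let ?gs = "c # map (\<lambda>i xs. xs ! i) [0..<n]"
  have "recfun n (\<lambda>xs. f (map (\<lambda>g. g xs) ?gs))"
    by (rule recfun_comp) (use f assms(3) recfun_proj in auto)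
  then show ?thesis
  proof (rule recfun_cong)
    fix xs :: "nat list" assume len: "length xs = n"
    have "map (\<lambda>g. g xs) ?gs = c xs # xs"
      using len map_nth[of xs] by (simp add: comp_def)
    then show "f (map (\<lambda>g. g xs) ?gs) = rec_nat (i xs) (\<lambda>y r. s (y # r # xs)) (c xs)"
      using len i'(2) s'(2) by (simp add: f_def)
  qed
qed

lemma recfun_comp1:
  assumes "recfun (Suc 0) f" "recfun n g"
  shows "recfun n (\<lambda>xs. f [g xs])"
  using recfun_comp[of "[g]" f n] assms by simp

lemma recfun_Least:
  assumes "recfun (Suc n) f" "\<And>xs. length xs = n \<Longrightarrow> \<exists>y. f (y # xs) = 0"
  shows "recfun n (\<lambda>xs. LEAST y. f (y # xs) = 0)"
proof -
  obtain f' where f': "general_recursive (Suc n) f'" "\<And>xs. length xs = Suc n \<Longrightarrow> f' xs = f xs"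
    using assms(1) unfolding recfun_def by blast
  have "general_recursive n (\<lambda>xs. LEAST y. f' (y # xs) = 0)"
    by (rule minimisation) (use f' assms(2) in auto)
  then have "recfun n (\<lambda>xs. LEAST y. f' (y # xs) = 0)" unfolding recfun_def by blast
  then show ?thesis by (rule recfun_cong) (simp add: f'(2))
qed

section \<open>Arithmetic and the pairing function\<close>

lemma recfun_add:
  assumes "recfun n f" "recfun n g"
  shows "recfun n (\<lambda>xs. f xs + g xs)"
proof -
  have "recfun n (\<lambda>xs. rec_nat (g xs) (\<lambda>y r. Suc ((y # r # xs) ! 1)) (f xs))"
    by (rule recfun_rec) (use assms in \<open>auto intro: recfun_Suc recfun_proj\<close>)
  moreover have "rec_nat b (\<lambda>y r. Suc r) a = a + b" for a b :: nat by (induction a) auto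
  ultimately show ?thesis by simp
qed

lemma recfun_diff:
  assumes "recfun n f" "recfun n g"
  shows "recfun n (\<lambda>xs. f xs - g xs)"
proof -
  have "recfun (Suc 0) (\<lambda>xs. rec_nat 0 (\<lambda>y r. (y # r # xs) ! 0) (xs ! 0))"
    by (rule recfun_rec) (auto intro: recfun_const recfun_proj)
  moreover have "rec_nat 0 (\<lambda>y r. y) a = a - 1" for a :: nat by (cases a) auto
  ultimately have pred: "recfun (Suc 0) (\<lambda>xs. xs ! 0 - 1)" by simp
  have "recfun (Suc (Suc n)) (\<lambda>zs. [zs ! 1] ! 0 - 1)"
    by (rule recfun_comp1[OF pred]) (rule recfun_proj, simp)
  then have "recfun n (\<lambda>xs. rec_nat (f xs) (\<lambda>y r. [(y # r # xs) ! 1] ! 0 - 1) (g xs))"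
    by (intro recfun_rec assms)
  moreover have "rec_nat a (\<lambda>y r. r - 1) b = a - b" for a b :: nat by (induction b) auto
  ultimately show ?thesis by simp
qed

lemma recfun_triangle:
  assumes "recfun n f"
  shows "recfun n (\<lambda>xs. triangle (f xs))"
proof -
  have "recfun n (\<lambda>xs. rec_nat 0 (\<lambda>y r. (y # r # xs) ! 1 + Suc ((y # r # xs) ! 0)) (f xs))"
    by (rule recfun_rec) (use assms in \<open>auto intro!: recfun_add recfun_Suc recfun_proj recfun_const\<close>)
  moreover have "rec_nat 0 (\<lambda>y r. r + Suc y) a = triangle a" for a :: nat by (induction a) auto
  ultimately show ?thesis by simp
qed

lemma recfun_prod_encode:
  assumes "recfun n f" "recfun n g"
  shows "recfun n (\<lambda>xs. prod_encode (f xs, g xs))"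
  unfolding prod_encode_def case_prod_conv by (intro recfun_add recfun_triangle assms)

lemma triangle_mono: "a \<le> b \<Longrightarrow> triangle a \<le> triangle b"
  by (induction rule: dec_induct) auto

text \<open>The pairing sends \<open>(a, b)\<close> to \<open>triangle (a + b) + a\<close>, so
  \<open>a + b\<close> is the least \<open>s\<close> with \<open>z < triangle (Suc s)\<close>; the
  vanishing truncated difference expresses this inequality. Minimisation enters only here.\<close>

lemma prod_decode_sum:
  assumes "prod_decode z = (a, b)"
  shows "(LEAST s. Suc z - triangle (Suc s) = 0) = a + b"
proof -
  have z: "z = triangle (a + b) + a"
    using prod_decode_inverse[of z] by (simp add: assms prod_encode_def)
  show ?thesis
  proof (rule Least_equality)
    show "Suc z - triangle (Suc (a + b)) = 0" by (simp add: z)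
    fix s assume s: "Suc z - triangle (Suc s) = 0"
    show "a + b \<le> s"
    proof (rule ccontr)
      assume "\<not> a + b \<le> s"
      then have "triangle (Suc s) \<le> triangle (a + b)" by (intro triangle_mono) simp
      then show False using s z by linarith
    qed
  qed
qed

lemma recfun_prod_decode:
  assumes "recfun n f"
  shows "recfun n (\<lambda>xs. fst (prod_decode (f xs)))" "recfun n (\<lambda>xs. snd (prod_decode (f xs)))"
proof -
  have "recfun (Suc 0) (\<lambda>xs. LEAST s. Suc ((s # xs) ! 1) - triangle (Suc ((s # xs) ! 0)) = 0)"
  proof (rule recfun_Least[where f = "\<lambda>zs. Suc (zs ! 1) - triangle (Suc (zs ! 0))"])
    fix xs :: "nat list"
    have "n \<le> triangle n" for n by (induction n) auto
    then show "\<exists>s. Suc ((s # xs) ! 1) - triangle (Suc ((s # xs) ! 0)) = 0"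
      by (intro exI[of _ "xs ! 0"]) (simp del: triangle_Suc)
  qed (intro recfun_diff recfun_Suc recfun_triangle recfun_proj; simp)
  then have *: "recfun (Suc 0) (\<lambda>xs. LEAST s. Suc (xs ! 0) - triangle (Suc s) = 0)" by simp
  define sm where "sm z = fst (prod_decode z) + snd (prod_decode z)" for z
  have "recfun (Suc 0) (\<lambda>xs. sm (xs ! 0))"
    using * by (rule recfun_cong)
      (simp only: prod_decode_sum[OF prod.collapse[symmetric]] sm_def)
  from recfun_comp1[OF this assms] have s: "recfun n (\<lambda>xs. sm (f xs))" by simp
  have z: "z = triangle (sm z) + fst (prod_decode z)" for z
    using prod_decode_inverse[of z] by (simp add: sm_def prod_encode_def case_prod_beta)
  have 1: "recfun n (\<lambda>xs. f xs - triangle (sm (f xs)))"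
    by (intro recfun_diff recfun_triangle s assms)
  have eq1: "z - triangle (sm z) = fst (prod_decode z)" for z using z[of z] by linarith
  show 2: "recfun n (\<lambda>xs. fst (prod_decode (f xs)))" using 1 unfolding eq1 .
  have "recfun n (\<lambda>xs. sm (f xs) - fst (prod_decode (f xs)))"
    by (intro recfun_diff s 2)
  then show "recfun n (\<lambda>xs. snd (prod_decode (f xs)))" by (simp add: sm_def)
qed

section \<open>Computable functions on encodable types\<close>

class enc =
  fixes enc :: "'a \<Rightarrow> nat"

instantiation nat :: enc
begin
definition "enc (n :: nat) = n"
instance ..
end

instantiation bool :: enc
begin
definition "enc b = (if b then 1 else 0)"
instance ..
end

instantiation prod :: (enc, enc) enc
begin
definition "enc p = prod_encode (enc (fst p), enc (snd p))"
instance ..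
end

instantiation list :: (enc) enc
begin
definition "enc xs = list_encode (map enc xs)"
instance ..
end

text \<open>The values of \<open>g\<close> outside the range of \<open>enc\<close> are
  unconstrained, so a total function on numbers can represent a function on any encoded
  type.\<close>

definition computable :: "('a :: enc \<Rightarrow> 'b :: enc) \<Rightarrow> bool" where
  "computable f \<longleftrightarrow> (\<exists>g. recfun (Suc 0) (\<lambda>xs. g (xs ! 0)) \<and> (\<forall>x. g (enc x) = enc (f x)))"

named_theorems computable_intros

lemma computableI: "recfun (Suc 0) (\<lambda>xs. g (xs ! 0)) \<Longrightarrow> (\<And>x. g (enc x) = enc (f x)) \<Longrightarrow> computable f"
  unfolding computable_def by blast

lemma computable_comp:
  assumes "computable f" "computable g"
  shows "computable (\<lambda>x. f (g x))"
proof -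
  obtain f' where f': "recfun (Suc 0) (\<lambda>xs. f' (xs ! 0))" "\<And>x. f' (enc x) = enc (f x)"
    using assms(1) unfolding computable_def by blast
  obtain g' where g': "recfun (Suc 0) (\<lambda>xs. g' (xs ! 0))" "\<And>x. g' (enc x) = enc (g x)"
    using assms(2) unfolding computable_def by blast
  show ?thesis
    by (rule computableI[of "\<lambda>z. f' (g' z)"]) (use recfun_comp1[OF f'(1) g'(1)] f' g' in simp_all)
qed

lemma computable_id [computable_intros]: "computable (\<lambda>x. x)"
  by (rule computableI[of "\<lambda>z. z"]) (simp_all add: recfun_proj)

lemma computable_const [computable_intros]: "computable (\<lambda>x. c)"
  by (rule computableI[of "\<lambda>z. enc c"]) (simp_all add: recfun_const)

lemma computable_Pair [computable_intros]:
  assumes "computable f" "computable g"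
  shows "computable (\<lambda>x. (f x, g x))"
proof -
  obtain f' where f': "recfun (Suc 0) (\<lambda>xs. f' (xs ! 0))" "\<And>x. f' (enc x) = enc (f x)"
    using assms(1) unfolding computable_def by blast
  obtain g' where g': "recfun (Suc 0) (\<lambda>xs. g' (xs ! 0))" "\<And>x. g' (enc x) = enc (g x)"
    using assms(2) unfolding computable_def by blast
  show ?thesis
    by (rule computableI[of "\<lambda>z. prod_encode (f' z, g' z)"])
      (simp_all add: recfun_prod_encode f' g' enc_prod_def)
qed

lemma computable_fst [computable_intros]:
  assumes "computable f"
  shows "computable (\<lambda>x. fst (f x))"
proof (rule computable_comp[OF _ assms])
  show "computable (fst :: 'b \<times> 'c \<Rightarrow> 'b)"
    by (rule computableI[of "\<lambda>z. fst (prod_decode z)"])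
      (simp_all add: recfun_prod_decode recfun_proj enc_prod_def)
qed

lemma computable_snd [computable_intros]:
  assumes "computable f"
  shows "computable (\<lambda>x. snd (f x))"
proof (rule computable_comp[OF _ assms])
  show "computable (snd :: 'b \<times> 'c \<Rightarrow> 'c)"
    by (rule computableI[of "\<lambda>z. snd (prod_decode z)"])
      (simp_all add: recfun_prod_decode recfun_proj enc_prod_def)
qed

text \<open>Functions of several arguments are treated as functions of tuples; this rule returns to
  the curried form.\<close>

lemma computable_comp_env:
  assumes "computable (\<lambda>z. f (fst z) (snd z))" "computable g" "computable h"
  shows "computable (\<lambda>x. f (g x) (h x))"
  using computable_comp[OF assms(1) computable_Pair[OF assms(2,3)]] by simp

text \<open>The step may depend on the outer argument \<open>x\<close>, which is therefore passed
  along as the first component of a triple. The rules for folds below follow the same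
  pattern.\<close>

lemma computable_rec_nat [computable_intros]:
  assumes "computable i" "computable n" "computable (\<lambda>z. s (fst z) (fst (snd z)) (snd (snd z)))"
  shows "computable (\<lambda>x. rec_nat (i x) (s x) (n x :: nat))"
proof -
  obtain i' where i': "recfun (Suc 0) (\<lambda>xs. i' (xs ! 0))" "\<And>x. i' (enc x) = enc (i x)"
    using assms(1) unfolding computable_def by blast
  obtain n' where n': "recfun (Suc 0) (\<lambda>xs. n' (xs ! 0))" "\<And>x. n' (enc x) = enc (n x)"
    using assms(2) unfolding computable_def by blast
  obtain s' where s': "recfun (Suc 0) (\<lambda>xs. s' (xs ! 0))"
    "\<And>z. s' (enc z) = enc (s (fst z) (fst (snd z)) (snd (snd z)))"
    using assms(3) unfolding computable_def by blast
  define t where "t ys = s' (prod_encode (ys ! 2, prod_encode (ys ! 0, ys ! 1)))" for ys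
  show ?thesis
  proof (rule computableI[of "\<lambda>z. rec_nat (i' z) (\<lambda>y r. s' (prod_encode (z, prod_encode (y, r)))) (n' z)"])
    have "recfun (Suc (Suc (Suc 0))) (\<lambda>ys. prod_encode (ys ! 2, prod_encode (ys ! 0, ys ! 1)))"
      by (intro recfun_prod_encode recfun_proj) auto
    from recfun_comp1[OF s'(1) this] have "recfun (Suc (Suc (Suc 0))) t" by (simp add: t_def[abs_def])
    from recfun_rec[OF i'(1) this n'(1)]
    show "recfun (Suc 0) (\<lambda>xs. rec_nat (i' (xs ! 0))
        (\<lambda>y r. s' (prod_encode (xs ! 0, prod_encode (y, r)))) (n' (xs ! 0)))"
      by (simp add: t_def numeral_2_eq_2)
  next
    fix x
    have "rec_nat (enc (i x)) (\<lambda>y r. s' (prod_encode (enc x, prod_encode (y, r)))) m =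
        enc (rec_nat (i x) (s x) m)" for m
    proof (induction m)
      case (Suc m)
      have "s' (enc (x, m, rec_nat (i x) (s x) m)) = enc (s x m (rec_nat (i x) (s x) m))"
        by (simp add: s'(2))
      then show ?case using Suc by (simp add: enc_prod_def enc_nat_def)
    qed simp
    then show "rec_nat (i' (enc x)) (\<lambda>y r. s' (prod_encode (enc x, prod_encode (y, r)))) (n' (enc x)) =
        enc (rec_nat (i x) (s x) (n x))"
      by (simp add: i' n' enc_nat_def)
  qed
qed

section \<open>Computable arithmetic and logic\<close>

lemma computable_Suc [computable_intros]:
  "computable f \<Longrightarrow> computable (\<lambda>x. Suc (f x))"
  by (rule computable_comp[of Suc])
    (auto intro!: computableI[of Suc] recfun_Suc recfun_proj simp: enc_nat_def)

lemma computable_add [computable_intros]: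
  assumes "computable f" "computable g"
  shows "computable (\<lambda>x. f x + g x :: nat)"
proof (rule computable_comp_env[OF _ assms])
  show "computable (\<lambda>z. fst z + snd z :: nat)"
    by (rule computableI[of "\<lambda>z. fst (prod_decode z) + snd (prod_decode z)"])
      (auto intro!: recfun_add recfun_prod_decode recfun_proj simp: enc_nat_def enc_prod_def)
qed

lemma computable_diff [computable_intros]:
  assumes "computable f" "computable g"
  shows "computable (\<lambda>x. f x - g x :: nat)"
proof (rule computable_comp_env[OF _ assms])
  show "computable (\<lambda>z. fst z - snd z :: nat)"
    by (rule computableI[of "\<lambda>z. fst (prod_decode z) - snd (prod_decode z)"])
      (auto intro!: recfun_diff recfun_prod_decode recfun_proj simp: enc_nat_def enc_prod_def)
qed

lemma computable_mult [computable_intros]: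
  assumes "computable f" "computable g"
  shows "computable (\<lambda>x. f x * g x :: nat)"
proof -
  have eq: "a * b = rec_nat 0 (\<lambda>_ r. b + r) a" for a b :: nat by (induction a) auto
  show ?thesis unfolding eq by (intro computable_intros assms computable_comp[OF assms(2)])
qed

lemma computable_power2 [computable_intros]:
  assumes "computable f"
  shows "computable (\<lambda>x. 2 ^ f x :: nat)"
proof -
  have eq: "(2 :: nat) ^ a = rec_nat 1 (\<lambda>_ r. r + r) a" for a by (induction a) auto
  show ?thesis unfolding eq by (intro computable_intros assms)
qed

lemma computable_if [computable_intros]:
  assumes "computable b" "computable f" "computable g"
  shows "computable (\<lambda>x. if b x then f x else g x)"
proof -
  obtain b' where b': "recfun (Suc 0) (\<lambda>xs. b' (xs ! 0))" "\<And>x. b' (enc x) = enc (b x)"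
    using assms(1) unfolding computable_def by blast
  have "computable (\<lambda>x. b' (enc x))"
    by (rule computableI[of b']) (simp_all add: b' enc_nat_def)
  \<comment> \<open>The code of a truth value is 0 or 1, so at most one step of the recursion
    selects the branch.\<close>
  then have "computable (\<lambda>x. rec_nat (g x) (\<lambda>_ _. f x) (b' (enc x)))"
    by (intro computable_intros assms computable_comp[OF assms(2)])
  moreover have "rec_nat (g x) (\<lambda>_ _. f x) (b' (enc x)) = (if b x then f x else g x)" for x
    by (simp add: b' enc_bool_def)
  ultimately show ?thesis by simp
qed

lemma computable_conj [computable_intros]:
  assumes "computable b" "computable c"
  shows "computable (\<lambda>x. b x \<and> c x)"
proof -
  have eq: "(b x \<and> c x) = (if b x then c x else False)" for x by simp
  show ?thesis unfolding eq by (intro computable_if computable_const assms)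
qed

lemma computable_Not [computable_intros]:
  assumes "computable b"
  shows "computable (\<lambda>x. \<not> b x)"
proof -
  have eq: "(\<not> b x) = (if b x then False else True)" for x by simp
  show ?thesis unfolding eq by (intro computable_if computable_const assms)
qed

lemma computable_disj [computable_intros]:
  assumes "computable b" "computable c"
  shows "computable (\<lambda>x. b x \<or> c x)"
proof -
  have eq: "(b x \<or> c x) = (if b x then True else c x)" for x by simp
  show ?thesis unfolding eq by (intro computable_if computable_const assms)
qed

lemma computable_imp [computable_intros]:
  assumes "computable b" "computable c"
  shows "computable (\<lambda>x. b x \<longrightarrow> c x)"
proof -
  have eq: "(b x \<longrightarrow> c x) = (if b x then c x else True)" for x by simp
  show ?thesis unfolding eq by (intro computable_if computable_const assms)
qed

lemma computable_iff [computable_intros]: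
  assumes "computable b" "computable c"
  shows "computable (\<lambda>x. b x = (c x :: bool))"
proof -
  have "computable (\<lambda>x. if b x then c x else \<not> c x)" by (intro computable_intros assms)
  moreover have "(if b x then c x else \<not> c x) = (b x = c x)" for x by auto
  ultimately show ?thesis by simp
qed

lemma computable_nat_eq [computable_intros]:
  assumes "computable f" "computable g"
  shows "computable (\<lambda>x. f x = (g x :: nat))"
proof -
  have "computable (\<lambda>x. rec_nat True (\<lambda>_ _. False) (f x - g x + (g x - f x)))"
    by (intro computable_intros assms)
  moreover have "rec_nat True (\<lambda>_ _. False) (a - b + (b - a)) = (a = b)" for a b :: nat
    by (cases "a - b + (b - a)") auto
  ultimately show ?thesis by simp
qed

section \<open>Computable list functions\<close>

lemma computable_Cons [computable_intros]:
  assumes "computable f" "computable g"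
  shows "computable (\<lambda>x. f x # g x)"
proof (rule computable_comp_env[OF _ assms])
  \<comment> \<open>A nonempty list is coded by the successor of the code of the pair of head and
    tail.\<close>
  show "computable (\<lambda>z. fst z # snd z)"
    by (rule computableI[of Suc]) (auto intro!: recfun_Suc recfun_proj simp: enc_list_def enc_prod_def)
qed

text \<open>A code of a list bounds its length, so that many iterations exhaust the list.\<close>

lemma computable_foldl [computable_intros]:
  assumes "computable i" "computable l" "computable (\<lambda>z. s (fst z) (fst (snd z)) (snd (snd z)))"
  shows "computable (\<lambda>x. foldl (s x) (i x) (l x))"
proof -
  obtain i' where i': "recfun (Suc 0) (\<lambda>xs. i' (xs ! 0))" "\<And>x. i' (enc x) = enc (i x)"
    using assms(1) unfolding computable_def by blast
  obtain l' where l': "recfun (Suc 0) (\<lambda>xs. l' (xs ! 0))" "\<And>x. l' (enc x) = enc (l x)"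
    using assms(2) unfolding computable_def by blast
  obtain s' where s': "recfun (Suc 0) (\<lambda>xs. s' (xs ! 0))"
    "\<And>z. s' (enc z) = enc (s (fst z) (fst (snd z)) (snd (snd z)))"
    using assms(3) unfolding computable_def by blast
  have i'c: "computable i'" and l'c: "computable l'" and s'c: "computable s'"
    by (rule computableI[OF i'(1)], simp add: enc_nat_def,
        rule computableI[OF l'(1)], simp add: enc_nat_def,
        rule computableI[OF s'(1)], simp add: enc_nat_def)
  define hd' where "hd' z = fst (prod_decode (z - 1))" for z :: nat
  define tl' where "tl' z = snd (prod_decode (z - 1))" for z :: nat
  have hd'c: "computable hd'" and tl'c: "computable tl'"
    unfolding hd'_def tl'_def
    by (rule computableI[of "\<lambda>z. fst (prod_decode (z - 1))"],
        intro recfun_prod_decode recfun_diff recfun_proj recfun_const, simp, simp add: enc_nat_def,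
        rule computableI[of "\<lambda>z. snd (prod_decode (z - 1))"],
        intro recfun_prod_decode recfun_diff recfun_proj recfun_const, simp, simp add: enc_nat_def)
  \<comment> \<open>The code of the empty list is 0; from then on the state stays fixed, so surplus
    iterations do no harm.\<close>
  define step where "step z st = (if snd st = 0 then st
    else (s' (prod_encode (z, prod_encode (fst st, hd' (snd st)))), tl' (snd st)))" for z st
  define F where "F z = fst (rec_nat (i' z, l' z) (\<lambda>_ st. step z st) (l' z))" for z
  have pe: "computable (\<lambda>z. prod_encode (fst z, snd z :: nat))"
    by (rule computableI[of "\<lambda>z. z"]) (simp_all add: recfun_proj enc_prod_def enc_nat_def)
  have "computable F"
    unfolding F_def step_def
    by (intro computable_intros computable_comp[OF s'c] computable_comp[OF hd'c]
        computable_comp[OF tl'c] computable_comp[OF l'c] i'c l'c computable_comp_env[OF pe])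
  then have F: "recfun (Suc 0) (\<lambda>xs. F (xs ! 0))"
    unfolding computable_def enc_nat_def by (metis recfun_cong)
  have pops: "rec_nat (enc a, enc ys) (\<lambda>_ st. step (enc x) st) m =
      (enc (foldl (s x) a ys), 0)" if "length ys \<le> m" for x a ys m
  proof -
    \<comment> \<open>\<open>rec_nat\<close> applies its last step outermost, while the list is
      consumed from the front.\<close>
    have shift: "rec_nat c (\<lambda>_ st. step (enc x) st) (Suc m) = rec_nat (step (enc x) c) (\<lambda>_ st. step (enc x) st) m"
      for c m by (induction m) auto
    show ?thesis
      using that
    proof (induction ys arbitrary: a m)
      case Nil
      show ?case by (induction m) (simp_all add: enc_list_def step_def)
    next
      case (Cons y ys)
      then obtain m' where m: "m = Suc m'" "length ys \<le> m'" by (cases m) auto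
      have "step (enc x) (enc a, enc (y # ys)) = (s' (enc (x, a, y)), enc ys)"
        by (simp add: step_def enc_list_def enc_prod_def hd'_def tl'_def)
      also have "\<dots> = (enc (s x a y), enc ys)" by (simp add: s'(2))
      finally show ?case unfolding m(1) shift using Cons.IH m(2) by simp
    qed
  qed
  have len: "length ys \<le> enc ys" for ys :: "'c list"
    by (induction ys) (auto simp: enc_list_def intro: order_trans le_prod_encode_2)
  show ?thesis
    by (rule computableI[OF F]) (simp add: F_def i' l' pops len)
qed

lemma computable_rev [computable_intros]:
  assumes "computable l"
  shows "computable (\<lambda>x. rev (l x))"
proof -
  have eq: "rev xs = foldl (\<lambda>a b. b # a) [] xs" for xs :: "'b list"
    by (induction xs rule: rev_induct) auto
  show ?thesis unfolding eq by (intro computable_intros assms)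
qed

lemma computable_foldr [computable_intros]:
  assumes "computable i" "computable l" "computable (\<lambda>z. s (fst z) (fst (snd z)) (snd (snd z)))"
  shows "computable (\<lambda>x. foldr (s x) (l x) (i x))"
proof -
  have "computable (\<lambda>z. (fst z, snd (snd z), fst (snd z)))" by (intro computable_intros)
  from computable_comp[OF assms(3) this]
  have *: "computable (\<lambda>z. s (fst z) (snd (snd z)) (fst (snd z)))" by simp
  show ?thesis
    unfolding foldr_conv_foldl by (intro computable_foldl computable_rev assms *)
qed

lemma computable_append [computable_intros]:
  assumes "computable f" "computable g"
  shows "computable (\<lambda>x. f x @ g x)"
proof -
  have eq: "xs @ ys = foldr (\<lambda>a b. a # b) xs ys" for xs ys :: "'b list" by (induction xs) auto
  show ?thesis unfolding eq by (intro computable_intros assms)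
qed

lemma computable_concat [computable_intros]:
  assumes "computable l"
  shows "computable (\<lambda>x. concat (l x))"
proof -
  have eq: "concat xs = foldr (\<lambda>a b. a @ b) xs []" for xs :: "'b list list" by (induction xs) auto
  show ?thesis unfolding eq by (intro computable_intros assms)
qed

lemma computable_length [computable_intros]:
  assumes "computable l"
  shows "computable (\<lambda>x. length (l x))"
proof -
  have eq: "length xs = foldr (\<lambda>a b. Suc b) xs 0" for xs :: "'b list" by (induction xs) auto
  show ?thesis unfolding eq by (intro computable_intros assms)
qed

text \<open>Discards the accumulator that a fold passes to its step.\<close>

lemma computable_env3:
  assumes "computable (\<lambda>z. f (fst z) (snd z))"
  shows "computable (\<lambda>z. f (fst z) (fst (snd z)))"
  by (rule computable_comp_env[OF assms]) (intro computable_intros)+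

lemma computable_map [computable_intros]:
  assumes "computable l" "computable (\<lambda>z. f (fst z) (snd z))"
  shows "computable (\<lambda>x. map (f x) (l x))"
proof -
  have eq: "map f xs = foldr (\<lambda>a b. f a # b) xs []" for f :: "'b \<Rightarrow> 'c" and xs by (induction xs) auto
  show ?thesis unfolding eq by (intro computable_intros assms computable_env3)
qed

lemma computable_filter [computable_intros]:
  assumes "computable l" "computable (\<lambda>z. P (fst z) (snd z))"
  shows "computable (\<lambda>x. filter (P x) (l x))"
proof -
  have eq: "filter P xs = foldr (\<lambda>a b. if P a then a # b else b) xs []" for P :: "'b \<Rightarrow> bool" and xs
    by (induction xs) auto
  show ?thesis unfolding eq by (intro computable_intros assms computable_env3)
qed

lemma computable_list_all [computable_intros]:
  assumes "computable l" "computable (\<lambda>z. P (fst z) (snd z))"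
  shows "computable (\<lambda>x. list_all (P x) (l x))"
proof -
  have eq: "list_all P xs = foldr (\<lambda>a b. P a \<and> b) xs True" for P :: "'b \<Rightarrow> bool" and xs
    by (induction xs) auto
  show ?thesis unfolding eq by (intro computable_intros assms computable_env3)
qed

lemma computable_list_ex [computable_intros]:
  assumes "computable l" "computable (\<lambda>z. P (fst z) (snd z))"
  shows "computable (\<lambda>x. list_ex (P x) (l x))"
proof -
  have eq: "list_ex P xs = foldr (\<lambda>a b. P a \<or> b) xs False" for P :: "'b \<Rightarrow> bool" and xs
    by (induction xs) auto
  show ?thesis unfolding eq by (intro computable_intros assms computable_env3)
qed

section \<open>The decision procedure\<close>

definition subset_list :: "nat list \<Rightarrow> nat list \<Rightarrow> bool" where
  "subset_list xs ys \<longleftrightarrow> list_all (\<lambda>a. list_ex (\<lambda>b. a = b) ys) xs"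

lemma subset_list_iff: "subset_list xs ys \<longleftrightarrow> set xs \<subseteq> set ys"
  by (auto simp: subset_list_def list_all_iff list_ex_iff)

lemma computable_subset_list [computable_intros]:
  assumes "computable f" "computable g"
  shows "computable (\<lambda>x. subset_list (f x) (g x))"
proof (rule computable_comp_env[OF _ assms])
  show "computable (\<lambda>z. subset_list (fst z) (snd z))"
    unfolding subset_list_def by (intro computable_intros)
qed

lemma word_pow_rec: "word_pow w n = rec_nat [] (\<lambda>_ r. w @ r) n"
  by (induction n) (auto simp: word_pow_Suc)

lemma computable_word_pow [computable_intros]:
  assumes "computable f" "computable g"
  shows "computable (\<lambda>x. word_pow (f x) (g x))"
proof (rule computable_comp_env[OF _ assms])
  show "computable (\<lambda>z. word_pow (fst z) (snd z))"
    unfolding word_pow_rec by (intro computable_intros)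
qed

lemma wrap_foldr:
  "wrap N s efs = foldr (\<lambda>ef r. word_pow (fst ef) N @ r @ word_pow (snd ef) N) efs s"
  by (induction N s efs rule: wrap.induct) auto

lemma computable_wrap [computable_intros]:
  assumes "computable f" "computable g" "computable h"
  shows "computable (\<lambda>x. wrap (f x) (g x) (h x))"
proof -
  have "computable (\<lambda>z. wrap (fst z) (fst (snd z)) (snd (snd z)))"
    unfolding wrap_foldr by (intro computable_intros)
  from computable_comp[OF this computable_Pair[OF assms(1) computable_Pair[OF assms(2,3)]]]
  show ?thesis by simp
qed

text \<open>The condition on a pair refers to the word that it encloses, so one fold computes this
  word along with the truth value.\<close>

definition nested_step :: "nat list \<times> nat list \<Rightarrow> bool \<times> nat list \<Rightarrow> bool \<times> nat list" where
  "nested_step ef r =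
    (fst r \<and> subset_list (snd r) (fst ef) \<and> subset_list (snd r) (snd ef),
     word_pow (fst ef) 1 @ snd r @ word_pow (snd ef) 1)"

lemma nested_foldr: "nested s efs \<longleftrightarrow> fst (foldr nested_step efs (True, s))"
proof -
  have "foldr nested_step efs (True, s) = (nested s efs, wrap 1 s efs)"
    by (induction s efs rule: nested.induct) (auto simp: nested_step_def subset_list_iff)
  then show ?thesis by simp
qed

lemma computable_nested [computable_intros]:
  assumes "computable f" "computable g"
  shows "computable (\<lambda>x. nested (f x :: nat list) (g x))"
proof (rule computable_comp_env[OF _ assms])
  show "computable (\<lambda>z. nested (fst z :: nat list) (snd z))"
    unfolding nested_foldr nested_step_def by (intro computable_intros)
qed

definition words_upto :: "nat list \<Rightarrow> nat \<Rightarrow> nat list list" where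
  "words_upto al K = rec_nat [[]] (\<lambda>_ ws. [] # concat (map (\<lambda>a. map (\<lambda>w. a # w) ws) al)) K"

lemma set_words_upto: "set (words_upto al K) = test_words (set al) K"
proof (induction K)
  case 0
  show ?case by (auto simp: words_upto_def test_words_def)
next
  case (Suc K)
  have "set (words_upto al (Suc K)) = insert [] {a # w |a w. a \<in> set al \<and> w \<in> test_words (set al) K}"
    using Suc by (auto simp: words_upto_def)
  also have "\<dots> = test_words (set al) (Suc K)"
  proof (intro set_eqI)
    fix w
    show "w \<in> insert [] {a # w |a w. a \<in> set al \<and> w \<in> test_words (set al) K} \<longleftrightarrow>
        w \<in> test_words (set al) (Suc K)"
      by (cases w) (auto simp: test_words_def)
  qed
  finally show ?case .
qed

lemma computable_words_upto [computable_intros]: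
  assumes "computable f" "computable g"
  shows "computable (\<lambda>x. words_upto (f x) (g x))"
proof (rule computable_comp_env[OF _ assms])
  show "computable (\<lambda>z. words_upto (fst z) (snd z))"
    unfolding words_upto_def by (intro computable_intros)
qed

definition frames :: "nat list list \<Rightarrow> nat \<Rightarrow> (nat list \<times> nat list) list list" where
  "frames ws k = rec_nat [[]]
    (\<lambda>_ r. concat (map (\<lambda>e. concat (map (\<lambda>f. map (\<lambda>t. (e, f) # t) r) ws)) ws)) k"

lemma set_frames: "set (frames ws k) = {efs. length efs = k \<and> set efs \<subseteq> set ws \<times> set ws}"
proof (induction k)
  case 0
  show ?case by (auto simp: frames_def)
next
  case (Suc k)
  have "set (frames ws (Suc k)) =
      {(e, f) # t |e f t. e \<in> set ws \<and> f \<in> set ws \<and> t \<in> set (frames ws k)}"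
    by (auto simp: frames_def)
  also have "\<dots> = {efs. length efs = Suc k \<and> set efs \<subseteq> set ws \<times> set ws}"
  proof (intro set_eqI)
    fix efs :: "(nat list \<times> nat list) list"
    show "efs \<in> {(e, f) # t |e f t. e \<in> set ws \<and> f \<in> set ws \<and> t \<in> set (frames ws k)} \<longleftrightarrow>
        efs \<in> {efs. length efs = Suc k \<and> set efs \<subseteq> set ws \<times> set ws}"
      unfolding Suc by (cases efs) auto
  qed
  finally show ?case .
qed

lemma computable_frames [computable_intros]:
  assumes "computable f" "computable g"
  shows "computable (\<lambda>x. frames (f x) (g x))"
proof (rule computable_comp_env[OF _ assms])
  show "computable (\<lambda>z. frames (fst z) (snd z))"
    unfolding frames_def by (intro computable_intros)
qed

text \<open>The subset construction, with sets of states as lists.\<close>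

definition successors :: "(nat \<times> nat \<times> nat) list \<Rightarrow> nat list \<Rightarrow> nat \<Rightarrow> nat list" where
  "successors tr S a =
    map (\<lambda>t. snd (snd t)) (filter (\<lambda>t. fst (snd t) = a \<and> list_ex (\<lambda>p. fst t = p) S) tr)"

definition accepts :: "machine \<Rightarrow> nat list \<Rightarrow> bool" where
  "accepts M w \<longleftrightarrow> list_ex (\<lambda>q. list_ex (\<lambda>p. q = p) (fst (snd (snd M))))
    (foldl (successors (snd (snd (snd M)))) (fst (snd M)) w)"

lemma set_foldl_successors:
  "set (foldl (successors tr) S w) = {q. \<exists>p \<in> set S. run (set tr) p w q}"
proof (induction w arbitrary: S)
  case (Cons a w)
  have "set (successors tr S a) = {r. \<exists>p \<in> set S. (p, a, r) \<in> set tr}"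
    by (force simp: successors_def list_ex_iff)
  then show ?case by (auto simp: Cons.IH)
qed simp

text \<open>\<open>accepts\<close> never consults the alphabet and agrees with
  \<open>language\<close> only on words over it; the procedure tests no other words.\<close>

lemma accepts_iff:
  assumes "w \<in> lists (set (alphabet M))"
  shows "accepts (machine_of M) w \<longleftrightarrow> w \<in> language M"
  using assms by (auto simp: accepts_def machine_of_def language_def list_ex_iff set_foldl_successors)

lemma computable_accepts [computable_intros]:
  assumes "computable f" "computable g"
  shows "computable (\<lambda>x. accepts (f x) (g x))"
proof (rule computable_comp_env[OF _ assms])
  show "computable (\<lambda>z. accepts (fst z) (snd z))"
    unfolding accepts_def successors_def by (intro computable_intros)
qed

lemma computable_test_length [computable_intros]:
  assumes "computable f"
  shows "computable (\<lambda>x. test_length (f x))"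
proof (rule computable_comp[OF _ assms])
  show "computable test_length"
    unfolding test_length_def states_def case_prod_beta by (intro computable_intros)
qed

definition all_contexts :: "machine \<Rightarrow> nat list list \<Rightarrow> nat list \<Rightarrow> nat list \<Rightarrow> bool" where
  "all_contexts M ws u v \<longleftrightarrow>
    list_all (\<lambda>x. list_all (\<lambda>y. accepts M (x @ u @ y) = accepts M (x @ v @ y)) ws) ws"

lemma computable_all_contexts [computable_intros]:
  assumes "computable f" "computable g" "computable h" "computable k"
  shows "computable (\<lambda>x. all_contexts (f x) (g x) (h x) (k x))"
proof -
  have "computable (\<lambda>z. all_contexts (fst z) (fst (snd z)) (fst (snd (snd z))) (snd (snd (snd z))))"
    unfolding all_contexts_def by (intro computable_intros)
  from computable_comp[OF this computable_Pair[OF assms(1) computable_Pair[OF assms(2)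
    computable_Pair[OF assms(3,4)]]]]
  show ?thesis by simp
qed

definition test_machine :: "nat \<Rightarrow> machine \<Rightarrow> nat list list \<Rightarrow> nat \<Rightarrow> bool" where
  "test_machine k M ws K \<longleftrightarrow>
    list_all (\<lambda>e. list_all (\<lambda>s. subset_list s e \<longrightarrow>
      all_contexts M ws (word_pow e K @ s @ word_pow e K) (word_pow e K)) ws) ws \<and>
    list_all (\<lambda>efs. list_all (\<lambda>s. nested s efs \<longrightarrow>
      all_contexts M ws (wrap K s efs) (wrap K [] efs)) ws) (frames ws k)"

definition decider :: "nat \<Rightarrow> machine \<Rightarrow> bool" where
  "decider k M \<longleftrightarrow> test_machine k M (words_upto (fst M) (test_length M)) (test_length M)"

lemma computable_decider: "computable (decider k)"
proof -
  have "computable (\<lambda>z. test_machine k (fst z) (fst (snd z)) (snd (snd z)))"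
    unfolding test_machine_def by (intro computable_intros)
  moreover have "computable (\<lambda>M :: machine. (M, words_upto (fst M) (test_length M), test_length M))"
    by (intro computable_intros)
  ultimately have "computable (\<lambda>M. test_machine k M (words_upto (fst M) (test_length M)) (test_length M))"
    using computable_comp by fastforce
  then show ?thesis by (simp add: decider_def[abs_def])
qed

lemma wrap_in_lists:
  assumes "set efs \<subseteq> lists A \<times> lists A" "s \<in> lists A"
  shows "wrap N s efs \<in> lists A"
  using assms by (induction N s efs rule: wrap.induct) (auto simp: set_word_pow split: if_splits)

lemma decider_iff:
  "decider k (machine_of M) \<longleftrightarrow>
    passes_tests (set (alphabet M)) k (test_length (machine_of M)) (language M)"
proof -
  define A where "A = set (alphabet M)"
  define K where "K = test_length (machine_of M)"
  define ws where "ws = words_upto (alphabet M) K"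
  have ws: "set ws = test_words A K" by (simp add: ws_def A_def set_words_upto)
  have in_A: "w \<in> lists A" if "w \<in> test_words A K" for w
    using that by (simp add: test_words_def)
  have contexts: "all_contexts (machine_of M) ws u v \<longleftrightarrow>
      (\<forall>x \<in> test_words A K. \<forall>y \<in> test_words A K.
        x @ u @ y \<in> language M \<longleftrightarrow> x @ v @ y \<in> language M)"
    if uv: "u \<in> lists A" "v \<in> lists A" for u v
  proof -
    have "accepts (machine_of M) (x @ w @ y) \<longleftrightarrow> x @ w @ y \<in> language M"
      if "x \<in> test_words A K" "y \<in> test_words A K" "w \<in> lists A" for x w y
      using that in_A by (intro accepts_iff) (simp add: A_def)
    then show ?thesis using uv by (simp add: all_contexts_def list_all_iff ws)
  qed
  have absorb: "all_contexts (machine_of M) ws (word_pow e K @ s @ word_pow e K) (word_pow e K) \<longleftrightarrow>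
      (\<forall>x \<in> test_words A K. \<forall>y \<in> test_words A K.
        x @ word_pow e K @ s @ word_pow e K @ y \<in> language M \<longleftrightarrow> x @ word_pow e K @ y \<in> language M)"
    if "e \<in> test_words A K" "s \<in> test_words A K" for e s
    using contexts[of "word_pow e K @ s @ word_pow e K" "word_pow e K"] in_A that
    by (simp add: word_pow_in_lists)
  have wrap: "all_contexts (machine_of M) ws (wrap K s efs) (wrap K [] efs) \<longleftrightarrow>
      (\<forall>x \<in> test_words A K. \<forall>y \<in> test_words A K.
        x @ wrap K s efs @ y \<in> language M \<longleftrightarrow> x @ wrap K [] efs @ y \<in> language M)"
    if "set efs \<subseteq> test_words A K \<times> test_words A K" "s \<in> test_words A K" for efs s
  proof (rule contexts)
    have "set efs \<subseteq> lists A \<times> lists A" using that in_A by blast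
    from wrap_in_lists[OF this] in_A[OF that(2)]
    show "wrap K s efs \<in> lists A" "wrap K [] efs \<in> lists A" by blast+
  qed
  have "decider k (machine_of M) \<longleftrightarrow> test_machine k (machine_of M) ws K"
    by (simp add: decider_def ws_def K_def machine_of_def)
  also have "\<dots> \<longleftrightarrow> passes_tests A k K (language M)"
  proof -
    let ?T = "test_words A K"
    have "(\<forall>e \<in> ?T. \<forall>s \<in> ?T. set s \<subseteq> set e \<longrightarrow>
        all_contexts (machine_of M) ws (word_pow e K @ s @ word_pow e K) (word_pow e K)) \<longleftrightarrow>
      (\<forall>e \<in> ?T. \<forall>s \<in> ?T. \<forall>x \<in> ?T. \<forall>y \<in> ?T. set s \<subseteq> set e \<longrightarrow>
        (x @ word_pow e K @ s @ word_pow e K @ y \<in> language M \<longleftrightarrow> x @ word_pow e K @ y \<in> language M))"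
      using absorb by (intro ball_cong refl) auto
    moreover have "(\<forall>efs \<in> {efs. length efs = k \<and> set efs \<subseteq> ?T \<times> ?T}. \<forall>s \<in> ?T. nested s efs \<longrightarrow>
        all_contexts (machine_of M) ws (wrap K s efs) (wrap K [] efs)) \<longleftrightarrow>
      (\<forall>efs. length efs = k \<longrightarrow> set efs \<subseteq> ?T \<times> ?T \<longrightarrow>
        (\<forall>s \<in> ?T. \<forall>x \<in> ?T. \<forall>y \<in> ?T. nested s efs \<longrightarrow>
          (x @ wrap K s efs @ y \<in> language M \<longleftrightarrow> x @ wrap K [] efs @ y \<in> language M)))"
      (is "(\<forall>efs \<in> _. \<forall>s \<in> _. ?P efs s) \<longleftrightarrow> (\<forall>efs. _ \<longrightarrow> _ \<longrightarrow> (\<forall>s \<in> _. ?Q efs s))")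
    proof -
      have "?P efs s \<longleftrightarrow> ?Q efs s" if "set efs \<subseteq> ?T \<times> ?T" "s \<in> ?T" for efs s
        using wrap[OF that] by auto
      then show ?thesis by (simp add: Ball_def imp_conjL)
    qed
    ultimately show ?thesis
      unfolding test_machine_def passes_tests_def list_all_iff set_frames ws subset_list_iff
      by (rule arg_cong2[where f = conj])
  qed
  finally show ?thesis by (simp add: A_def K_def)
qed

section \<open>From codes of automata to codes of machines\<close>

lemma enc_transition: "enc t = transition_code t" for t :: "nat \<times> nat \<times> nat"
  by (cases t) (simp add: enc_prod_def enc_nat_def transition_code_def)

text \<open>\<open>automaton_code\<close> codes a list of four entries, \<open>enc\<close> of a
  machine nested pairs; \<open>r\<close> converts the first into the second.\<close>

lemma decidable_automaton_code:
  assumes "computable D"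
  shows "decidable automaton_code (\<lambda>M. D (machine_of M))"
proof -
  obtain g where g: "recfun (Suc 0) (\<lambda>xs. g (xs ! 0))" "\<And>x. g (enc x) = enc (D x)"
    using assms unfolding computable_def by blast
  define hd' where "hd' z = fst (prod_decode (z - 1))" for z :: nat
  define tl' where "tl' z = snd (prod_decode (z - 1))" for z :: nat
  define r where "r z = prod_encode (hd' z, prod_encode (hd' (tl' z),
    prod_encode (hd' (tl' (tl' z)), hd' (tl' (tl' (tl' z))))))" for z
  have "recfun (Suc 0) (\<lambda>xs. r (xs ! 0))"
    unfolding r_def hd'_def tl'_def
    by (intro recfun_prod_encode recfun_prod_decode recfun_diff recfun_proj recfun_const) simp_all
  from recfun_comp1[OF _ this, of "\<lambda>xs. g (xs ! 0)"] g(1)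
  have "recfun 1 (\<lambda>xs. g (r (xs ! 0)))" by simp
  then obtain f where f: "general_recursive 1 f" "\<And>xs. length xs = 1 \<Longrightarrow> f xs = g (r (xs ! 0))"
    unfolding recfun_def by blast
  have "r (automaton_code M) = enc (machine_of M)" for M
    by (simp add: r_def hd'_def tl'_def automaton_code_def machine_of_def enc_prod_def enc_list_def
        enc_nat_def[abs_def] enc_transition[abs_def, symmetric])
  then have "f [automaton_code M] = (if D (machine_of M) then 1 else 0)" for M
    using f(2)[of "[automaton_code M]"] g(2)[of "machine_of M"] by (simp add: enc_bool_def)
  then show ?thesis using f(1) unfolding decidable_def by blast
qed

theorem mainTheorem6:
  fixes m :: nat
  assumes "m \<ge> 2"
  shows "decidable automaton_code (\<lambda>M. language M \<in> W (set (alphabet M)) m)"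
proof -
  \<comment> \<open>Level \<open>m\<close> corresponds to identities with \<open>m - 1\<close>
    nested pairs, of which there is at least one.\<close>
  obtain k where m: "m = Suc (Suc k)"
    using assms by (metis add_2_eq_Suc le_Suc_ex)
  have "decidable automaton_code (\<lambda>M. decider (Suc k) (machine_of M))"
    by (rule decidable_automaton_code) (rule computable_decider)
  then show ?thesis unfolding m language_in_W_iff decider_iff .
qed

end
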